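(* Suppose that $m\geq n>2$. For each $n$ define $$t_n=\sum_{A\subseteq[m],\ |A|=n}r_A.$$ Then $$\mathcal{VR}(\mathcal{F}^m_{\leq n},2)\simeq \Big(\bigvee_{t_n} S^3\Big)\vee \mathcal{VR}(\mathcal{F}^m_{\leq n-1},2).$$ Therefore, $\mathcal{VR}(\mathcal{F}^m_{\leq n},2)$ is homotopy equivalent to the wedge sum of $\sum_{k=3}^n t_k$ copies of $S^3$.
   Context: $[m]=\{1,\dots,m\}$. Any collection of subsets of $[m]$ is a finite metric space with $d(A,B)=|A\Delta B|$ (size of the symmetric difference). $\mathcal{F}^m_{\le n}$ is the collection of all subsets of $[m]$ (including $\emptyset$) of cardinality at most $n$. For a metric space $X$ and $r\ge 0$, the Vietoris-Rips complex $\mathcal{VR}(X,r)$ is the simplicial complex with vertex set $X$ whose simplices are the nonempty finite subsets of $X$ of diameter at most $r$. For $A=\{i_1<\cdots<i_n\}\subseteq[m]$, set $d_1=i_1$ and $d_\ell=i_\ell-(i_{\ell-1}+1)$ for $\ell=2,\dots,n$, and $$r_A= \sum_{k=2}^{n-2}\binom{k}{2}+\sum_{\ell=1}^{n-2}d_{\ell}\binom{n-\ell}{2},$$ where a sum whose upper limit is less than its lower limit is $0$. $\simeq$ denotes homotopy equivalence (of geometric realizations), $\vee$ wedge sum, and $\bigvee_k X$ the wedge sum of $k$ copies of $X$. *)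

theory Defs
  imports "HOL-Analysis.Analysis"
begin

section \<open>Geometric realization of an abstract simplicial complex\<close>

text \<open>A complex is given by its set of simplices. Points of the realization are
  represented by barycentric coordinates, i.e. functions on the vertex type.\<close>

definition closed_simplex :: "'a set \<Rightarrow> ('a \<Rightarrow> real) set" where
  "closed_simplex \<sigma> = {f. (\<forall>v. 0 \<le> f v) \<and> (\<forall>v. v \<notin> \<sigma> \<longrightarrow> f v = 0) \<and> sum f \<sigma> = 1}"

text \<open>The realization carries the weak topology with respect to its closed simplices; each closed
  simplex has the subspace topology of the product topology, which on the finite-dimensional space
  spanned by a finite \<open>\<sigma>\<close> is the Euclidean one.\<close>

definition geometric_realization :: "'a set set \<Rightarrow> ('a \<Rightarrow> real) topology" where
  "geometric_realization K =
     topology (\<lambda>U. U \<subseteq> (\<Union>\<sigma>\<in>K. closed_simplex \<sigma>) \<and>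
       (\<forall>\<sigma>\<in>K. openin (top_of_set (closed_simplex \<sigma>)) (U \<inter> closed_simplex \<sigma>)))"

lemma istopology_geometric_realization:
  "istopology (\<lambda>U. U \<subseteq> (\<Union>\<sigma>\<in>K. closed_simplex \<sigma>) \<and>
       (\<forall>\<sigma>\<in>K. openin (top_of_set (closed_simplex \<sigma>)) (U \<inter> closed_simplex \<sigma>)))"
proof -
  have 1: "openin (top_of_set C) (S \<inter> T \<inter> C)"
    if "openin (top_of_set C) (S \<inter> C)" "openin (top_of_set C) (T \<inter> C)" for S T C :: "('a \<Rightarrow> real) set"
  proof -
    have "S \<inter> T \<inter> C = (S \<inter> C) \<inter> (T \<inter> C)"
      by blast
    then show ?thesis
      using openin_Int[OF that] by simp
  qed
  have 2: "openin (top_of_set C) (\<Union>\<K> \<inter> C)"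
    if "\<forall>S\<in>\<K>. openin (top_of_set C) (S \<inter> C)" for \<K> and C :: "('a \<Rightarrow> real) set"
  proof -
    have *: "\<Union>\<K> \<inter> C = (\<Union>S\<in>\<K>. S \<inter> C)"
      by blast
    show ?thesis
      unfolding * using that by (intro openin_Union) blast
  qed
  show ?thesis
    unfolding istopology_def
  proof (intro conjI allI impI)
    fix S T :: "('a \<Rightarrow> real) set"
    assume "S \<subseteq> (\<Union>\<sigma>\<in>K. closed_simplex \<sigma>) \<and>
       (\<forall>\<sigma>\<in>K. openin (top_of_set (closed_simplex \<sigma>)) (S \<inter> closed_simplex \<sigma>))"
      and "T \<subseteq> (\<Union>\<sigma>\<in>K. closed_simplex \<sigma>) \<and>
       (\<forall>\<sigma>\<in>K. openin (top_of_set (closed_simplex \<sigma>)) (T \<inter> closed_simplex \<sigma>))"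
    then show "S \<inter> T \<subseteq> (\<Union>\<sigma>\<in>K. closed_simplex \<sigma>)"
      and "\<forall>\<sigma>\<in>K. openin (top_of_set (closed_simplex \<sigma>)) (S \<inter> T \<inter> closed_simplex \<sigma>)"
      using 1 by blast+
  next
    fix \<K> :: "('a \<Rightarrow> real) set set"
    assume "\<forall>S\<in>\<K>. S \<subseteq> (\<Union>\<sigma>\<in>K. closed_simplex \<sigma>) \<and>
       (\<forall>\<sigma>\<in>K. openin (top_of_set (closed_simplex \<sigma>)) (S \<inter> closed_simplex \<sigma>))"
    then show "\<Union>\<K> \<subseteq> (\<Union>\<sigma>\<in>K. closed_simplex \<sigma>)"
      and "\<forall>\<sigma>\<in>K. openin (top_of_set (closed_simplex \<sigma>)) (\<Union>\<K> \<inter> closed_simplex \<sigma>)"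
      using 2 by blast+
  qed
qed

lemma openin_geometric_realization:
  "openin (geometric_realization K) U \<longleftrightarrow>
     U \<subseteq> (\<Union>\<sigma>\<in>K. closed_simplex \<sigma>) \<and>
     (\<forall>\<sigma>\<in>K. openin (top_of_set (closed_simplex \<sigma>)) (U \<inter> closed_simplex \<sigma>))"
  by (simp add: geometric_realization_def istopology_geometric_realization)

lemma topspace_geometric_realization [simp]:
  "topspace (geometric_realization K) = (\<Union>\<sigma>\<in>K. closed_simplex \<sigma>)"
proof -
  have "openin (geometric_realization K) (\<Union>\<sigma>\<in>K. closed_simplex \<sigma>)"
    unfolding openin_geometric_realization
  proof (intro conjI ballI)
    fix \<sigma> assume "\<sigma> \<in> K"
    then have "(\<Union>\<sigma>\<in>K. closed_simplex \<sigma>) \<inter> closed_simplex \<sigma> = closed_simplex \<sigma>"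
      by blast
    then show "openin (top_of_set (closed_simplex \<sigma>))
                 ((\<Union>\<sigma>\<in>K. closed_simplex \<sigma>) \<inter> closed_simplex \<sigma>)"
      by simp
  qed simp
  then show ?thesis
    by (metis openin_geometric_realization openin_subset openin_topspace subset_antisym)
qed


section \<open>Vietoris-Rips complexes\<close>

text \<open>Used for \<open>X\<close>, \<open>d\<close> with \<^prop>\<open>Metric_space X d\<close>. For finite nonempty \<open>\<sigma>\<close> the diameter is the
  maximum of the pairwise distances.\<close>

definition vietoris_rips :: "'a set \<Rightarrow> ('a \<Rightarrow> 'a \<Rightarrow> real) \<Rightarrow> real \<Rightarrow> 'a set set" where
  "vietoris_rips X d r =
     {\<sigma>. \<sigma> \<subseteq> X \<and> finite \<sigma> \<and> \<sigma> \<noteq> {} \<and> Max {d x y | x y. x \<in> \<sigma> \<and> y \<in> \<sigma>} \<le> r}"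

definition symdiff_dist :: "'a set \<Rightarrow> 'a set \<Rightarrow> real" where
  "symdiff_dist A B = real (card (sym_diff A B))"

definition subsets_upto :: "nat \<Rightarrow> nat \<Rightarrow> nat set set" where
  "subsets_upto m n = {A. A \<subseteq> {1..m} \<and> card A \<le> n}"

lemma Metric_space_subsets_upto: "Metric_space (subsets_upto m n) symdiff_dist"
proof
  show "0 \<le> symdiff_dist A B" for A B :: "nat set"
    by (simp add: symdiff_dist_def)
  show "symdiff_dist A B = symdiff_dist B A" for A B :: "nat set"
    by (simp add: symdiff_dist_def Un_commute)
  have fin: "finite A" if "A \<in> subsets_upto m n" for A
    using that finite_subset by (auto simp: subsets_upto_def)
  show "symdiff_dist A B = 0 \<longleftrightarrow> A = B"
    if "A \<in> subsets_upto m n" "B \<in> subsets_upto m n" for A B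
    using fin[OF that(1)] fin[OF that(2)] by (auto simp: symdiff_dist_def)
  show "symdiff_dist A C \<le> symdiff_dist A B + symdiff_dist B C"
    if "A \<in> subsets_upto m n" "B \<in> subsets_upto m n" "C \<in> subsets_upto m n" for A B C
  proof -
    have "card (sym_diff A C) \<le> card (sym_diff A B \<union> sym_diff B C)"
      using that fin by (intro card_mono) auto
    also have "\<dots> \<le> card (sym_diff A B) + card (sym_diff B C)"
      by (rule card_Un_le)
    finally show ?thesis
      by (simp add: symdiff_dist_def)
  qed
qed

definition VR_subsets :: "nat \<Rightarrow> nat \<Rightarrow> real \<Rightarrow> (nat set \<Rightarrow> real) topology" where
  "VR_subsets m n r = geometric_realization (vietoris_rips (subsets_upto m n) symdiff_dist r)"


section \<open>Wedge sums\<close>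

text \<open>The final (quotient) topology on \<open>S\<close> induced by a map \<open>f\<close> from \<open>X\<close> to \<open>S\<close>.\<close>

definition final_topology :: "'b set \<Rightarrow> 'a topology \<Rightarrow> ('a \<Rightarrow> 'b) \<Rightarrow> 'b topology" where
  "final_topology S X f = topology (\<lambda>U. U \<subseteq> S \<and> openin X {x \<in> topspace X. f x \<in> U})"

lemma istopology_final: "istopology (\<lambda>U. U \<subseteq> S \<and> openin X {x \<in> topspace X. f x \<in> U})"
proof -
  have 1: "{x \<in> topspace X. f x \<in> U \<inter> V} = {x \<in> topspace X. f x \<in> U} \<inter> {x \<in> topspace X. f x \<in> V}"
    for U V by blast
  have 2: "{x \<in> topspace X. f x \<in> \<Union>\<K>} = (\<Union>U\<in>\<K>. {x \<in> topspace X. f x \<in> U})" for \<K>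
    by blast
  show ?thesis
    unfolding istopology_def 1 2 by blast
qed

lemma openin_final_topology:
  "openin (final_topology S X f) U \<longleftrightarrow> U \<subseteq> S \<and> openin X {x \<in> topspace X. f x \<in> U}"
  by (simp add: final_topology_def istopology_final)

lemma topspace_final_topology:
  assumes "f ` topspace X \<subseteq> S"
  shows "topspace (final_topology S X f) = S"
proof -
  have "{x \<in> topspace X. f x \<in> S} = topspace X"
    using assms by blast
  then have "openin (final_topology S X f) S"
    by (simp add: openin_final_topology)
  then show ?thesis
    by (metis openin_final_topology openin_subset openin_topspace subset_antisym)
qed

text \<open>Wedge of a family of pointed spaces \<open>(X i, p i)\<close>: \<open>None\<close> is the common image of the
  base points. The wedge of the empty family is a one-point space.\<close>

definition wedge_collapse :: "('i \<Rightarrow> 'a) \<Rightarrow> 'i \<times> 'a \<Rightarrow> ('i \<times> 'a) option" where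
  "wedge_collapse p = (\<lambda>(i, x). if x = p i then None else Some (i, x))"

definition wedge_family :: "('i \<Rightarrow> 'a topology) \<Rightarrow> ('i \<Rightarrow> 'a) \<Rightarrow> 'i set \<Rightarrow> ('i \<times> 'a) option topology" where
  "wedge_family X p I =
     final_topology (insert None (wedge_collapse p ` topspace (sum_topology X I)))
       (sum_topology X I) (wedge_collapse p)"

text \<open>Wedge of two pointed spaces over different types: the quotient of their disjoint union
  which identifies \<open>Inr q\<close> with \<open>Inl p\<close>.\<close>

definition disjoint_union :: "'a topology \<Rightarrow> 'b topology \<Rightarrow> ('a + 'b) topology" where
  "disjoint_union X Y = topology (\<lambda>U. openin X (Inl -` U) \<and> openin Y (Inr -` U))"

lemma istopology_disjoint_union:
  "istopology (\<lambda>U. openin X (Inl -` U) \<and> openin Y (Inr -` U))"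
  unfolding istopology_def vimage_Int vimage_Union by blast

lemma openin_disjoint_union_iff:
  "openin (disjoint_union X Y) U \<longleftrightarrow> openin X (Inl -` U) \<and> openin Y (Inr -` U)"
  by (simp add: disjoint_union_def istopology_disjoint_union)

lemma topspace_disjoint_union: "topspace (disjoint_union X Y) = topspace X <+> topspace Y"
proof (rule subset_antisym)
  have "openin X (Inl -` topspace (disjoint_union X Y))" "openin Y (Inr -` topspace (disjoint_union X Y))"
    using openin_topspace[of "disjoint_union X Y"] by (simp_all only: openin_disjoint_union_iff)
  then have *: "Inl -` topspace (disjoint_union X Y) \<subseteq> topspace X"
      "Inr -` topspace (disjoint_union X Y) \<subseteq> topspace Y"
    by (simp_all add: openin_subset)
  show "topspace (disjoint_union X Y) \<subseteq> topspace X <+> topspace Y"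
  proof
    fix z assume "z \<in> topspace (disjoint_union X Y)"
    then show "z \<in> topspace X <+> topspace Y"
      using * by (cases z) auto
  qed
  have "Inl -` (topspace X <+> topspace Y) = topspace X" "Inr -` (topspace X <+> topspace Y) = topspace Y"
    by auto
  then have "openin (disjoint_union X Y) (topspace X <+> topspace Y)"
    by (simp add: openin_disjoint_union_iff)
  then show "topspace X <+> topspace Y \<subseteq> topspace (disjoint_union X Y)"
    by (rule openin_subset)
qed

definition wedge_identify :: "'a \<Rightarrow> 'b \<Rightarrow> 'a + 'b \<Rightarrow> 'a + 'b" where
  "wedge_identify p q z = (if z = Inr q then Inl p else z)"

definition wedge :: "'a topology \<Rightarrow> 'a \<Rightarrow> 'b topology \<Rightarrow> 'b \<Rightarrow> ('a + 'b) topology" where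
  "wedge X p Y q =
     final_topology (wedge_identify p q ` topspace (disjoint_union X Y))
       (disjoint_union X Y) (wedge_identify p q)"

text \<open>\<open>sphere_bouquet d k\<close> is the wedge of \<open>k\<close> copies of the \<open>d\<close>-sphere with base point \<open>None\<close>.\<close>

definition sphere_bouquet :: "nat \<Rightarrow> nat \<Rightarrow> (nat \<times> (nat \<Rightarrow> real)) option topology" where
  "sphere_bouquet d k = wedge_family (\<lambda>_. nsphere d) (\<lambda>_ i. if i = 0 then 1 else 0) {..<k}"


section \<open>The numbers \<open>r\<^sub>A\<close> and \<open>t\<^sub>n\<close>\<close>

text \<open>\<open>elt A l\<close> is the \<open>l\<close>-th smallest element of \<open>A\<close>, counting from 1.\<close>

definition elt :: "nat set \<Rightarrow> nat \<Rightarrow> nat" where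
  "elt A l = sorted_list_of_set A ! (l - 1)"

text \<open>For \<open>2 \<le> l \<le> card A\<close> the subtraction does not truncate.\<close>

definition gap :: "nat set \<Rightarrow> nat \<Rightarrow> nat" where
  "gap A l = (if l = 1 then elt A 1 else elt A l - (elt A (l - 1) + 1))"

definition r_coeff :: "nat set \<Rightarrow> nat" where
  "r_coeff A = (let n = card A in
     (\<Sum>k = 2..n - 2. k choose 2) + (\<Sum>l = 1..n - 2. gap A l * ((n - l) choose 2)))"

definition t_coeff :: "nat \<Rightarrow> nat \<Rightarrow> nat" where
  "t_coeff m n = (\<Sum>A | A \<subseteq> {1..m} \<and> card A = n. r_coeff A)"

end

theory Submission
  imports Defs
begin

text \<open>For finite complexes a discrete Morse matching whose critical simplices, apart from one vertex, all
  have dimension \<open>d\<close> exhibits the complex as a bouquet of \<open>d\<close>-spheres: collapse the pairs above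
  dimension \<open>d\<close> first; what remains is a collapsible complex with one \<open>d\<close>-simplex for every critical
  simplex attached, and collapsing the contractible part to a point turns each of these into a sphere.

  The Vietoris-Rips complex is built by adding the sets \<open>A\<close> of size \<open>n\<close> in the order of increasing element
  sums. The link of \<open>A\<close> at that moment consists of the vertices \<open>A - {i}\<close>, \<open>A - {i, j}\<close> and
  \<open>insert x (A - {i})\<close> for \<open>x < i\<close>. Removing from the star of \<open>A\<close> the critical simplices, spanned by \<open>A\<close>
  and the sets that arise from it by removing or exchanging two elements of a suitable triple, leaves
  a complex which collapses onto the previous one, and the number of critical simplices is \<open>r_coeff A\<close>.

  Attaching a bouquet at different points of a path-connected space gives homotopy equivalent wedges,
  because a sphere can be stretched along a path. Hence the wedge in the statement may be taken at
  a vertex, where it is a bouquet of the right number of spheres.\<close>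

section \<open>Reductions of simplicial complexes\<close>

text \<open>A new vertex \<open>A\<close> enters as the cone over its link, so everything is decided
  there: two distinct pairs are adjacent in the link exactly when they meet. A triangle
  \<open>{p, q}\<close>, \<open>{q, r}\<close>, \<open>{p, r}\<close> is a facet of the link, and
  with the apex \<open>A\<close> it becomes the tetrahedron behind an \<open>S^3\<close>. The number
  \<open>(n choose 3)\<close> plus one \<open>(c - 1 choose 2)\<close> for each \<open>x\<close>
  outside \<open>A\<close> with \<open>c\<close> elements of \<open>A\<close> above it is a
  regrouping of \<open>r_coeff A\<close>.

  No attaching map is shown to be null-homotopic. All critical simplices have dimension 3, so the
  reductions, continued down to the vertex \<open>{}\<close>, yield bouquets, and the wedge formula
  compares two of them by counting spheres. The price is the base point: these equivalences are
  pointed only at \<open>{}\<close>, while the theorem allows every point of the smaller complex.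

  All spaces are handled as subsets of function spaces, a wedge as two axes in a product. The
  quotient topologies of the definitions are left behind by one argument: a continuous bijection
  from a compact space onto a Hausdorff space is a homeomorphism.\<close>

definition abstract_complex :: "'a set set \<Rightarrow> bool" where
  "abstract_complex K \<longleftrightarrow> finite K \<and> (\<forall>\<sigma>\<in>K. finite \<sigma> \<and> \<sigma> \<noteq> {} \<and> (\<forall>\<tau>\<subseteq>\<sigma>. \<tau> \<noteq> {} \<longrightarrow> \<tau> \<in> K))"

text \<open>\<open>collapse\<close> is an elementary collapse through a free face and
  \<open>critical\<close> deletes a facet with \<open>Suc d\<close> vertices; the number counts the
  latter. Read from the top, a derivation is a discrete Morse matching together with the order of
  removal, so acyclicity is built in.\<close>

inductive reduces :: "nat \<Rightarrow> 'a set set \<Rightarrow> nat \<Rightarrow> 'a set set \<Rightarrow> bool" for d :: nat where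
  stop: "reduces d K 0 K"
| collapse: "\<lbrakk>\<sigma> \<in> K; v \<notin> \<sigma>; insert v \<sigma> \<in> K; \<And>\<tau>. \<lbrakk>\<tau> \<in> K; \<sigma> \<subseteq> \<tau>\<rbrakk> \<Longrightarrow> \<tau> = \<sigma> \<or> \<tau> = insert v \<sigma>;
     reduces d (K - {\<sigma>, insert v \<sigma>}) N K'\<rbrakk> \<Longrightarrow> reduces d K N K'"
| critical: "\<lbrakk>\<sigma> \<in> K; card \<sigma> = Suc d; \<And>\<tau>. \<lbrakk>\<tau> \<in> K; \<sigma> \<subseteq> \<tau>\<rbrakk> \<Longrightarrow> \<tau> = \<sigma>;
     reduces d (K - {\<sigma>}) N K'\<rbrakk> \<Longrightarrow> reduces d K (Suc N) K'"

lemma reduces_trans: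
  assumes "reduces d K a K1" "reduces d K1 b K2"
  shows "reduces d K (a + b) K2"
  using assms
proof (induction rule: reduces.induct)
  case (stop K)
  then show ?case by simp
next
  case (collapse \<sigma> K v N K')
  show ?case
    by (rule reduces.collapse[OF collapse.hyps(1-4)]) (use collapse in auto)
next
  case (critical \<sigma> K N K')
  show ?case
    unfolding add_Suc
    by (rule reduces.critical[OF critical.hyps(1-3)]) (use critical in auto)
qed

lemma reduces_subset: "reduces d K N K' \<Longrightarrow> K' \<subseteq> K"
  by (induction rule: reduces.induct) auto

lemma reduces_image:
  assumes "reduces d K N K'" "inj f"
  shows "reduces d ((`) f ` K) N ((`) f ` K')"
  using assms
proof (induction rule: reduces.induct)
  case (stop K)
  then show ?case by (simp add: reduces.stop)
next
  case (collapse \<sigma> K v N K')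
  have inj: "inj ((`) f)"
    using \<open>inj f\<close> by (simp add: inj_def inj_image_eq_iff)
  have d: "(`) f ` (K - {\<sigma>, insert v \<sigma>}) = (`) f ` K - {f ` \<sigma>, insert (f v) (f ` \<sigma>)}"
    by (simp add: image_set_diff[OF inj])
  have iff: "f ` \<sigma> \<subseteq> f ` \<tau> \<longleftrightarrow> \<sigma> \<subseteq> \<tau>" for \<tau>
    using \<open>inj f\<close> by (simp add: inj_image_subset_iff)
  show ?case
  proof (rule reduces.collapse)
    show "f ` \<sigma> \<in> (`) f ` K" "insert (f v) (f ` \<sigma>) \<in> (`) f ` K"
      using collapse.hyps(1,3) by auto (metis image_insert imageI)
    show "f v \<notin> f ` \<sigma>"
      using collapse.hyps(2) \<open>inj f\<close> by (simp add: inj_image_mem_iff)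
    show "\<tau> = f ` \<sigma> \<or> \<tau> = insert (f v) (f ` \<sigma>)" if "\<tau> \<in> (`) f ` K" "f ` \<sigma> \<subseteq> \<tau>" for \<tau>
    proof -
      obtain \<tau>' where "\<tau>' \<in> K" "\<tau> = f ` \<tau>'"
        using \<open>\<tau> \<in> (`) f ` K\<close> by auto
      then show ?thesis
        using that(2) collapse.hyps(4)[of \<tau>'] by (auto simp: iff)
    qed
    show "reduces d ((`) f ` K - {f ` \<sigma>, insert (f v) (f ` \<sigma>)}) N ((`) f ` K')"
      using collapse.IH \<open>inj f\<close> by (simp add: d)
  qed
next
  case (critical \<sigma> K N K')
  have inj: "inj ((`) f)"
    using \<open>inj f\<close> by (simp add: inj_def inj_image_eq_iff)
  have d: "(`) f ` (K - {\<sigma>}) = (`) f ` K - {f ` \<sigma>}"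
    by (simp add: image_set_diff[OF inj])
  have iff: "f ` \<sigma> \<subseteq> f ` \<tau> \<longleftrightarrow> \<sigma> \<subseteq> \<tau>" for \<tau>
    using \<open>inj f\<close> by (simp add: inj_image_subset_iff)
  show ?case
  proof (rule reduces.critical)
    show "f ` \<sigma> \<in> (`) f ` K"
      using critical.hyps(1) by auto
    show "card (f ` \<sigma>) = Suc d"
      using critical.hyps(2) \<open>inj f\<close> by (simp add: card_image inj_on_subset)
    show "\<tau> = f ` \<sigma>" if "\<tau> \<in> (`) f ` K" "f ` \<sigma> \<subseteq> \<tau>" for \<tau>
    proof -
      obtain \<tau>' where "\<tau>' \<in> K" "\<tau> = f ` \<tau>'"
        using \<open>\<tau> \<in> (`) f ` K\<close> by auto
      then show ?thesis
        using that(2) critical.hyps(3)[of \<tau>'] by (auto simp: iff)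
    qed
    show "reduces d ((`) f ` K - {f ` \<sigma>}) N ((`) f ` K')"
      using critical.IH \<open>inj f\<close> by (simp add: d)
  qed
qed

section \<open>Simplicial complexes and the removal of cones\<close>

lemma abstract_complexD:
  assumes "abstract_complex K"
  shows "finite K" and "\<sigma> \<in> K \<Longrightarrow> finite \<sigma>" and "\<sigma> \<in> K \<Longrightarrow> \<sigma> \<noteq> {}"
    and "\<lbrakk>\<sigma> \<in> K; \<tau> \<subseteq> \<sigma>; \<tau> \<noteq> {}\<rbrakk> \<Longrightarrow> \<tau> \<in> K"
  using assms unfolding abstract_complex_def by blast+

lemma abstract_complex_up_removal:
  assumes K: "abstract_complex K"
    and up: "\<And>\<sigma> \<tau>. \<lbrakk>\<sigma> \<in> R; \<tau> \<in> K; \<sigma> \<subseteq> \<tau>\<rbrakk> \<Longrightarrow> \<tau> \<in> R"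
  shows "abstract_complex (K - R)"
  unfolding abstract_complex_def
proof (intro conjI ballI allI impI)
  show "finite (K - R)"
    using abstract_complexD(1)[OF K] by simp
next
  fix \<pi> assume "\<pi> \<in> K - R"
  then show "finite \<pi>" and "\<pi> \<noteq> {}"
    using abstract_complexD(2,3)[OF K] by auto
next
  fix \<pi> \<rho> assume "\<pi> \<in> K - R" "\<rho> \<subseteq> \<pi>" "\<rho> \<noteq> {}"
  then show "\<rho> \<in> K - R"
    using abstract_complexD(4)[OF K] up by blast
qed

lemma abstract_complex_collapse:
  assumes "abstract_complex K" "\<sigma> \<in> K"
    "\<And>\<tau>. \<lbrakk>\<tau> \<in> K; \<sigma> \<subseteq> \<tau>\<rbrakk> \<Longrightarrow> \<tau> = \<sigma> \<or> \<tau> = insert v \<sigma>"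
  shows "abstract_complex (K - {\<sigma>, insert v \<sigma>})"
  by (rule abstract_complex_up_removal[OF assms(1)]) (use assms(3) in blast)

lemma abstract_complex_filter:
  assumes "abstract_complex K"
  shows "abstract_complex {\<tau> \<in> K. \<forall>\<rho>\<in>P. \<not> \<rho> \<subseteq> \<tau>}"
proof -
  have "abstract_complex (K - {\<tau>. \<exists>\<rho>\<in>P. \<rho> \<subseteq> \<tau>})"
    by (rule abstract_complex_up_removal[OF assms]) auto
  moreover have "K - {\<tau>. \<exists>\<rho>\<in>P. \<rho> \<subseteq> \<tau>} = {\<tau> \<in> K. \<forall>\<rho>\<in>P. \<not> \<rho> \<subseteq> \<tau>}"
    by auto
  ultimately show ?thesis by simp
qed

text \<open>The simplices containing \<open>\<sigma>\<close> are paired as \<open>\<tau>\<close> and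
  \<open>insert v \<tau>\<close>. A largest one without \<open>v\<close> is a free face, and
  removing its pair keeps the closure under adding \<open>v\<close>, so the process can be
  repeated.\<close>

lemma cone_removal:
  assumes "abstract_complex K" "\<sigma> \<noteq> {}" "v \<notin> \<sigma>"
    and "\<And>\<tau>. \<lbrakk>\<tau> \<in> K; \<sigma> \<subseteq> \<tau>\<rbrakk> \<Longrightarrow> insert v \<tau> \<in> K"
  shows "reduces d K 0 {\<tau> \<in> K. \<not> \<sigma> \<subseteq> \<tau>}"
  using assms
proof (induction "card {\<tau> \<in> K. \<sigma> \<subseteq> \<tau>}" arbitrary: K rule: less_induct)
  case less
  have fin: "finite K" and fin': "\<And>\<tau>. \<tau> \<in> K \<Longrightarrow> finite \<tau>"
    using abstract_complexD(1,2)[OF less.prems(1)] by auto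
  have down: "\<And>\<tau> \<rho>. \<lbrakk>\<tau> \<in> K; \<rho> \<subseteq> \<tau>; \<rho> \<noteq> {}\<rbrakk> \<Longrightarrow> \<rho> \<in> K"
    using abstract_complexD(4)[OF less.prems(1)] .
  show ?case
  proof (cases "\<sigma> \<in> K")
    case False
    then have "{\<tau> \<in> K. \<not> \<sigma> \<subseteq> \<tau>} = K"
      using down[OF _ _ less.prems(2)] by blast
    then show ?thesis
      by (simp add: reduces.stop)
  next
    case True
    let ?M = "{\<tau> \<in> K. \<sigma> \<subseteq> \<tau> \<and> v \<notin> \<tau>}"
    obtain \<tau> where \<tau>: "\<tau> \<in> ?M" and max: "\<And>\<pi>. \<pi> \<in> ?M \<Longrightarrow> card \<pi> \<le> card \<tau>"
    proof -
      have "\<exists>\<tau>. \<tau> \<in> ?M \<and> (\<forall>\<pi>. \<pi> \<in> ?M \<longrightarrow> card \<pi> \<le> card \<tau>)"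
        using True less.prems(3) fin
        by (intro ex_has_greatest_nat[of _ \<sigma> _ "Suc (Max (card ` K))"]) (auto simp: less_Suc_eq_le)
      then show ?thesis
        using that by blast
    qed
    \<comment> \<open>\<open>\<pi> - {v}\<close> again contains \<open>\<sigma>\<close> and avoids
      \<open>v\<close>, so by maximality it is no larger than \<open>\<tau>\<close>.\<close>
    have co: "\<pi> = \<tau> \<or> \<pi> = insert v \<tau>" if "\<pi> \<in> K" "\<tau> \<subseteq> \<pi>" for \<pi>
    proof -
      have "\<pi> - {v} \<in> ?M"
        using that \<tau> less.prems(2,3) down[OF that(1), of "\<pi> - {v}"] by auto
      then have "card (\<pi> - {v}) \<le> card \<tau>" by (rule max)
      moreover have "\<tau> \<subseteq> \<pi> - {v}" using that \<tau> by auto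
      ultimately have "\<pi> - {v} = \<tau>"
        using fin'[OF that(1)] by (metis card_seteq finite_Diff)
      then show ?thesis by auto
    qed
    let ?K = "K - {\<tau>, insert v \<tau>}"
    have "{\<pi> \<in> ?K. \<sigma> \<subseteq> \<pi>} \<subset> {\<pi> \<in> K. \<sigma> \<subseteq> \<pi>}"
      using \<tau> by auto
    then have "card {\<pi> \<in> ?K. \<sigma> \<subseteq> \<pi>} < card {\<pi> \<in> K. \<sigma> \<subseteq> \<pi>}"
      using fin by (intro psubset_card_mono) auto
    then have "reduces d ?K 0 {\<pi> \<in> ?K. \<not> \<sigma> \<subseteq> \<pi>}"
    proof (rule less.hyps)
      show "abstract_complex ?K"
        using abstract_complex_collapse[OF less.prems(1)] \<tau> co by blast
      show "insert v \<pi> \<in> ?K" if "\<pi> \<in> ?K" "\<sigma> \<subseteq> \<pi>" for \<pi>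
        using that \<tau> less.prems(4)[of \<pi>] by auto
    qed (use less.prems in auto)
    moreover have "{\<pi> \<in> ?K. \<not> \<sigma> \<subseteq> \<pi>} = {\<pi> \<in> K. \<not> \<sigma> \<subseteq> \<pi>}"
      using \<tau> by auto
    ultimately show ?thesis
      using \<tau> co less.prems(4)[of \<tau>] by (intro reduces.collapse[of \<tau> K v]) auto
  qed
qed

text \<open>The faces may have different apexes. The condition \<open>v \<notin> \<Union>P\<close>
  keeps the removals independent: if \<open>insert v \<tau>\<close> contains a member of
  \<open>P\<close>, then so does \<open>\<tau>\<close>, hence cones survive the earlier
  removals.\<close>

lemma cone_removal_family:
  assumes "finite P" "abstract_complex K"
    and "\<And>\<rho>. \<rho> \<in> P \<Longrightarrow> \<rho> \<noteq> {}"
    and "\<And>\<rho>. \<rho> \<in> P \<Longrightarrow> \<exists>v. v \<notin> \<Union>P \<and> (\<forall>\<tau>\<in>K. \<rho> \<subseteq> \<tau> \<longrightarrow> insert v \<tau> \<in> K)"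
  shows "reduces d K 0 {\<tau> \<in> K. \<forall>\<rho>\<in>P. \<not> \<rho> \<subseteq> \<tau>}"
  using assms
proof (induction P rule: finite_induct)
  case empty
  then show ?case by (simp add: reduces.stop)
next
  case (insert \<rho> P)
  let ?K = "{\<tau> \<in> K. \<forall>\<rho>\<in>P. \<not> \<rho> \<subseteq> \<tau>}"
  have "reduces d K 0 ?K"
  proof (rule insert.IH)
    show "\<exists>v. v \<notin> \<Union>P \<and> (\<forall>\<tau>\<in>K. \<pi> \<subseteq> \<tau> \<longrightarrow> insert v \<tau> \<in> K)" if "\<pi> \<in> P" for \<pi>
      using insert.prems(3)[of \<pi>] that by auto
  qed (use insert.prems(1,2) in auto)
  moreover obtain v where v: "v \<notin> \<Union>(insert \<rho> P)" "\<forall>\<tau>\<in>K. \<rho> \<subseteq> \<tau> \<longrightarrow> insert v \<tau> \<in> K"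
    using insert.prems(3)[of \<rho>] by blast
  have "reduces d ?K 0 {\<tau> \<in> ?K. \<not> \<rho> \<subseteq> \<tau>}"
  proof (rule cone_removal)
    show "abstract_complex ?K"
      by (rule abstract_complex_filter[OF insert.prems(1)])
    show "\<rho> \<noteq> {}" "v \<notin> \<rho>"
      using insert.prems(2) v(1) by auto
    show "insert v \<tau> \<in> ?K" if "\<tau> \<in> ?K" "\<rho> \<subseteq> \<tau>" for \<tau>
      using that v by (auto simp: subset_insert)
  qed
  moreover have "{\<tau> \<in> ?K. \<not> \<rho> \<subseteq> \<tau>} = {\<tau> \<in> K. \<forall>\<rho>\<in>insert \<rho> P. \<not> \<rho> \<subseteq> \<tau>}"
    by auto
  ultimately show ?case
    using reduces_trans[of d K 0 ?K 0] by simp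
qed

lemma critical_removal_family:
  assumes "finite C" "C \<subseteq> K" "\<And>\<sigma>. \<sigma> \<in> C \<Longrightarrow> card \<sigma> = Suc d"
    and "\<And>\<sigma> \<tau>. \<lbrakk>\<sigma> \<in> C; \<tau> \<in> K; \<sigma> \<subseteq> \<tau>\<rbrakk> \<Longrightarrow> \<tau> = \<sigma>"
  shows "reduces d K (card C) (K - C)"
  using assms
proof (induction C arbitrary: K rule: finite_induct)
  case empty
  then show ?case by (simp add: reduces.stop)
next
  case (insert \<sigma> C)
  have "reduces d (K - {\<sigma>}) (card C) (K - {\<sigma>} - C)"
    using insert.prems insert.hyps by (intro insert.IH) auto
  then have "reduces d K (Suc (card C)) (K - {\<sigma>} - C)"
    using insert.prems by (intro reduces.critical[of \<sigma>]) auto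
  moreover have "K - {\<sigma>} - C = K - insert \<sigma> C"
    by auto
  ultimately show ?case
    using insert.hyps by simp
qed

text \<open>A free face with more than \<open>d\<close> vertices lies in no member of
  \<open>X\<close>: the cardinalities would force equality, and \<open>X\<close> is disjoint from
  \<open>K\<close>. This allows simplices of dimension at most \<open>d\<close> to be put aside
  while the higher ones collapse. \<open>N = 0\<close> is a premise because the induction needs a
  variable there.\<close>

lemma reduces_Un:
  assumes "reduces d K N K'" "N = 0"
    and "\<And>\<alpha>. \<alpha> \<in> K - K' \<Longrightarrow> Suc d \<le> card \<alpha>"
    and "X \<inter> K = {}" "\<And>x. x \<in> X \<Longrightarrow> finite x \<and> card x \<le> Suc d"
  shows "reduces d (K \<union> X) 0 (K' \<union> X)"
  using assms
proof (induction rule: reduces.induct)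
  case (stop K)
  then show ?case by (simp add: reduces.stop)
next
  case (collapse \<sigma> K v N K')
  have "\<sigma> \<notin> K'"
    using reduces_subset[OF collapse.hyps(5)] by auto
  then have card: "Suc d \<le> card \<sigma>"
    using collapse.prems(2) collapse.hyps(1) by auto
  have no: "\<not> \<sigma> \<subseteq> x" if "x \<in> X" for x
    using that card collapse.prems(3,4) collapse.hyps(1)
    by (metis card_seteq disjoint_iff le_trans)
  have eq: "K \<union> X - {\<sigma>, insert v \<sigma>} = (K - {\<sigma>, insert v \<sigma>}) \<union> X"
    using collapse.prems(3) collapse.hyps(1,3) by auto
  have "reduces d ((K - {\<sigma>, insert v \<sigma>}) \<union> X) 0 (K' \<union> X)"
    using collapse.prems by (intro collapse.IH) auto
  then show ?case
    using collapse.hyps(1-4) no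
    by (intro reduces.collapse[of \<sigma> "K \<union> X" v]) (simp_all only: eq, blast+)
next
  case critical
  then show ?case by simp
qed

text \<open>Critical simplices of the middle of a reduction can be postponed: first collapse the pairs
  above dimension \<open>d\<close>, then remove all critical simplices, then collapse the remaining pairs.\<close>

lemma reduces_reorder:
  assumes "reduces d K N K0" "K0 = {{w}}" "\<And>\<sigma>. \<sigma> \<in> K \<Longrightarrow> finite \<sigma>"
  shows "\<exists>K' C. reduces d K 0 K' \<and> C \<subseteq> K' \<and> card C = N \<and> finite C \<and> (\<forall>\<sigma>\<in>C. card \<sigma> = Suc d) \<and>
    (\<forall>\<sigma>\<in>K'. card \<sigma> \<le> Suc d) \<and> reduces d (K' - C) 0 {{w}} \<and> (\<forall>\<sigma>\<in>K - K'. Suc d \<le> card \<sigma>)"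
  using assms
proof (induction rule: reduces.induct)
  case (stop K)
  then show ?case
    by (intro exI[of _ K] exI[of _ "{}"]) (auto intro: reduces.stop)
next
  case (collapse \<sigma> K v N K0)
  let ?K1 = "K - {\<sigma>, insert v \<sigma>}"
  have fin: "finite \<pi>" if "\<pi> \<in> ?K1" for \<pi>
    using collapse.prems(2) that by simp
  obtain K' C where IH: "reduces d ?K1 0 K'" "C \<subseteq> K'" "card C = N" "finite C"
      "\<forall>\<sigma>\<in>C. card \<sigma> = Suc d" "\<forall>\<sigma>\<in>K'. card \<sigma> \<le> Suc d" "reduces d (K' - C) 0 {{w}}"
      "\<forall>\<sigma>\<in>?K1 - K'. Suc d \<le> card \<sigma>"
    using collapse.IH[OF collapse.prems(1) fin] by blast
  have sub: "K' \<subseteq> ?K1"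
    by (rule reduces_subset[OF IH(1)])
  have card_v: "card (insert v \<sigma>) = Suc (card \<sigma>)"
    using collapse.prems(2)[OF collapse.hyps(1)] collapse.hyps(2) by simp
  show ?case
  \<comment> \<open>A pair whose smaller member has at most \<open>d\<close> vertices is postponed:
    it is added to \<open>K'\<close> and collapsed after the critical simplices. A larger pair is
    collapsed at once.\<close>
  proof (cases "card \<sigma> \<le> d")
    case True
    let ?X = "{\<sigma>, insert v \<sigma>}"
    have "reduces d (?K1 \<union> ?X) 0 (K' \<union> ?X)"
      by (rule reduces_Un[OF IH(1)]) (use IH(8) True card_v collapse.hyps(1) collapse.prems(2) in auto)
    moreover have "?K1 \<union> ?X = K"
      using collapse.hyps(1,3) by auto
    moreover have "reduces d (K' \<union> ?X - C) 0 {{w}}"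
    proof (rule reduces.collapse)
      have "K' \<union> ?X - C - ?X = K' - C"
        using sub by auto
      then show "reduces d (K' \<union> ?X - C - ?X) 0 {{w}}"
        using IH(7) by simp
      show "\<sigma> \<in> K' \<union> ?X - C" "insert v \<sigma> \<in> K' \<union> ?X - C"
        using IH(2) sub by auto
      show "\<tau> = \<sigma> \<or> \<tau> = insert v \<sigma>" if "\<tau> \<in> K' \<union> ?X - C" "\<sigma> \<subseteq> \<tau>" for \<tau>
        using collapse.hyps(4)[OF _ that(2)] that(1) sub collapse.hyps(1,3) by blast
    qed (rule collapse.hyps)
    ultimately show ?thesis
    proof (intro exI conjI)
      show "card C = N" "finite C" "\<forall>\<sigma>\<in>C. card \<sigma> = Suc d"
        by (rule IH)+
      show "C \<subseteq> K' \<union> ?X"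
        using IH(2) by blast
      show "\<forall>\<sigma>\<in>K' \<union> ?X. card \<sigma> \<le> Suc d"
        using IH(6) True card_v by auto
      show "\<forall>\<pi>\<in>K - (K' \<union> ?X). Suc d \<le> card \<pi>"
        using IH(8) by blast
    qed simp_all
  next
    case False
    then have big: "Suc d \<le> card \<sigma>" "Suc d \<le> card (insert v \<sigma>)"
      by (simp_all add: card_v)
    have "reduces d K 0 K'"
      by (rule reduces.collapse[OF collapse.hyps(1-4) IH(1)])
    then show ?thesis
    proof (intro exI conjI)
      show "C \<subseteq> K'" "card C = N" "finite C" "\<forall>\<sigma>\<in>C. card \<sigma> = Suc d" "\<forall>\<sigma>\<in>K'. card \<sigma> \<le> Suc d"
          "reduces d (K' - C) 0 {{w}}"
        by (rule IH)+
      show "\<forall>\<pi>\<in>K - K'. Suc d \<le> card \<pi>"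
        using IH(8) big by blast
    qed
  qed
next
  case (critical \<sigma> K N K0)
  let ?K1 = "K - {\<sigma>}"
  have fin: "finite \<pi>" if "\<pi> \<in> ?K1" for \<pi>
    using critical.prems(2) that by simp
  obtain K' C where IH: "reduces d ?K1 0 K'" "C \<subseteq> K'" "card C = N" "finite C"
      "\<forall>\<sigma>\<in>C. card \<sigma> = Suc d" "\<forall>\<sigma>\<in>K'. card \<sigma> \<le> Suc d" "reduces d (K' - C) 0 {{w}}"
      "\<forall>\<sigma>\<in>?K1 - K'. Suc d \<le> card \<sigma>"
    using critical.IH[OF critical.prems(1) fin] by blast
  have sub: "K' \<subseteq> ?K1"
    by (rule reduces_subset[OF IH(1)])
  have "finite \<sigma>"
    by (rule critical.prems(2)[OF critical.hyps(1)])
  \<comment> \<open>A critical simplex has only \<open>Suc d\<close> vertices, so it can wait while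
    the higher pairs collapse; it then joins \<open>C\<close>.\<close>
  then have "reduces d (?K1 \<union> {\<sigma>}) 0 (K' \<union> {\<sigma>})"
    by (intro reduces_Un[OF IH(1)]) (use IH(8) critical.hyps(1,2) in auto)
  moreover have K: "?K1 \<union> {\<sigma>} = K"
    using critical.hyps(1) by auto
  ultimately have 1: "reduces d K 0 (K' \<union> {\<sigma>})"
    by simp
  have 2: "K' \<union> {\<sigma>} - insert \<sigma> C = K' - C"
    using sub by auto
  have 3: "card (insert \<sigma> C) = Suc N"
    using IH(2,3,4) sub by (metis Diff_iff card_insert_disjoint insertI1 subsetD)
  show ?case
  proof (intro exI conjI)
    show "reduces d K 0 (K' \<union> {\<sigma>})" "card (insert \<sigma> C) = Suc N"
      by (rule 1 3)+
    show "insert \<sigma> C \<subseteq> K' \<union> {\<sigma>}" "finite (insert \<sigma> C)"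
      using IH(2,4) by auto
    show "\<forall>\<sigma>\<in>insert \<sigma> C. card \<sigma> = Suc d" "\<forall>\<sigma>\<in>K' \<union> {\<sigma>}. card \<sigma> \<le> Suc d"
      using IH(5,6) critical.hyps(2) by simp_all
    show "reduces d (K' \<union> {\<sigma>} - insert \<sigma> C) 0 {{w}}"
      using IH(7) by (simp only: 2)
    show "\<forall>\<pi>\<in>K - (K' \<union> {\<sigma>}). Suc d \<le> card \<pi>"
      using IH(8) by auto
  qed
qed

section \<open>The star of a new vertex\<close>

definition flag_complex :: "'a set set \<Rightarrow> 'a set set set" where
  "flag_complex V = {\<sigma>. \<sigma> \<subseteq> V \<and> \<sigma> \<noteq> {} \<and> (\<forall>B\<in>\<sigma>. \<forall>C\<in>\<sigma>. card (sym_diff B C) \<le> 2)}"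

lemma abstract_complex_flag_complex:
  assumes "finite V"
  shows "abstract_complex (flag_complex V)"
  unfolding abstract_complex_def
proof (intro conjI ballI allI impI)
  have "flag_complex V \<subseteq> Pow V"
    by (auto simp: flag_complex_def)
  then show "finite (flag_complex V)"
    using assms by (meson finite_Pow_iff finite_subset)
next
  fix \<sigma> assume "\<sigma> \<in> flag_complex V"
  then show "finite \<sigma>" "\<sigma> \<noteq> {}"
    using assms finite_subset by (auto simp: flag_complex_def)
next
  fix \<sigma> \<tau> assume "\<sigma> \<in> flag_complex V" "\<tau> \<subseteq> \<sigma>" "\<tau> \<noteq> {}"
  then show "\<tau> \<in> flag_complex V"
    unfolding flag_complex_def by blast
qed

lemma vietoris_rips_symdiff_dist:
  assumes "finite V"
  shows "vietoris_rips V symdiff_dist 2 = flag_complex V"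
proof -
  have *: "Max {symdiff_dist x y | x y. x \<in> \<sigma> \<and> y \<in> \<sigma>} \<le> 2 \<longleftrightarrow> (\<forall>B\<in>\<sigma>. \<forall>C\<in>\<sigma>. card (sym_diff B C) \<le> 2)"
    if "finite \<sigma>" "\<sigma> \<noteq> {}" for \<sigma> :: "'a set set"
  proof -
    have "{symdiff_dist x y | x y. x \<in> \<sigma> \<and> y \<in> \<sigma>} = (\<lambda>(x, y). symdiff_dist x y) ` (\<sigma> \<times> \<sigma>)"
      by auto
    then show ?thesis
      using that by (auto simp: symdiff_dist_def)
  qed
  show ?thesis
    unfolding vietoris_rips_def flag_complex_def
    by (intro Collect_cong) (use * finite_subset[OF _ assms] in blast)
qed

text \<open>The symmetric difference has \<open>card D + card E - 2 * card (D \<inter> E)\<close>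
  elements, so two disjoint sets of these sizes are within distance 2 only if both are singletons.
  Adjacency in the link thus becomes intersection.\<close>

lemma card_sym_diff_le_2_iff:
  assumes "card D = 1 \<or> card D = 2" "card E = 1 \<or> card E = 2"
  shows "card (sym_diff D E) \<le> 2 \<longleftrightarrow> card D = 1 \<and> card E = 1 \<or> D \<inter> E \<noteq> {}"
proof -
  have fin: "finite D" "finite E"
    using assms card_ge_0_finite by force+
  have "card (sym_diff D E) = card (D - E) + card (E - D)"
    using fin by (intro card_Un_disjoint) auto
  moreover have "card (D - E) = card D - card (D \<inter> E)" "card (E - D) = card E - card (D \<inter> E)"
    using fin by (simp_all add: card_Diff_subset_Int Int_commute)
  moreover have "card (D \<inter> E) = 0 \<longleftrightarrow> D \<inter> E = {}"
    using fin by simp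
  moreover have "card (D \<inter> E) \<le> card D" "card (D \<inter> E) \<le> card E"
    using fin by (simp_all add: card_mono)
  ultimately show ?thesis
    using assms by auto
qed

text \<open>A set that meets all three edges of a triangle contains two of its corners, and there is
  no room for more.\<close>

lemma doubletons_in_triple_transversal:
  assumes "card D \<le> 2" "finite D" "D \<inter> {p, q} \<noteq> {}" "D \<inter> {q, r} \<noteq> {}" "D \<inter> {p, r} \<noteq> {}"
    "p \<noteq> q" "q \<noteq> r" "p \<noteq> r"
  shows "D \<subseteq> {p, q, r} \<and> card D = 2"
proof -
  have "\<exists>a b. a \<noteq> b \<and> {a, b} \<subseteq> D \<and> {a, b} \<subseteq> {p, q, r}"
    using assms(3-8) by auto
  then obtain a b where ab: "a \<noteq> b" "{a, b} \<subseteq> D" "{a, b} \<subseteq> {p, q, r}"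
    by blast
  then have "card {a, b} = 2" by simp
  then have "D = {a, b}"
    using assms(1,2) ab by (metis card_seteq)
  then show ?thesis using ab by simp
qed

text \<open>The star of a vertex \<open>A\<close> in the Vietoris-Rips complex, translated by the isometry
  \<open>B \<mapsto> A \<triangle> B\<close> so that the vertex becomes \<open>{}\<close>. A neighbour \<open>{i}\<close> stands for \<open>A - {i}\<close>, a neighbour
  \<open>{i, j}\<close> for \<open>A - {i, j}\<close> and a neighbour \<open>{x, i}\<close> with \<open>x \<in> X\<close> for \<open>insert x (A - {i})\<close>.\<close>

locale translated_star =
  fixes A X :: "nat set" and U :: "nat set set"
  assumes finite_A: "finite A" and A_ne: "A \<noteq> {}" and finite_X: "finite X" and disj: "A \<inter> X = {}"
    and finite_U: "finite U" and empty_U: "{} \<in> U"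
    and nbh: "\<And>D. D \<noteq> {} \<Longrightarrow> D \<in> U \<and> card D \<le> 2 \<longleftrightarrow>
      (\<exists>i\<in>A. D = {i}) \<or> (\<exists>i\<in>A. \<exists>j\<in>A. i \<noteq> j \<and> D = {i, j}) \<or> (\<exists>x\<in>X. \<exists>i\<in>A. x < i \<and> D = {x, i})"
begin

definition nb :: "nat set \<Rightarrow> bool" where
  "nb D \<longleftrightarrow> (\<exists>i\<in>A. D = {i}) \<or> (\<exists>i\<in>A. \<exists>j\<in>A. i \<noteq> j \<and> D = {i, j}) \<or> (\<exists>x\<in>X. \<exists>i\<in>A. x < i \<and> D = {x, i})"

definition above :: "nat \<Rightarrow> nat set" where
  "above x = {i \<in> A. x < i}"

text \<open>The neighbour \<open>{x, lo x}\<close> is the cone apex for the neighbours through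
  \<open>x\<close>. The pairs of \<open>above x\<close> that avoid \<open>lo x\<close> are the edges
  outside a spanning star of the complete graph on \<open>above x\<close>, so their number is its
  cycle rank, \<open>(card (above x) - 1) choose 2\<close>.\<close>

definition lo :: "nat \<Rightarrow> nat" where
  "lo x = Min (above x)"

text \<open>For a triple \<open>T\<close> this is a tetrahedron: its vertices are \<open>A\<close>,
  which is \<open>{}\<close> after translation, and the three edges of the triangle
  \<open>T\<close>, which meet pairwise.\<close>

definition tri :: "nat set \<Rightarrow> nat set set" where
  "tri T = insert {} {D. D \<subseteq> T \<and> card D = 2}"

definition crit :: "nat set set" where
  "crit = {T. T \<subseteq> A \<and> card T = 3} \<union> (\<Union>x\<in>X. insert x ` {S. S \<subseteq> above x - {lo x} \<and> card S = 2})"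

lemma nb_card: "nb D \<Longrightarrow> card D = 1 \<or> card D = 2" "nb D \<Longrightarrow> finite D" "nb D \<Longrightarrow> D \<noteq> {}"
  using disj by (auto simp: nb_def)

text \<open>Distance at most 2 to \<open>{}\<close> makes every other vertex a neighbour of size 1
  or 2, and \<open>card_sym_diff_le_2_iff\<close> turns the remaining distances into
  intersections.\<close>

lemma flag_iff:
  assumes "{} \<in> \<tau>"
  shows "\<tau> \<in> flag_complex U \<longleftrightarrow> (\<forall>D\<in>\<tau>. D \<noteq> {} \<longrightarrow> nb D) \<and>
    (\<forall>D\<in>\<tau>. \<forall>E\<in>\<tau>. D \<noteq> {} \<longrightarrow> E \<noteq> {} \<longrightarrow> card D = 1 \<and> card E = 1 \<or> D \<inter> E \<noteq> {})"
  (is "?L \<longleftrightarrow> ?N \<and> ?I")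
proof
  assume L: ?L
  have N: ?N
  proof (intro ballI impI)
    fix D assume D: "D \<in> \<tau>" "D \<noteq> {}"
    then have "D \<in> U" "card (sym_diff D {}) \<le> 2"
      using L assms unfolding flag_complex_def by blast+
    then show "nb D"
      using nbh[OF D(2)] by (simp add: nb_def)
  qed
  moreover have ?I
  proof (intro ballI impI)
    fix D E assume D: "D \<in> \<tau>" "E \<in> \<tau>" "D \<noteq> {}" "E \<noteq> {}"
    then have "card (sym_diff D E) \<le> 2"
      using L unfolding flag_complex_def by blast
    then show "card D = 1 \<and> card E = 1 \<or> D \<inter> E \<noteq> {}"
      using card_sym_diff_le_2_iff[OF nb_card(1) nb_card(1), of D E] N D by blast
  qed
  ultimately show "?N \<and> ?I" ..
next
  assume R: "?N \<and> ?I"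
  have "D \<in> U" if "D \<in> \<tau>" for D
    using R that nbh[of D] empty_U by (cases "D = {}") (auto simp: nb_def)
  moreover have "card D \<le> 2" if "D \<in> \<tau>" for D
    using R that nb_card(1)[of D] by (cases "D = {}") auto
  then have "card (sym_diff D E) \<le> 2" if "D \<in> \<tau>" "E \<in> \<tau>" for D E
  proof (cases "D = {} \<or> E = {}")
    case True
    then show ?thesis
      using that \<open>\<And>D. D \<in> \<tau> \<Longrightarrow> card D \<le> 2\<close> by auto
  next
    case False
    then show ?thesis
      using card_sym_diff_le_2_iff[OF nb_card(1) nb_card(1), of D E] R that by blast
  qed
  ultimately show ?L
    using assms unfolding flag_complex_def by blast
qed

lemma flagD:
  assumes "\<tau> \<in> flag_complex U" "{} \<in> \<tau>" "D \<in> \<tau>" "D \<noteq> {}"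
  shows "nb D" and "\<lbrakk>E \<in> \<tau>; E \<noteq> {}; card E \<noteq> 1\<rbrakk> \<Longrightarrow> D \<inter> E \<noteq> {}"
  using assms flag_iff[OF assms(2)] by blast+

lemma nb_intros:
  "i \<in> A \<Longrightarrow> nb {i}"
  "\<lbrakk>i \<in> A; j \<in> A; i \<noteq> j\<rbrakk> \<Longrightarrow> nb {i, j}"
  "\<lbrakk>x \<in> X; i \<in> A; x < i\<rbrakk> \<Longrightarrow> nb {x, i}"
  by (auto simp: nb_def)

lemma nb_with_X:
  assumes "nb D" "x \<in> D" "x \<in> X"
  obtains k where "k \<in> A" "x < k" "D = {x, k}"
  using assms disj unfolding nb_def by blast

lemma nb_eq_doubleton:
  assumes "nb D" "i \<in> D" "k \<in> D" "i \<noteq> k"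
  shows "D = {i, k}"
  using assms unfolding nb_def by blast

lemma lo:
  assumes "i \<in> A" "x < i"
  shows "lo x \<in> A" "x < lo x"
proof -
  have "lo x \<in> above x"
    unfolding lo_def using assms finite_A by (intro Min_in) (auto simp: above_def)
  then show "lo x \<in> A" "x < lo x"
    by (auto simp: above_def)
qed

lemma X_neq_A: "\<lbrakk>x \<in> X; i \<in> A\<rbrakk> \<Longrightarrow> x \<noteq> i"
  using disj by auto

lemma not_subset_familyD: "\<lbrakk>\<forall>r\<in>S. \<not> r \<subseteq> \<tau>; \<rho> \<in> S; \<rho> \<subseteq> \<tau>\<rbrakk> \<Longrightarrow> False"
  by blast

lemma A_not_X: "i \<in> A \<Longrightarrow> i \<notin> X"
  using disj by auto

section \<open>The critical tetrahedra of the star\<close>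

lemma crit_cases:
  assumes "T \<in> crit"
  obtains p q r where "T = {p, q, r}" "p \<noteq> q" "q \<noteq> r" "p \<noteq> r" "p \<in> A" "q \<in> A" "r \<in> A"
  | x i k where "T = {x, i, k}" "x \<in> X" "i \<in> A" "k \<in> A" "x < i" "x < k" "i \<noteq> k" "i \<noteq> lo x" "k \<noteq> lo x"
proof -
  consider "T \<subseteq> A" "card T = 3" | x S where "x \<in> X" "T = insert x S" "S \<subseteq> above x - {lo x}" "card S = 2"
    using assms unfolding crit_def by blast
  then show ?thesis
  proof cases
    case 1
    then show ?thesis
      using that(1) by (auto simp: card_3_iff)
  next
    case 2
    then obtain i k where "S = {i, k}" "i \<noteq> k"
      by (auto simp: card_2_iff)
    then show ?thesis
      using 2 that(2)[of x i k] by (simp add: above_def)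
  qed
qed

lemma crit_intros:
  "\<lbrakk>p \<noteq> q; q \<noteq> r; p \<noteq> r; p \<in> A; q \<in> A; r \<in> A\<rbrakk> \<Longrightarrow> {p, q, r} \<in> crit"
  "\<lbrakk>x \<in> X; i \<in> A; k \<in> A; x < i; x < k; i \<noteq> k; i \<noteq> lo x; k \<noteq> lo x\<rbrakk> \<Longrightarrow> {x, i, k} \<in> crit"
proof -
  show "{p, q, r} \<in> crit" if "p \<noteq> q" "q \<noteq> r" "p \<noteq> r" "p \<in> A" "q \<in> A" "r \<in> A"
    using that by (simp add: crit_def)
  assume *: "x \<in> X" "i \<in> A" "k \<in> A" "x < i" "x < k" "i \<noteq> k" "i \<noteq> lo x" "k \<noteq> lo x"
  then have "{x, i, k} \<in> insert x ` {S. S \<subseteq> above x - {lo x} \<and> card S = 2}"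
    by (intro image_eqI[of _ _ "{i, k}"]) (auto simp: above_def)
  then show "{x, i, k} \<in> crit"
    using * unfolding crit_def by blast
qed

lemma crit_triple:
  assumes "T \<in> crit"
  obtains p q r where "T = {p, q, r}" "p \<noteq> q" "q \<noteq> r" "p \<noteq> r" "nb {p, q}" "nb {p, r}" "nb {q, r}"
  using assms
proof (cases rule: crit_cases)
  case (1 p q r)
  then show ?thesis
    using that[of p q r] nb_intros(2) by simp
next
  case (2 x i k)
  then show ?thesis
    using that[of x i k] nb_intros(2,3) X_neq_A by simp
qed

lemma tri_triple:
  assumes "p \<noteq> q" "q \<noteq> r" "p \<noteq> r"
  shows "tri {p, q, r} = {{}, {p, q}, {q, r}, {p, r}}"
proof -
  have "D \<subseteq> {p, q, r} \<and> card D = 2 \<longleftrightarrow> D = {p, q} \<or> D = {q, r} \<or> D = {p, r}" for D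
    using assms by (auto simp: card_2_iff)
  then show ?thesis
    unfolding tri_def by blast
qed

lemma card_tri:
  assumes "T \<in> crit"
  shows "card (tri T) = 4"
  using assms
proof (cases rule: crit_triple)
  case (1 p q r)
  then have "{p, q} \<noteq> {q, r}" "{p, q} \<noteq> {p, r}" "{q, r} \<noteq> {p, r}"
    by (simp_all add: doubleton_eq_iff)
  then show ?thesis
    using 1 by (simp add: tri_triple)
qed

lemma tri_in_flag:
  assumes "T \<in> crit"
  shows "tri T \<in> flag_complex U"
  using assms
proof (cases rule: crit_triple)
  case (1 p q r)
  then show ?thesis
    by (subst flag_iff) (auto simp: tri_triple)
qed

text \<open>A further vertex is adjacent to all three edges of \<open>T\<close>, hence meets each of
  them, and by \<open>doubletons_in_triple_transversal\<close> it is one of them.\<close>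

lemma tri_maximal:
  assumes "T \<in> crit" "\<tau> \<in> flag_complex U" "tri T \<subseteq> \<tau>"
  shows "\<tau> = tri T"
  using assms(1)
proof (cases rule: crit_triple)
  case (1 p q r)
  have tri: "tri T = {{}, {p, q}, {q, r}, {p, r}}"
    using 1 by (simp add: tri_triple)
  have "D \<in> tri T" if "D \<in> \<tau>" "D \<noteq> {}" for D
  proof -
    have e: "{} \<in> \<tau>" "{p, q} \<in> \<tau>" "{q, r} \<in> \<tau>" "{p, r} \<in> \<tau>"
      using assms(3) tri by auto
    note m = flagD(2)[OF assms(2) e(1) that]
    have "D \<inter> {p, q} \<noteq> {}" "D \<inter> {q, r} \<noteq> {}" "D \<inter> {p, r} \<noteq> {}"
      using m[OF e(2)] m[OF e(3)] m[OF e(4)] 1(2-4) by simp_all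
    moreover have "finite D" "card D \<le> 2"
      using nb_card[OF flagD(1)[OF assms(2) e(1) that]] by auto
    ultimately have "D \<subseteq> {p, q, r} \<and> card D = 2"
      using 1(2-4) by (intro doubletons_in_triple_transversal) auto
    then show ?thesis
      using 1(1) by (simp add: tri_def)
  qed
  moreover have "{} \<in> tri T"
    by (simp add: tri)
  ultimately show ?thesis
    using assms(3) by blast
qed

lemma inj_on_tri: "inj_on tri crit"
proof (rule inj_on_inverseI)
  fix T assume "T \<in> crit"
  then show "\<Union>(tri T) = T"
  proof (cases rule: crit_triple)
    case (1 p q r)
    then show ?thesis
      by (auto simp: tri_triple)
  qed
qed

lemma finite_crit: "finite crit"
proof -
  have "crit \<subseteq> Pow (A \<union> X)"
    by (auto simp: crit_def above_def)
  then show ?thesis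
    using finite_A finite_X by (meson finite_Pow_iff finite_UnI finite_subset)
qed

lemma crit_with_pair:
  assumes "T \<in> crit" "{a, b} \<in> tri T" "a \<noteq> b"
  obtains z where "z \<noteq> a" "z \<noteq> b" "T = {a, b, z}" "{a, z} \<in> tri T" "{b, z} \<in> tri T"
  using assms(1)
proof (cases rule: crit_triple)
  case (1 p q r)
  then have "{a, b} = {p, q} \<or> {a, b} = {q, r} \<or> {a, b} = {p, r}"
    using assms(2) by (simp add: tri_triple)
  then obtain z where z: "z \<noteq> a" "z \<noteq> b" "T = {a, b, z}"
  proof (elim disjE)
    assume "{a, b} = {p, q}"
    then show thesis using 1(1-4) that[of r] by (auto simp: doubleton_eq_iff)
  next
    assume "{a, b} = {q, r}"
    then show thesis using 1(1-4) that[of p] by (auto simp: doubleton_eq_iff)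
  next
    assume "{a, b} = {p, r}"
    then show thesis using 1(1-4) that[of q] by (auto simp: doubleton_eq_iff)
  qed
  moreover from z have "{a, z} \<in> tri T" "{b, z} \<in> tri T"
    by (auto simp: tri_def)
  ultimately show thesis
    using that by blast
qed

text \<open>\<open>R\<close> are the faces removed so far and \<open>P\<close> those to be removed
  next. The last two clauses let \<open>v\<close> be added to every remaining simplex over
  \<open>\<rho>\<close>: it is adjacent to all vertices, and it does not complete a face of
  \<open>R\<close>.\<close>

definition removable :: "nat set set set \<Rightarrow> nat set set set \<Rightarrow> nat set set \<Rightarrow> nat set \<Rightarrow> bool" where
  "removable P R \<rho> v \<longleftrightarrow> nb v \<and> v \<notin> \<Union>P \<and>
     (\<forall>\<tau>\<in>flag_complex U. \<rho> \<subseteq> \<tau> \<longrightarrow> (\<forall>r\<in>R. \<not> r \<subseteq> \<tau>) \<longrightarrow>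
        (\<forall>D\<in>\<tau>. D \<noteq> {} \<longrightarrow> card D = 1 \<and> card v = 1 \<or> D \<inter> v \<noteq> {}) \<and>
        (\<forall>r\<in>R. v \<in> r \<longrightarrow> \<not> r \<subseteq> insert v \<tau>))"

lemma removableI:
  assumes "nb v" "v \<notin> \<Union>P"
    and "\<And>\<tau> D. \<lbrakk>\<tau> \<in> flag_complex U; \<rho> \<subseteq> \<tau>; \<forall>r\<in>R. \<not> r \<subseteq> \<tau>; D \<in> \<tau>; D \<noteq> {}\<rbrakk> \<Longrightarrow>
      card D = 1 \<and> card v = 1 \<or> D \<inter> v \<noteq> {}"
    and "\<And>\<tau> r. \<lbrakk>\<tau> \<in> flag_complex U; \<rho> \<subseteq> \<tau>; r \<in> R; v \<in> r\<rbrakk> \<Longrightarrow> \<not> r \<subseteq> insert v \<tau>"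
  shows "removable P R \<rho> v"
  unfolding removable_def
  by (intro conjI ballI impI) (fact assms(1,2) | erule (4) assms(3) | erule (3) assms(4))+

text \<open>Singletons are adjacent to each other and belong to no removed face, so for an apex
  \<open>{i}\<close> only the vertices of size 2 have to be checked.\<close>

lemma removable_singletonI:
  assumes "i \<in> A" "\<And>r D. \<lbrakk>r \<in> R \<union> P; D \<in> r\<rbrakk> \<Longrightarrow> card D \<noteq> 1"
    and "\<And>\<tau> D. \<lbrakk>\<tau> \<in> flag_complex U; \<rho> \<subseteq> \<tau>; \<forall>r\<in>R. \<not> r \<subseteq> \<tau>; D \<in> \<tau>; D \<noteq> {}\<rbrakk> \<Longrightarrow> card D = 1 \<or> i \<in> D"
  shows "removable P R \<rho> {i}"
proof (rule removableI)
  show "nb {i}"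
    by (rule nb_intros(1)[OF assms(1)])
  show "{i} \<notin> \<Union>P"
    using assms(2)[of _ "{i}"] by auto
  show "card D = 1 \<and> card {i} = 1 \<or> D \<inter> {i} \<noteq> {}"
    if "\<tau> \<in> flag_complex U" "\<rho> \<subseteq> \<tau>" "\<forall>r\<in>R. \<not> r \<subseteq> \<tau>" "D \<in> \<tau>" "D \<noteq> {}" for \<tau> D
    using assms(3)[OF that] by (elim disjE) simp_all
  show "\<not> r \<subseteq> insert {i} \<tau>" if "r \<in> R" "{i} \<in> r" for \<tau> r
    using assms(2)[OF UnI1 that(2)] that(1) by simp
qed

lemma removal_step:
  assumes fin: "finite P" and e: "\<And>\<rho>. \<rho> \<in> P \<Longrightarrow> {} \<in> \<rho>"
    and v: "\<And>\<rho>. \<rho> \<in> P \<Longrightarrow> \<exists>v. removable P R \<rho> v"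
  shows "reduces 3 {\<tau> \<in> flag_complex U. \<forall>r\<in>R. \<not> r \<subseteq> \<tau>} 0 {\<tau> \<in> flag_complex U. \<forall>r\<in>R \<union> P. \<not> r \<subseteq> \<tau>}"
proof -
  let ?K = "{\<tau> \<in> flag_complex U. \<forall>r\<in>R. \<not> r \<subseteq> \<tau>}"
  have "reduces 3 ?K 0 {\<tau> \<in> ?K. \<forall>\<rho>\<in>P. \<not> \<rho> \<subseteq> \<tau>}"
  proof (rule cone_removal_family[OF fin])
    show "abstract_complex ?K"
      by (intro abstract_complex_filter abstract_complex_flag_complex finite_U)
    show "\<rho> \<noteq> {}" if "\<rho> \<in> P" for \<rho>
      using e[OF that] by auto
    show "\<exists>v. v \<notin> \<Union>P \<and> (\<forall>\<tau>\<in>?K. \<rho> \<subseteq> \<tau> \<longrightarrow> insert v \<tau> \<in> ?K)" if \<rho>: "\<rho> \<in> P" for \<rho>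
    proof -
      obtain v where v1: "nb v" "v \<notin> \<Union>P" and v2: "\<And>\<tau>. \<lbrakk>\<tau> \<in> flag_complex U; \<rho> \<subseteq> \<tau>; \<forall>r\<in>R. \<not> r \<subseteq> \<tau>\<rbrakk> \<Longrightarrow>
         (\<forall>D\<in>\<tau>. D \<noteq> {} \<longrightarrow> card D = 1 \<and> card v = 1 \<or> D \<inter> v \<noteq> {}) \<and>
         (\<forall>r\<in>R. v \<in> r \<longrightarrow> \<not> r \<subseteq> insert v \<tau>)"
        using v[OF \<rho>] unfolding removable_def by metis
      have "insert v \<tau> \<in> ?K" if "\<tau> \<in> ?K" "\<rho> \<subseteq> \<tau>" for \<tau>
      proof -
        have \<tau>: "\<tau> \<in> flag_complex U" "\<forall>r\<in>R. \<not> r \<subseteq> \<tau>"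
          using that(1) by auto
        have "{} \<in> \<tau>"
          using e[OF \<rho>] that(2) by auto
        note v3 = v2[OF \<tau>(1) that(2) \<tau>(2)]
        have "insert v \<tau> \<in> flag_complex U"
        proof (subst flag_iff)
          show "{} \<in> insert v \<tau>"
            using \<open>{} \<in> \<tau>\<close> by simp
          have 1: "\<forall>D\<in>\<tau>. D \<noteq> {} \<longrightarrow> nb D"
            and 2: "\<forall>D\<in>\<tau>. \<forall>E\<in>\<tau>. D \<noteq> {} \<longrightarrow> E \<noteq> {} \<longrightarrow> card D = 1 \<and> card E = 1 \<or> D \<inter> E \<noteq> {}"
            using \<tau>(1) flag_iff[OF \<open>{} \<in> \<tau>\<close>] by blast+
          have 3: "v \<inter> v \<noteq> {}"
            using nb_card(3)[OF v1(1)] by simp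
          have 4: "\<forall>D\<in>\<tau>. D \<noteq> {} \<longrightarrow> card D = 1 \<and> card v = 1 \<or> D \<inter> v \<noteq> {}"
            using v3 by blast
          show "(\<forall>D\<in>insert v \<tau>. D \<noteq> {} \<longrightarrow> nb D) \<and> (\<forall>D\<in>insert v \<tau>. \<forall>E\<in>insert v \<tau>.
              D \<noteq> {} \<longrightarrow> E \<noteq> {} \<longrightarrow> card D = 1 \<and> card E = 1 \<or> D \<inter> E \<noteq> {})"
            using 1 2 3 4 v1(1) by (metis Int_commute insert_iff)
        qed
        moreover have "\<not> r \<subseteq> insert v \<tau>" if "r \<in> R" for r
          using v3 that \<tau>(2) by (meson subset_insert)
        ultimately show ?thesis
          by simp
      qed
      then show ?thesis
        using v1(2) by blast
    qed
  qed
  moreover have "{\<tau> \<in> ?K. \<forall>\<rho>\<in>P. \<not> \<rho> \<subseteq> \<tau>} = {\<tau> \<in> flag_complex U. \<forall>r\<in>R \<union> P. \<not> r \<subseteq> \<tau>}"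
    by blast
  ultimately show ?thesis
    by simp
qed

lemma finite_family:
  assumes "\<And>\<rho>. \<rho> \<in> P \<Longrightarrow> \<rho> \<subseteq> Pow (A \<union> X)"
  shows "finite P"
proof -
  have "P \<subseteq> Pow (Pow (A \<union> X))"
    using assms by blast
  then show ?thesis
    using finite_A finite_X by (meson finite_Pow_iff finite_UnI finite_subset)
qed

text \<open>After the critical tetrahedra, six families of faces at the vertex \<open>{}\<close> go,
  ordered so that each has cone apexes when its turn comes: two edges through \<open>x\<close> away
  from \<open>lo x\<close>, then two including \<open>{x, lo x}\<close>, then one; two edges inside
  \<open>A\<close> with a common end, then one; finally \<open>{}\<close> itself.\<close>

lemma reduces_star: "reduces 3 (flag_complex U) (card crit) (flag_complex (U - {{}}))"
proof -
  define P1 where "P1 = {{{}, {x, i}, {x, k}} | x i k. x \<in> X \<and> i \<in> A \<and> k \<in> A \<and> x < i \<and> x < k \<and>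
    i \<noteq> k \<and> i \<noteq> lo x \<and> k \<noteq> lo x}"
  define P2 where "P2 = {{{}, {x, lo x}, {x, i}} | x i. x \<in> X \<and> i \<in> A \<and> x < i \<and> i \<noteq> lo x}"
  define P3 where "P3 = {{{}, {x, i}} | x i. x \<in> X \<and> i \<in> A \<and> x < i}"
  define P4 where "P4 = {{{}, {i, j}, {j, k}} | i j k. i \<in> A \<and> j \<in> A \<and> k \<in> A \<and> i \<noteq> j \<and> j \<noteq> k \<and> i \<noteq> k}"
  define P5 where "P5 = {{{}, {i, j}} | i j. i \<in> A \<and> j \<in> A \<and> i \<noteq> j}"
  define P6 :: "nat set set set" where "P6 = {{{}}}"
  define R where "R = tri ` crit"
  let ?F = "\<lambda>R. {\<tau> \<in> flag_complex U. \<forall>r\<in>R. \<not> r \<subseteq> \<tau>}"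
  have P1I: "{{}, {x, i}, {x, k}} \<in> P1"
    if "x \<in> X" "i \<in> A" "k \<in> A" "x < i" "x < k" "i \<noteq> k" "i \<noteq> lo x" "k \<noteq> lo x" for x i k
    unfolding P1_def using that by blast
  have P2I: "{{}, {x, lo x}, {x, i}} \<in> P2" if "x \<in> X" "i \<in> A" "x < i" "i \<noteq> lo x" for x i
    unfolding P2_def using that by blast
  have P3I: "{{}, {x, i}} \<in> P3" if "x \<in> X" "i \<in> A" "x < i" for x i
    unfolding P3_def using that by blast
  have P4I: "{{}, {i, j}, {j, k}} \<in> P4" if "i \<in> A" "j \<in> A" "k \<in> A" "i \<noteq> j" "j \<noteq> k" "i \<noteq> k" for i j k
    unfolding P4_def using that by blast
  have P5I: "{{}, {i, j}} \<in> P5" if "i \<in> A" "j \<in> A" "i \<noteq> j" for i j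
    unfolding P5_def using that by blast
  have tri_no: "\<not> {{}, {p, q}, {q, r}, {p, r}} \<subseteq> \<tau>"
    if "{p, q, r} \<in> crit" "p \<noteq> q" "q \<noteq> r" "p \<noteq> r" "\<forall>r\<in>R \<union> S. \<not> r \<subseteq> \<tau>" for p q r \<tau> S
  proof -
    have "tri {p, q, r} \<in> R"
      using that(1) by (simp add: R_def)
    then show ?thesis
      using that(5) by (simp only: tri_triple[OF that(2-4)]) blast
  qed
  have card_R: "card D \<noteq> 1" if "r \<in> R \<union> P1 \<union> P2 \<union> P3 \<union> P4 \<union> P5" "D \<in> r" for r D
  proof -
    have 2: "card {x, i :: nat} = 2" if "x < i" for x i
      using that by simp
    have 3: "card {i, j :: nat} = 2" if "i \<noteq> j" for i j
      using that by simp
    from that(1) have "D = {} \<or> card D = 2"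
    proof (elim UnE)
      assume "r \<in> R"
      then show ?thesis
        using that(2) by (auto simp: R_def tri_def)
    next
      assume "r \<in> P1"
      then show ?thesis
        using that(2) 2 unfolding P1_def by blast
    next
      assume "r \<in> P2"
      then show ?thesis
        using that(2) 2 lo unfolding P2_def by blast
    next
      assume "r \<in> P3"
      then show ?thesis
        using that(2) 2 unfolding P3_def by blast
    next
      assume "r \<in> P4"
      then show ?thesis
        using that(2) 3 unfolding P4_def by blast
    next
      assume "r \<in> P5"
      then show ?thesis
        using that(2) 3 unfolding P5_def by blast
    qed
    then show ?thesis by auto
  qed
  have step0: "reduces 3 (flag_complex U) (card crit) (?F R)"
  proof -
    have "reduces 3 (flag_complex U) (card (tri ` crit)) (flag_complex U - tri ` crit)"
      using finite_crit card_tri tri_in_flag tri_maximal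
      by (intro critical_removal_family) auto
    moreover have "flag_complex U - tri ` crit = ?F R"
      using tri_maximal by (auto simp: R_def)
    ultimately show ?thesis
      by (simp add: card_image inj_on_tri)
  qed
  have step1: "reduces 3 (?F R) 0 (?F (R \<union> P1))"
  proof (rule removal_step)
    show "finite P1"
      by (rule finite_family) (auto simp: P1_def)
    show "{} \<in> \<rho>" if "\<rho> \<in> P1" for \<rho>
      using that by (auto simp: P1_def)
    fix \<rho> assume "\<rho> \<in> P1"
    then obtain x i k where \<rho>: "\<rho> = {{}, {x, i}, {x, k}}"
      and xik: "x \<in> X" "i \<in> A" "k \<in> A" "x < i" "x < k" "i \<noteq> k" "i \<noteq> lo x" "k \<noteq> lo x"
      unfolding P1_def by blast
    \<comment> \<open>A vertex adjacent to \<open>{x, i}\<close> and \<open>{x, k}\<close> contains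
      \<open>x\<close> or is \<open>{i, k}\<close>, and the latter would complete the removed
      tetrahedron of \<open>{x, i, k}\<close>. The apex itself completes none, since a critical
      triple with \<open>x\<close> avoids \<open>lo x\<close>.\<close>
    let ?v = "{x, lo x}"
    note l = lo[OF xik(2,4)]
    show "\<exists>v. removable P1 R \<rho> v"
    proof (rule exI[of _ ?v], rule removableI)
      show "nb ?v"
        using nb_intros(3) xik(1) l by blast
      show "?v \<notin> \<Union>P1"
        using xik(1) l X_neq_A by (auto simp: P1_def doubleton_eq_iff)
    next
      fix \<tau> D assume \<tau>: "\<tau> \<in> flag_complex U" "\<rho> \<subseteq> \<tau>" "\<forall>r\<in>R. \<not> r \<subseteq> \<tau>" and D: "D \<in> \<tau>" "D \<noteq> {}"
      have \<rho>\<tau>: "{} \<in> \<tau>" "{x, i} \<in> \<tau>" "{x, k} \<in> \<tau>"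
        using \<tau>(2) \<rho> by auto
      note m = flagD[OF \<tau>(1) \<rho>\<tau>(1) D]
      show "card D = 1 \<and> card ?v = 1 \<or> D \<inter> ?v \<noteq> {}"
      proof (cases "x \<in> D")
        case False
        then have "i \<in> D" "k \<in> D"
          using m(2)[OF \<rho>\<tau>(2)] m(2)[OF \<rho>\<tau>(3)] xik by auto
        then have "D = {i, k}"
          using nb_eq_doubleton m(1) xik by blast
        then show ?thesis
          using tri_no[of x i k "{}" \<tau>] crit_intros(2)[OF xik] \<rho>\<tau> D(1) \<tau>(3) xik by auto
      qed auto
    next
      fix \<tau> r assume "r \<in> R" "?v \<in> r"
      then obtain T where T: "T \<in> crit" "?v \<in> tri T"
        by (auto simp: R_def)
      then have "x \<in> T" "lo x \<in> T"
        by (auto simp: tri_def)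
      with T(1) have False
        using xik(1) X_neq_A l by (cases rule: crit_cases) auto
      then show "\<not> r \<subseteq> insert ?v \<tau>" ..
    qed
  qed
  \<comment> \<open>Consequence of the removal of \<open>P1\<close>: two different edges through
    \<open>x\<close> survive together only if one of them is \<open>{x, lo x}\<close>.\<close>
  have star_x: "D = {x, k} \<Longrightarrow> k = i \<or> k = lo x \<or> i = lo x"
    if "x \<in> X" "i \<in> A" "x < i" "\<forall>r\<in>R \<union> P1 \<union> S. \<not> r \<subseteq> \<tau>" "{} \<in> \<tau>" "{x, i} \<in> \<tau>" "D \<in> \<tau>" "k \<in> A" "x < k"
    for x i \<tau> D k S
  proof (rule ccontr)
    assume "D = {x, k}" and "\<not> (k = i \<or> k = lo x \<or> i = lo x)"
    then have "{{}, {x, i}, {x, k}} \<in> P1"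
      using P1I[of x i k] that(1,2,3,8,9) by auto
    then have "\<not> {{}, {x, i}, {x, k}} \<subseteq> \<tau>"
      using that(4) by blast
    then show False
      using that(5-7) \<open>D = {x, k}\<close> by simp
  qed
  have step2: "reduces 3 (?F (R \<union> P1)) 0 (?F (R \<union> P1 \<union> P2))"
  proof (rule removal_step)
    show "finite P2"
      by (rule finite_family) (use lo in \<open>auto simp: P2_def\<close>)
    show "{} \<in> \<rho>" if "\<rho> \<in> P2" for \<rho>
      using that by (auto simp: P2_def)
    fix \<rho> assume "\<rho> \<in> P2"
    then obtain x i where \<rho>: "\<rho> = {{}, {x, lo x}, {x, i}}"
      and xi: "x \<in> X" "i \<in> A" "x < i" "i \<noteq> lo x"
      unfolding P2_def by blast
    \<comment> \<open>A vertex avoiding \<open>x\<close> contains \<open>lo x\<close> because it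
      meets \<open>{x, lo x}\<close>; one through \<open>x\<close> is \<open>{x, i}\<close> or
      \<open>{x, lo x}\<close> by \<open>star_x\<close>.\<close>
    let ?v = "{lo x, i}"
    note l = lo[OF xi(2,3)]
    show "\<exists>v. removable P2 (R \<union> P1) \<rho> v"
    proof (rule exI[of _ ?v], rule removableI)
      show "nb ?v"
        using nb_intros(2) xi l by blast
      show "?v \<notin> \<Union>P2"
        using xi l A_not_X by (auto simp: P2_def doubleton_eq_iff)
    next
      fix \<tau> D assume \<tau>: "\<tau> \<in> flag_complex U" "\<rho> \<subseteq> \<tau>" "\<forall>r\<in>R \<union> P1. \<not> r \<subseteq> \<tau>" and D: "D \<in> \<tau>" "D \<noteq> {}"
      have \<rho>\<tau>: "{} \<in> \<tau>" "{x, lo x} \<in> \<tau>" "{x, i} \<in> \<tau>"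
        using \<tau>(2) \<rho> by auto
      note m = flagD[OF \<tau>(1) \<rho>\<tau>(1) D]
      show "card D = 1 \<and> card ?v = 1 \<or> D \<inter> ?v \<noteq> {}"
      proof (cases "x \<in> D")
        case False
        then show ?thesis
          using m(2)[OF \<rho>\<tau>(2)] l by auto
      next
        case True
        then obtain k where k: "k \<in> A" "x < k" "D = {x, k}"
          using nb_with_X m(1) xi(1) by blast
        then show ?thesis
          using star_x[OF xi(1-3) _ \<rho>\<tau>(1,3) D(1) k(1,2), of "{}"] \<tau>(3) xi(4) by auto
      qed
    next
      fix \<tau> r assume \<tau>: "\<tau> \<in> flag_complex U" "\<rho> \<subseteq> \<tau>" and r: "r \<in> R \<union> P1" "?v \<in> r"
      have \<rho>\<tau>: "{} \<in> \<tau>" "{x, lo x} \<in> \<tau>" "{x, i} \<in> \<tau>"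
        using \<tau>(2) \<rho> by auto
      have "r \<notin> P1"
        using r(2) xi l A_not_X by (auto simp: P1_def doubleton_eq_iff)
      then obtain T where T: "T \<in> crit" "r = tri T"
        using r(1) by (auto simp: R_def)
      then obtain z where z: "z \<noteq> lo x" "z \<noteq> i" "T = {lo x, i, z}" "{lo x, z} \<in> tri T"
        using crit_with_pair[of T "lo x" i] r(2) xi(4) by metis
      show "\<not> r \<subseteq> insert ?v \<tau>"
      proof
        assume "r \<subseteq> insert ?v \<tau>"
        \<comment> \<open>A tetrahedron completed by the apex has its other edge
          \<open>{lo x, z}\<close> in \<open>\<tau>\<close>. This edge meets \<open>{x, i}\<close>
          only if \<open>z = x\<close>, but no critical triple contains both \<open>x\<close> and
          \<open>lo x\<close>.\<close>
        then have "{lo x, z} \<in> \<tau>"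
          using z T(2) by (auto simp: doubleton_eq_iff)
        from flagD(2)[OF \<tau>(1) \<rho>\<tau>(1) this _ \<rho>\<tau>(3)] have "z = x"
          using xi l z X_neq_A by auto
        then have T': "x \<in> T" "lo x \<in> T" "\<And>y. y \<in> T \<Longrightarrow> y \<in> X \<Longrightarrow> y = x"
          using z(3) xi l A_not_X by auto
        from T(1) show False
        proof (cases rule: crit_cases)
          case 1
          then show False
            using T'(1) xi(1) A_not_X by auto
        next
          case (2 y a b)
          then have "y = x"
            using T'(3)[of y] by simp
          then show False
            using T'(2) 2 l by auto
        qed
      qed
    qed
  qed
  have step3: "reduces 3 (?F (R \<union> P1 \<union> P2)) 0 (?F (R \<union> P1 \<union> P2 \<union> P3))"
  proof (rule removal_step)
    show "finite P3"
      by (rule finite_family) (auto simp: P3_def)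
    show "{} \<in> \<rho>" if "\<rho> \<in> P3" for \<rho>
      using that by (auto simp: P3_def)
    fix \<rho> assume "\<rho> \<in> P3"
    then obtain x i where \<rho>: "\<rho> = {{}, {x, i}}" and xi: "x \<in> X" "i \<in> A" "x < i"
      unfolding P3_def by blast
    note l = lo[OF xi(2,3)]
    show "\<exists>v. removable P3 (R \<union> P1 \<union> P2) \<rho> v"
    \<comment> \<open>By now \<open>{x, i}\<close> is the only edge through \<open>x\<close> in the
      simplex, and every vertex avoiding \<open>x\<close> meets \<open>{x, i}\<close> in
      \<open>i\<close>.\<close>
    proof (rule exI[of _ "{i}"], rule removable_singletonI)
      show "i \<in> A"
        using xi by blast
      show "card D \<noteq> 1" if "r \<in> R \<union> P1 \<union> P2 \<union> P3" "D \<in> r" for r D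
        by (rule card_R[OF _ that(2)]) (use that(1) in blast)
    next
      fix \<tau> D assume \<tau>: "\<tau> \<in> flag_complex U" "\<rho> \<subseteq> \<tau>" "\<forall>r\<in>R \<union> P1 \<union> P2. \<not> r \<subseteq> \<tau>" and D: "D \<in> \<tau>" "D \<noteq> {}"
      have \<rho>\<tau>: "{} \<in> \<tau>" "{x, i} \<in> \<tau>"
        using \<tau>(2) \<rho> by auto
      note m = flagD[OF \<tau>(1) \<rho>\<tau>(1) D]
      show "card D = 1 \<or> i \<in> D"
      proof (cases "x \<in> D")
        case False
        then show ?thesis
          using m(2)[OF \<rho>\<tau>(2)] xi by auto
      next
        case True
        then obtain k where k: "k \<in> A" "x < k" "D = {x, k}"
          using nb_with_X m(1) xi(1) by blast
        then have "k = i \<or> k = lo x \<or> i = lo x"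
          using star_x[OF xi _ \<rho>\<tau> D(1) k(1,2)] \<tau>(3) by blast
        moreover have False if "k \<noteq> i" "k = lo x"
          by (rule not_subset_familyD[OF \<tau>(3), of "{{}, {x, lo x}, {x, i}}"])
            (use P2I[of x i] that k xi \<rho>\<tau> D(1) in auto)
        moreover have False if "k \<noteq> i" "i = lo x"
          by (rule not_subset_familyD[OF \<tau>(3), of "{{}, {x, lo x}, {x, k}}"])
            (use P2I[of x k] that k xi \<rho>\<tau> D(1) in auto)
        ultimately show ?thesis
          using k(3) by auto
      qed
    qed
  qed
  have step4: "reduces 3 (?F (R \<union> P1 \<union> P2 \<union> P3)) 0 (?F (R \<union> P1 \<union> P2 \<union> P3 \<union> P4))"
  proof (rule removal_step)
    show "finite P4"
      by (rule finite_family) (auto simp: P4_def)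
    show "{} \<in> \<rho>" if "\<rho> \<in> P4" for \<rho>
      using that by (auto simp: P4_def)
    fix \<rho> assume "\<rho> \<in> P4"
    then obtain i j k where \<rho>: "\<rho> = {{}, {i, j}, {j, k}}"
      and ijk: "i \<in> A" "j \<in> A" "k \<in> A" "i \<noteq> j" "j \<noteq> k" "i \<noteq> k"
      unfolding P4_def by blast
    show "\<exists>v. removable P4 (R \<union> P1 \<union> P2 \<union> P3) \<rho> v"
    \<comment> \<open>A vertex without \<open>j\<close> that meets \<open>{i, j}\<close> and
      \<open>{j, k}\<close> is \<open>{i, k}\<close>, which would complete the removed tetrahedron
      of \<open>{i, j, k}\<close>.\<close>
    proof (rule exI[of _ "{j}"], rule removable_singletonI)
      show "j \<in> A"
        using ijk by blast
      show "card D \<noteq> 1" if "r \<in> R \<union> P1 \<union> P2 \<union> P3 \<union> P4" "D \<in> r" for r D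
        by (rule card_R[OF _ that(2)]) (use that(1) in blast)
    next
      fix \<tau> D assume \<tau>: "\<tau> \<in> flag_complex U" "\<rho> \<subseteq> \<tau>" "\<forall>r\<in>R \<union> P1 \<union> P2 \<union> P3. \<not> r \<subseteq> \<tau>"
        and D: "D \<in> \<tau>" "D \<noteq> {}"
      have \<rho>\<tau>: "{} \<in> \<tau>" "{i, j} \<in> \<tau>" "{j, k} \<in> \<tau>"
        using \<tau>(2) \<rho> by auto
      note m = flagD[OF \<tau>(1) \<rho>\<tau>(1) D]
      show "card D = 1 \<or> j \<in> D"
      proof (cases "j \<in> D")
        case False
        then have "i \<in> D" "k \<in> D"
          using m(2)[OF \<rho>\<tau>(2)] m(2)[OF \<rho>\<tau>(3)] ijk by auto
        then have "D = {i, k}"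
          using nb_eq_doubleton m(1) ijk by blast
        then show ?thesis
          using tri_no[of i j k "P1 \<union> P2 \<union> P3" \<tau>] crit_intros(1)[of i j k] \<rho>\<tau> D(1) \<tau>(3) ijk
          by (auto simp: Un_assoc)
      qed auto
    qed
  qed
  have step5: "reduces 3 (?F (R \<union> P1 \<union> P2 \<union> P3 \<union> P4)) 0 (?F (R \<union> P1 \<union> P2 \<union> P3 \<union> P4 \<union> P5))"
  proof (rule removal_step)
    show "finite P5"
      by (rule finite_family) (auto simp: P5_def)
    show "{} \<in> \<rho>" if "\<rho> \<in> P5" for \<rho>
      using that by (auto simp: P5_def)
    fix \<rho> assume "\<rho> \<in> P5"
    then obtain i j where \<rho>: "\<rho> = {{}, {i, j}}" and ij: "i \<in> A" "j \<in> A" "i \<noteq> j"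
      unfolding P5_def by blast
    show "\<exists>v. removable P5 (R \<union> P1 \<union> P2 \<union> P3 \<union> P4) \<rho> v"
    \<comment> \<open>Another edge at \<open>j\<close> would complete a face of \<open>P4\<close>,
      and edges through points of \<open>X\<close> are gone with \<open>P3\<close>, so all edges
      left contain \<open>i\<close>.\<close>
    proof (rule exI[of _ "{i}"], rule removable_singletonI)
      show "i \<in> A"
        using ij by blast
      show "card D \<noteq> 1" if "r \<in> R \<union> P1 \<union> P2 \<union> P3 \<union> P4 \<union> P5" "D \<in> r" for r D
        by (rule card_R[OF _ that(2)]) (use that(1) in blast)
    next
      fix \<tau> D assume \<tau>: "\<tau> \<in> flag_complex U" "\<rho> \<subseteq> \<tau>" "\<forall>r\<in>R \<union> P1 \<union> P2 \<union> P3 \<union> P4. \<not> r \<subseteq> \<tau>"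
        and D: "D \<in> \<tau>" "D \<noteq> {}"
      have \<rho>\<tau>: "{} \<in> \<tau>" "{i, j} \<in> \<tau>"
        using \<tau>(2) \<rho> by auto
      note m = flagD[OF \<tau>(1) \<rho>\<tau>(1) D]
      have ne: "D \<inter> {i, j} \<noteq> {}"
        using m(2)[OF \<rho>\<tau>(2)] ij by simp
      from m(1) consider a where "D = {a}" | a b where "a \<in> A" "b \<in> A" "a \<noteq> b" "D = {a, b}"
        | x a where "x \<in> X" "a \<in> A" "x < a" "D = {x, a}"
        unfolding nb_def by blast
      then show "card D = 1 \<or> i \<in> D"
      proof cases
        case 1
        then show ?thesis by simp
      next
        case 2
        show ?thesis
        proof (cases "i \<in> D")
          case False
          then have "j \<in> D"
            using ne by auto
          then obtain b where b: "D = {j, b}" "b \<noteq> j" "b \<in> A"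
            using 2 by (auto simp: insert_commute)
          then have "{{}, {i, j}, {j, b}} \<in> P4"
            using P4I[of i j b] False ij by auto
          then have "\<not> {{}, {i, j}, {j, b}} \<subseteq> \<tau>"
            using \<tau>(3) by blast
          then show ?thesis
            using \<rho>\<tau> D(1) b(1) by auto
        qed auto
      next
        case 3
        then show ?thesis
          using not_subset_familyD[OF \<tau>(3), of "{{}, {x, a}}"] P3I[of x a] D(1) \<rho>\<tau>(1) by simp
      qed
    qed
  qed
  let ?R5 = "R \<union> P1 \<union> P2 \<union> P3 \<union> P4 \<union> P5"
  have step6: "reduces 3 (?F ?R5) 0 (?F (?R5 \<union> P6))"
  proof (rule removal_step)
    show "finite P6" and "\<And>\<rho>. \<rho> \<in> P6 \<Longrightarrow> {} \<in> \<rho>"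
      by (auto simp: P6_def)
    fix \<rho> assume "\<rho> \<in> P6"
    then have \<rho>: "\<rho> = {{}}"
      by (simp add: P6_def)
    obtain i where i: "i \<in> A"
      using A_ne by blast
    show "\<exists>v. removable P6 ?R5 \<rho> v"
    \<comment> \<open>Besides \<open>{}\<close> only singletons remain, so any
      \<open>i \<in> A\<close> serves.\<close>
    proof (rule exI[of _ "{i}"], rule removable_singletonI)
      show "i \<in> A"
        using i by blast
      show "card D \<noteq> 1" if "r \<in> ?R5 \<union> P6" "D \<in> r" for r D
        using that(1)
      proof
        assume "r \<in> P6"
        then show ?thesis
          using that(2) by (simp add: P6_def)
      qed (rule card_R[OF _ that(2)])
    next
      fix \<tau> D assume \<tau>: "\<tau> \<in> flag_complex U" "\<rho> \<subseteq> \<tau>" "\<forall>r\<in>?R5. \<not> r \<subseteq> \<tau>"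
        and D: "D \<in> \<tau>" "D \<noteq> {}"
      have \<rho>\<tau>: "{} \<in> \<tau>"
        using \<tau>(2) \<rho> by auto
      have "nb D"
        using flagD[OF \<tau>(1) \<rho>\<tau>(1) D] by blast
      then consider a where "D = {a}" | a b where "a \<in> A" "b \<in> A" "a \<noteq> b" "D = {a, b}"
        | x a where "x \<in> X" "a \<in> A" "x < a" "D = {x, a}"
        unfolding nb_def by blast
      then show "card D = 1 \<or> i \<in> D"
      proof cases
        case 1
        then show ?thesis by simp
      next
        case 2
        then show ?thesis
          using not_subset_familyD[OF \<tau>(3), of "{{}, {a, b}}"] P5I[of a b] D(1) \<rho>\<tau>(1) by simp
      next
        case 3
        then show ?thesis
          using not_subset_familyD[OF \<tau>(3), of "{{}, {x, a}}"] P3I[of x a] D(1) \<rho>\<tau>(1) by simp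
      qed
    qed
  qed
  \<comment> \<open>Every removed face contains \<open>{}\<close>, and \<open>P6\<close> removes all
    simplices with this vertex, so its condition alone describes the result.\<close>
  have "?F (?R5 \<union> P6) = flag_complex (U - {{}})"
  proof -
    have "{} \<in> r" if "r \<in> ?R5 \<union> P6" for r
      using that by (auto simp: R_def tri_def P1_def P2_def P3_def P4_def P5_def P6_def)
    then have "(\<forall>r\<in>?R5 \<union> P6. \<not> r \<subseteq> \<tau>) \<longleftrightarrow> {} \<notin> \<tau>" for \<tau>
      by (auto simp: P6_def)
    then have "?F (?R5 \<union> P6) = {\<tau> \<in> flag_complex U. {} \<notin> \<tau>}"
      by simp
    also have "\<dots> = flag_complex (U - {{}})"
      unfolding flag_complex_def by blast
    finally show ?thesis .
  qed
  moreover have "reduces 3 (flag_complex U) (card crit + 0 + 0 + 0 + 0 + 0 + 0) (?F (?R5 \<union> P6))"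
    by (rule reduces_trans[OF reduces_trans[OF reduces_trans[OF reduces_trans[OF reduces_trans[OF
          reduces_trans[OF step0 step1] step2] step3] step4] step5] step6])
  ultimately show ?thesis
    by simp
qed

end

section \<open>Counting critical simplices\<close>

context translated_star
begin

lemma card_crit: "card crit = (card A choose 3) + (\<Sum>x\<in>X. (card (above x) - 1) choose 2)"
proof -
  let ?C = "\<lambda>x. insert x ` {S. S \<subseteq> above x - {lo x} \<and> card S = 2}"
  have fin_above: "finite (above x)" for x
    using finite_A by (simp add: above_def)
  have fin: "finite (?C x)" for x
    using fin_above by simp
  have card_C: "card (?C x) = (card (above x) - 1) choose 2" if "x \<in> X" for x
  proof -
    have "x \<notin> above x"
      by (simp add: above_def)
    then have "inj_on (insert x) {S. S \<subseteq> above x - {lo x} \<and> card S = 2}"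
      by (intro inj_onI) (metis (mono_tags, lifting) DiffD1 insert_ident mem_Collect_eq subsetD)
    then have "card (?C x) = card {S. S \<subseteq> above x - {lo x} \<and> card S = 2}"
      by (rule card_image)
    also have "\<dots> = card (above x - {lo x}) choose 2"
      by (rule n_subsets) (simp add: fin_above)
    also have "card (above x - {lo x}) = card (above x) - 1"
    \<comment> \<open>If no element of \<open>A\<close> exceeds \<open>x\<close>, truncated
      subtraction makes both sides 0.\<close>
    proof (cases "above x = {}")
      case False
      then have "lo x \<in> above x"
        unfolding lo_def by (intro Min_in fin_above)
      then show ?thesis
        by (simp add: fin_above)
    qed simp
    finally show ?thesis .
  qed
  have "?C x \<inter> ?C y = {}" if "x \<in> X" "y \<in> X" "x \<noteq> y" for x y
    using that A_not_X unfolding above_def by blast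
  then have "card (\<Union>x\<in>X. ?C x) = (\<Sum>x\<in>X. card (?C x))"
    using finite_X fin by (intro card_UN_disjoint) auto
  also have "\<dots> = (\<Sum>x\<in>X. (card (above x) - 1) choose 2)"
    by (rule sum.cong[OF refl card_C])
  moreover have "{T. T \<subseteq> A \<and> card T = 3} \<inter> (\<Union>x\<in>X. ?C x) = {}"
    using A_not_X by blast
  then have "card crit = card {T. T \<subseteq> A \<and> card T = 3} + card (\<Union>x\<in>X. ?C x)"
    unfolding crit_def using finite_A finite_X fin by (intro card_Un_disjoint) auto
  ultimately show ?thesis
    using n_subsets[OF finite_A, of 3] by simp
qed

end

text \<open>The elements above \<open>x\<close> form a final segment of the sorted list, so
  \<open>x\<close> lies below entry \<open>j\<close> exactly when this segment reaches back to
  \<open>j\<close>. Entries are counted from 0.\<close>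

lemma less_nth_sorted_list_iff:
  fixes A :: "nat set"
  assumes "finite A" "j < card A"
  shows "x < sorted_list_of_set A ! j \<longleftrightarrow> card A - j \<le> card {i \<in> A. x < i}"
proof -
  define xs where "xs = sorted_list_of_set A"
  have xs: "set xs = A" "length xs = card A" "distinct xs" "sorted xs"
    using assms(1) by (simp_all add: xs_def)
  have card_drop: "card (set (drop k xs)) = card A - k" for k
    using xs by (simp add: distinct_card)
  show ?thesis
    unfolding xs_def[symmetric]
  proof
    assume l: "x < xs ! j"
    have "set (drop j xs) \<subseteq> {i \<in> A. x < i}"
    proof
      fix i assume "i \<in> set (drop j xs)"
      then obtain k where "k < length xs" "j \<le> k" "i = xs ! k"
        by (auto simp: in_set_conv_nth less_diff_conv add.commute)
      then show "i \<in> {i \<in> A. x < i}"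
        using l xs sorted_nth_mono[of xs j k] by auto
    qed
    then show "card A - j \<le> card {i \<in> A. x < i}"
      using assms(1) card_drop[of j] by (metis card_mono finite_Collect_conjI Collect_mem_eq)
  next
    assume le: "card A - j \<le> card {i \<in> A. x < i}"
    show "x < xs ! j"
    proof (rule ccontr)
      assume n: "\<not> x < xs ! j"
      have "{i \<in> A. x < i} \<subseteq> set (drop (Suc j) xs)"
      proof
        fix i assume "i \<in> {i \<in> A. x < i}"
        then obtain k where k: "k < length xs" "i = xs ! k" "x < i"
          using xs(1) by (auto simp: in_set_conv_nth)
        then have "\<not> k \<le> j"
          using n sorted_nth_mono[of xs k j] xs assms(2) by auto
        then show "i \<in> set (drop (Suc j) xs)"
          using k by (auto simp: in_set_conv_nth intro!: exI[of _ "k - Suc j"])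
      qed
      then have "card {i \<in> A. x < i} \<le> card A - Suc j"
        using card_drop[of "Suc j"] by (metis List.finite_set card_mono)
      then show False
        using le assms(2) by simp
    qed
  qed
qed

text \<open>These points fill the gap before the \<open>l\<close>-th element of \<open>A\<close>.
  The first gap is measured from 0, which is not in \<open>{1..m}\<close>, and therefore loses
  one.\<close>

lemma card_gap:
  assumes A: "A \<subseteq> {1..m}" and l: "1 \<le> l" "l \<le> card A"
  shows "card {x \<in> {1..m} - A. card {i \<in> A. x < i} = card A - l + 1} = (if l = 1 then gap A l - 1 else gap A l)"
proof -
  define xs where "xs = sorted_list_of_set A"
  have fin: "finite A"
    using A finite_subset by blast
  have xs: "set xs = A" "length xs = card A" "sorted xs"
    using fin by (simp_all add: xs_def)
  note iff = less_nth_sorted_list_iff[OF fin, folded xs_def]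
  have le: "card {i \<in> A. x < i} \<le> card A" for x
    using fin by (intro card_mono) auto
  have inA: "xs ! j \<in> A" if "j < card A" for j
    using that xs by (metis nth_mem)
  show ?thesis
  proof (cases "l = 1")
    case True
    have "{x \<in> {1..m} - A. card {i \<in> A. x < i} = card A - l + 1} = {1..<xs ! 0}"
    proof (intro set_eqI iffI)
      fix x assume "x \<in> {x \<in> {1..m} - A. card {i \<in> A. x < i} = card A - l + 1}"
      then show "x \<in> {1..<xs ! 0}"
        using True l iff[of 0 x] by auto
    next
      fix x assume x: "x \<in> {1..<xs ! 0}"
      have "x \<notin> A"
      proof
        assume "x \<in> A"
        then obtain k where "k < length xs" "x = xs ! k"
          using xs(1) by (metis in_set_conv_nth)
        then show False
          using x sorted_nth_mono[of xs 0 k] xs(3) by simp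
      qed
      moreover have "xs ! 0 \<le> m"
        using inA[of 0] A l by fastforce
      ultimately show "x \<in> {x \<in> {1..m} - A. card {i \<in> A. x < i} = card A - l + 1}"
        using x iff[of 0 x] le[of x] True l by auto
    qed
    then show ?thesis
      using True by (simp add: gap_def elt_def xs_def)
  next
    case False
    let ?p = "xs ! (l - 2)" and ?q = "xs ! (l - 1)"
    have ip: "x < ?p \<longleftrightarrow> card A - l + 2 \<le> card {i \<in> A. x < i}" for x
      using iff[of "l - 2" x] l False by (simp add: numeral_2_eq_2 Suc_diff_le) 
    have iq: "x < ?q \<longleftrightarrow> card A - l + 1 \<le> card {i \<in> A. x < i}" for x
      using iff[of "l - 1" x] l False by (simp add: Suc_diff_le)
    have "{x \<in> {1..m} - A. card {i \<in> A. x < i} = card A - l + 1} = {Suc ?p..<?q}"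
    proof (intro set_eqI iffI)
      fix x assume x: "x \<in> {x \<in> {1..m} - A. card {i \<in> A. x < i} = card A - l + 1}"
      then have "x < ?q" "\<not> x < ?p"
        using ip iq by auto
      moreover have "?p \<in> A"
        using l by (intro inA) arith
      then have "x \<noteq> ?p"
        using x by blast
      ultimately show "x \<in> {Suc ?p..<?q}"
        by auto
    next
      fix x assume x: "x \<in> {Suc ?p..<?q}"
      have "x \<notin> A"
      proof
        assume "x \<in> A"
        then obtain k where k: "k < length xs" "x = xs ! k"
          using xs(1) by (metis in_set_conv_nth)
        have "k < l - 1"
          using x k sorted_nth_mono[of xs "l - 1" k] xs(3) by force
        moreover have "l - 2 < k"
          using x k sorted_nth_mono[of xs k "l - 2"] xs(2,3) l by force
        ultimately show False by simp
      qed
      moreover have "?q \<le> m"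
        using inA[of "l - 1"] A l by fastforce
      ultimately show "x \<in> {x \<in> {1..m} - A. card {i \<in> A. x < i} = card A - l + 1}"
        using x ip[of x] iq[of x] by auto
    qed
    then show ?thesis
      using False l by (simp add: gap_def elt_def xs_def numeral_2_eq_2)
  qed
qed

text \<open>The points outside \<open>A\<close> are grouped by gaps: in the \<open>l\<close>-th gap
  every point has \<open>n - l + 1\<close> elements of \<open>A\<close> above it. The number
  \<open>gap A 1\<close> exceeds the count of points in the first gap by one, and the surplus
  \<open>(n - 1) choose 2\<close> extends the sum over \<open>2..n - 2\<close> by one term, to
  \<open>n choose 3\<close>.\<close>

lemma r_coeff_eq:
  assumes A: "A \<subseteq> {1..m}"
  shows "r_coeff A = (card A choose 3) + (\<Sum>x\<in>{1..m} - A. (card {i \<in> A. x < i} - 1) choose 2)"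
proof -
  define n where "n = card A"
  define c where "c x = card {i \<in> A. x < i}" for x
  have fin: "finite A"
    using A finite_subset by blast
  have le: "c x \<le> n" for x
    unfolding c_def n_def using fin by (intro card_mono) auto
  have sum: "(\<Sum>x\<in>{1..m} - A. (c x - 1) choose 2) =
      (\<Sum>l=1..n - 2. card {x \<in> {1..m} - A. c x = n - l + 1} * ((n - l) choose 2))"
  proof -
    \<comment> \<open>With fewer than three elements above, the binomial coefficient vanishes, which
      is why the gaps stop at \<open>n - 2\<close>.\<close>
    let ?X = "{x \<in> {1..m} - A. 3 \<le> c x}"
    have "(\<Sum>x\<in>{1..m} - A. (c x - 1) choose 2) = (\<Sum>x\<in>?X. (c x - 1) choose 2)"
      by (intro sum.mono_neutral_right) (auto intro!: binomial_eq_0)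
    also have "\<dots> = (\<Sum>l=1..n - 2. \<Sum>x\<in>{x \<in> ?X. n - c x + 1 = l}. (c x - 1) choose 2)"
    proof (intro sum.group[symmetric] image_subsetI)
      fix x assume "x \<in> ?X"
      then show "n - c x + 1 \<in> {1..n - 2}"
        using le[of x] by auto
    qed auto
    also have "\<dots> = (\<Sum>l=1..n - 2. card {x \<in> {1..m} - A. c x = n - l + 1} * ((n - l) choose 2))"
    proof (intro sum.cong refl)
      fix l assume l: "l \<in> {1..n - 2}"
      have "n - c x + 1 = l \<and> 3 \<le> c x \<longleftrightarrow> c x = n - l + 1" for x
        using l le[of x] by auto
      then have "{x \<in> ?X. n - c x + 1 = l} = {x \<in> {1..m} - A. c x = n - l + 1}"
        by auto
      then show "(\<Sum>x\<in>{x \<in> ?X. n - c x + 1 = l}. (c x - 1) choose 2) =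
          card {x \<in> {1..m} - A. c x = n - l + 1} * ((n - l) choose 2)"
        by simp
    qed
    finally show ?thesis .
  qed
  show ?thesis
  proof (cases "n < 3")
    case True
    then have "r_coeff A = 0"
      by (auto simp: r_coeff_def n_def[symmetric])
    moreover have "n choose 3 = 0"
      using True by (simp add: binomial_eq_0)
    moreover have "(\<Sum>x\<in>{1..m} - A. (c x - 1) choose 2) = 0"
      using True sum by simp
    ultimately show ?thesis
      by (simp add: n_def c_def)
  next
    case False
    have "gap A 1 \<ge> 1"
    proof -
      have "sorted_list_of_set A ! 0 \<in> A"
        using fin False by (metis n_def nth_mem set_sorted_list_of_set length_sorted_list_of_set not_less_zero
            gr_zeroI zero_less_numeral)
      then show ?thesis
        using A by (auto simp: gap_def elt_def)
    qed
    let ?f = "\<lambda>l. (n - l) choose 2"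
    have "(\<Sum>l=1..n - 2. gap A l * ?f l) = gap A 1 * ?f 1 + (\<Sum>l=2..n - 2. gap A l * ?f l)"
      using False by (simp add: sum.atLeast_Suc_atMost numeral_2_eq_2)
    moreover have "(\<Sum>l=1..n - 2. card {x \<in> {1..m} - A. c x = n - l + 1} * ?f l)
       = (gap A 1 - 1) * ?f 1 + (\<Sum>l=2..n - 2. gap A l * ?f l)"
    proof -
      have "(\<Sum>l=1..n - 2. card {x \<in> {1..m} - A. c x = n - l + 1} * ?f l)
         = (\<Sum>l=1..n - 2. (if l = 1 then gap A l - 1 else gap A l) * ?f l)"
      proof (rule sum.cong[OF refl])
        fix l assume "l \<in> {1..n - 2}"
        then have "1 \<le> l" "l \<le> card A"
          by (auto simp: n_def)
        then show "card {x \<in> {1..m} - A. c x = n - l + 1} * ?f l = (if l = 1 then gap A l - 1 else gap A l) * ?f l"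
          unfolding c_def n_def by (simp only: card_gap[OF A])
      qed
      also have "\<dots> = (gap A 1 - 1) * ?f 1 + (\<Sum>l=2..n - 2. (if l = 1 then gap A l - 1 else gap A l) * ?f l)"
        using False by (simp add: sum.atLeast_Suc_atMost numeral_2_eq_2)
      also have "(\<Sum>l=2..n - 2. (if l = 1 then gap A l - 1 else gap A l) * ?f l) = (\<Sum>l=2..n - 2. gap A l * ?f l)"
        by (intro sum.cong) auto
      finally show ?thesis .
    qed
    moreover have "n choose 3 = (\<Sum>k = 2..n - 2. k choose 2) + ?f 1"
    proof -
      obtain k where k: "n = Suc (Suc (Suc k))"
        using False by (metis Suc_diff_Suc add_Suc not_less numeral_3_eq_3 le_iff_add add.commute add_0)
      \<comment> \<open>Hockey-stick identity; the terms with \<open>j < 2\<close> vanish.\<close>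
      have "n choose 3 = (\<Sum>j\<le>n - 1. j choose 2)"
        using sum_choose_upper[of 2 "n - 1"] k by (simp add: numeral_3_eq_3 numeral_2_eq_2)
      also have "\<dots> = (\<Sum>j\<in>{2..n - 1}. j choose 2)"
        by (intro sum.mono_neutral_right) (auto intro!: binomial_eq_0)
      also have "\<dots> = (\<Sum>k = 2..n - 2. k choose 2) + ?f 1"
        using k by (simp add: numeral_2_eq_2)
      finally show ?thesis .
    qed
    moreover have "gap A 1 * ?f 1 = (gap A 1 - 1) * ?f 1 + ?f 1"
      using \<open>gap A 1 \<ge> 1\<close> by (metis Suc_diff_1 less_eq_Suc_le One_nat_def add.commute mult_Suc)
    ultimately show ?thesis
      unfolding r_coeff_def Let_def n_def[symmetric] c_def[symmetric] sum by simp
  qed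
qed

section \<open>Removing the sets of size n one at a time\<close>

lemma sym_diff_sym_diff: "sym_diff A (sym_diff A B) = B"
  by auto

lemma inj_sym_diff: "inj (sym_diff A)"
  by (rule inj_on_inverseI[of _ "sym_diff A"]) (rule sym_diff_sym_diff)

lemma flag_complex_image_sym_diff:
  "flag_complex (sym_diff A ` V) = (`) (sym_diff A) ` flag_complex V"
proof -
  have iso: "sym_diff (sym_diff A B) (sym_diff A C) = sym_diff B C" for B C
    by auto
  have sub: "(`) (sym_diff A) ` flag_complex V \<subseteq> flag_complex (sym_diff A ` V)" for V
  proof (rule image_subsetI)
    fix \<sigma> assume "\<sigma> \<in> flag_complex V"
    then show "sym_diff A ` \<sigma> \<in> flag_complex (sym_diff A ` V)"
      unfolding flag_complex_def mem_Collect_eq ball_simps iso by blast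
  qed
  have im: "sym_diff A ` sym_diff A ` W = W" for W
    by (simp add: image_image sym_diff_sym_diff)
  have "\<sigma> \<in> (`) (sym_diff A) ` flag_complex V" if "\<sigma> \<in> flag_complex (sym_diff A ` V)" for \<sigma>
  proof -
    have "sym_diff A ` \<sigma> \<in> flag_complex V"
      using sub[of "sym_diff A ` V"] that im[of V] by auto
    then show ?thesis
      by (rule image_eqI[rotated]) (simp add: im)
  qed
  then show ?thesis
    using sub[of V] by blast
qed

text \<open>The vertices \<open>A\<close> of size \<open>n\<close> are added in the order of increasing element sums, so that
  \<open>insert x (A - {i})\<close> precedes \<open>A\<close> if and only if \<open>x < i\<close>.\<close>

lemma reduces_add_top_sets:
  assumes "1 \<le> n" "finite S" "S \<subseteq> {A. A \<subseteq> {1..m} \<and> card A = n}"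
    and "\<And>A i x. \<lbrakk>A \<in> S; i \<in> A; x \<in> {1..m} - A; x < i\<rbrakk> \<Longrightarrow> insert x (A - {i}) \<in> S"
  shows "reduces 3 (flag_complex (subsets_upto m (n - 1) \<union> S)) (\<Sum>A\<in>S. r_coeff A)
    (flag_complex (subsets_upto m (n - 1)))"
  using assms(2-)
proof (induction "card S" arbitrary: S)
  case 0
  then show ?case
    by (simp add: reduces.stop)
next
  case (Suc k)
  let ?F = "subsets_upto m (n - 1)"
  have "S \<noteq> {}"
    using Suc.hyps(2) by auto
  \<comment> \<open>Reductions run downwards, so the vertex removed first is the one that was added
    last: one with the largest element sum.\<close>
  then obtain A where AS: "A \<in> S" and A_max: "\<And>B. B \<in> S \<Longrightarrow> \<Sum>B \<le> \<Sum>A"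
  proof -
    have "Max (Sum ` S) \<in> Sum ` S"
      using \<open>S \<noteq> {}\<close> Suc.prems(1) by (intro Max_in) auto
    then obtain A where "A \<in> S" "Max (Sum ` S) = \<Sum>A"
      by blast
    moreover have "\<Sum>B \<le> Max (Sum ` S)" if "B \<in> S" for B
      using that Suc.prems(1) by (intro Max_ge) auto
    ultimately show thesis
      using that by simp
  qed
  have A: "A \<subseteq> {1..m}" "card A = n" "finite A" "A \<noteq> {}"
    using AS Suc.prems(2) assms(1) finite_subset[of A "{1..m}"] by auto
  have exch: "\<Sum>(insert x (B - {i})) + i = \<Sum>B + x" if "finite B" "i \<in> B" "x \<notin> B" for B :: "nat set" and i x
    using that sum.remove[of B i "\<lambda>x. x"] by simp
  let ?U = "sym_diff A ` (?F \<union> S)"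
  interpret translated_star A "{1..m} - A" ?U
  proof
    have "?F \<union> S \<subseteq> Pow {1..m}"
      using Suc.prems(2) by (auto simp: subsets_upto_def)
    then show "finite ?U"
      by (meson finite_Pow_iff finite_atLeastAtMost finite_imageI finite_subset)
    show "{} \<in> ?U"
      using AS by (auto intro!: image_eqI[of _ _ A])
    fix D :: "nat set" assume "D \<noteq> {}"
    show "D \<in> ?U \<and> card D \<le> 2 \<longleftrightarrow> (\<exists>i\<in>A. D = {i}) \<or> (\<exists>i\<in>A. \<exists>j\<in>A. i \<noteq> j \<and> D = {i, j}) \<or>
        (\<exists>x\<in>{1..m} - A. \<exists>i\<in>A. x < i \<and> D = {x, i})" (is "?L \<longleftrightarrow> ?R")
    proof
      assume ?L
      then obtain B where B: "B \<in> ?F \<union> S" "D = sym_diff A B" "card D \<le> 2"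
        by blast
      have B': "B \<subseteq> {1..m}" "card B \<le> n" and BS: "card B = n \<Longrightarrow> B \<in> S"
        using B(1) Suc.prems(2) assms(1) by (auto simp: subsets_upto_def)
      have "finite B"
        using B'(1) finite_subset by blast
      then have "finite D"
        using B(2) A(3) by simp
      have BD: "B = sym_diff A D"
        using B(2) by auto
      \<comment> \<open>Exchanging \<open>i\<close> for \<open>j\<close> keeps the size
        \<open>n\<close>, so the result lies in \<open>S\<close>, and maximality of the element sum
        gives \<open>j < i\<close>.\<close>
      have one: ?R if "D = {j, i}" "i \<in> A" "j \<notin> A" for i j
      proof -
        have B_eq: "B = insert j (A - {i})"
          using BD that by auto
        then have "card B = n"
          using that A card_Suc_Diff1[of A i] by simp
        then have "\<Sum>B \<le> \<Sum>A"
          by (intro A_max BS)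
        moreover have "\<Sum>B + i = \<Sum>A + j"
          unfolding B_eq by (rule exch[OF A(3) that(2,3)])
        ultimately have "j \<le> i"
          by linarith
        moreover have "j \<in> {1..m}" "j \<noteq> i"
          using B_eq B'(1) that by auto
        ultimately show ?R
          using that by (intro disjI2 bexI[of _ j] bexI[of _ i]) auto
      qed
      have "card D = 1 \<or> card D = 2"
        using \<open>finite D\<close> \<open>D \<noteq> {}\<close> B(3) by (metis One_nat_def card_gt_0_iff le_SucE le_zero_eq less_numeral_extra(3) numeral_2_eq_2)
      then consider i where "D = {i}" | i j where "D = {i, j}" "i \<noteq> j"
        by (auto simp: card_1_singleton_iff card_2_iff)
      then show ?R
      proof cases
        case 1
        have "i \<in> A"
        proof (rule ccontr)
          assume "i \<notin> A"
          then have "B = insert i A"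
            using BD 1 by auto
          then show False
            using B'(2) A \<open>i \<notin> A\<close> by simp
        qed
        then show ?R
          using 1 by blast
      next
        case 2
        consider "i \<in> A" "j \<in> A" | "i \<in> A" "j \<notin> A" | "i \<notin> A" "j \<in> A" | "i \<notin> A" "j \<notin> A"
          by blast
        then show ?R
        proof cases
          case 1
          then show ?R using 2 by blast
        next
          case 3
          show ?R by (rule one[OF 2(1) 3(2,1)])
        next
          case n: 2
          show ?R by (rule one[OF _ n]) (use 2 in auto)
        next
          case 4
          then have "B = insert i (insert j A)"
            using BD 2 by auto
          then show ?R
            using B'(2) A 4 2(2) by simp
        qed
      qed
    next
      assume ?R
      then obtain B where "B \<in> ?F \<union> S" "D = sym_diff A B" "card D \<le> 2"
      proof (elim disjE bexE conjE)
        fix i assume i: "i \<in> A" "D = {i}"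
        have "A - {i} \<in> ?F"
          using A i(1) by (auto simp: subsets_upto_def)
        then show thesis
          using i by (intro that[of "A - {i}"]) auto
      next
        fix i j assume i: "i \<in> A" "j \<in> A" "i \<noteq> j" "D = {i, j}"
        have "card (A - {i, j}) \<le> card (A - {i})"
          using A(3) by (intro card_mono) auto
        then have "A - {i, j} \<in> ?F"
          using A i(1) by (auto simp: subsets_upto_def)
        then show thesis
          using i by (intro that[of "A - {i, j}"]) auto
      next
        fix x i assume x: "x \<in> {1..m} - A" "i \<in> A" "x < i" "D = {x, i}"
        have "insert x (A - {i}) \<in> S"
          by (rule Suc.prems(3)[OF AS x(2,1,3)])
        then show thesis
          using x by (intro that[of "insert x (A - {i})"]) auto
      qed
      then show ?L
        by blast
    qed
  qed (use A in auto)
  have "reduces 3 (flag_complex (?F \<union> S)) (card crit) (flag_complex (?F \<union> (S - {A})))"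
  proof -
    have 1: "sym_diff A ` ?U = ?F \<union> S"
      by (simp add: image_image sym_diff_sym_diff)
    have "A \<notin> ?F"
      using A assms(1) by (auto simp: subsets_upto_def)
    then have "?F \<union> (S - {A}) = (?F \<union> S) - {A}"
      by blast
    then have "sym_diff A ` (?F \<union> (S - {A})) = ?U - sym_diff A ` {A}"
      by (simp only: image_set_diff[OF inj_sym_diff])
    then have "?U - {{}} = sym_diff A ` (?F \<union> (S - {A}))"
      by simp
    then have 2: "sym_diff A ` (?U - {{}}) = ?F \<union> (S - {A})"
      by (simp add: image_image sym_diff_sym_diff)
    show ?thesis
      using reduces_image[OF reduces_star inj_sym_diff, of A]
      by (simp only: flag_complex_image_sym_diff[symmetric] 1 2)
  qed
  moreover have "card crit = r_coeff A"
    using r_coeff_eq[OF A(1)] card_crit by (simp add: above_def)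
  moreover have "reduces 3 (flag_complex (?F \<union> (S - {A}))) (\<Sum>B\<in>S - {A}. r_coeff B) (flag_complex ?F)"
  proof (rule Suc.hyps(1))
    show "k = card (S - {A})" "finite (S - {A})"
      using Suc.hyps(2) Suc.prems(1) AS by auto
    show "S - {A} \<subseteq> {A. A \<subseteq> {1..m} \<and> card A = n}"
      using Suc.prems(2) by auto
    \<comment> \<open>Lowering an element lowers the sum, so the result is never \<open>A\<close>,
      and the remaining family is still closed.\<close>
    show "insert x (B - {i}) \<in> S - {A}" if "B \<in> S - {A}" "i \<in> B" "x \<in> {1..m} - B" "x < i" for B i x
    proof -
      have "finite B"
        using that(1) Suc.prems(2) finite_subset[of B "{1..m}"] by auto
      then have "\<Sum>(insert x (B - {i})) + i = \<Sum>B + x"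
        using exch that by blast
      moreover have "\<Sum>B \<le> \<Sum>A"
        using A_max that(1) by blast
      ultimately have "insert x (B - {i}) \<noteq> A"
        using that(4) by auto
      then show ?thesis
        using Suc.prems(3)[of B i x] that by blast
    qed
  qed
  ultimately show ?case
    using reduces_trans sum.remove[OF Suc.prems(1) AS, of r_coeff] by metis
qed

lemma reduces_flag_complex_subsets_upto:
  assumes "1 \<le> n"
  shows "reduces 3 (flag_complex (subsets_upto m n)) (t_coeff m n) (flag_complex (subsets_upto m (n - 1)))"
proof -
  let ?S = "{A. A \<subseteq> {1..m} \<and> card A = n}"
  have "subsets_upto m (n - 1) \<union> ?S = subsets_upto m n"
    using assms by (auto simp: subsets_upto_def)
  moreover have "reduces 3 (flag_complex (subsets_upto m (n - 1) \<union> ?S)) (\<Sum>A\<in>?S. r_coeff A)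
    (flag_complex (subsets_upto m (n - 1)))"
  proof (rule reduces_add_top_sets[OF assms])
    show "insert x (A - {i}) \<in> ?S" if "A \<in> ?S" "i \<in> A" "x \<in> {1..m} - A" "x < i" for A i x
    proof -
      have "finite A"
        using that(1) finite_subset[of A "{1..m}"] by auto
      then have "card (insert x (A - {i})) = card A"
        using that card_Suc_Diff1[of A i] by simp
      then show ?thesis
        using that by auto
    qed
  qed auto
  ultimately show ?thesis
    by (simp add: t_coeff_def)
qed

lemma reduces_flag_complex_to_point:
  "reduces 3 (flag_complex (subsets_upto m n)) (\<Sum>k=1..n. t_coeff m k) {{{}}}"
proof (induction n)
  case 0
  have "subsets_upto m 0 = {{}}"
    using finite_subset[of _ "{1..m}"] by (auto simp: subsets_upto_def)
  moreover have "flag_complex {{}} = {{{} :: nat set}}"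
    by (auto simp: flag_complex_def)
  ultimately show ?case
    by (simp add: reduces.stop)
next
  case (Suc n)
  show ?case
    using reduces_trans[OF reduces_flag_complex_subsets_upto[of "Suc n" m], simplified, OF Suc]
    by (simp add: add.commute)
qed

lemma t_coeff_less_3:
  assumes "k < 3"
  shows "t_coeff m k = 0"
  unfolding t_coeff_def
proof (rule sum.neutral, safe)
  fix A :: "nat set" assume "k = card A"
  then show "r_coeff A = 0"
    using assms by (auto simp: r_coeff_def Let_def)
qed

section \<open>Geometric realizations of finite complexes\<close>

definition realization_set :: "'a set set \<Rightarrow> ('a \<Rightarrow> real) set" where
  "realization_set K = (\<Union>\<sigma>\<in>K. closed_simplex \<sigma>)"

definition vertex_point :: "'a \<Rightarrow> 'a \<Rightarrow> real" where
  "vertex_point w = (\<lambda>v. if v = w then 1 else 0)"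

definition support :: "('a \<Rightarrow> real) \<Rightarrow> 'a set" where
  "support x = {v. x v \<noteq> 0}"

lemma compact_closed_simplex:
  assumes "finite \<sigma>"
  shows "compact (closed_simplex \<sigma>)"
proof -
  let ?B = "PiE UNIV (\<lambda>v. if v \<in> \<sigma> then {0..1::real} else {0})"
  have "compactin (product_topology (\<lambda>_. euclidean) UNIV) ?B"
    by (simp add: compactin_PiE)
  then have "compact ?B"
    by (simp add: euclidean_product_topology)
  moreover have "closed {f. sum f \<sigma> = (1::real)}"
    by (intro closed_Collect_eq continuous_intros) simp
  moreover have "closed_simplex \<sigma> = ?B \<inter> {f. sum f \<sigma> = 1}"
  proof (intro set_eqI iffI)
    fix f assume f: "f \<in> closed_simplex \<sigma>"
    have "f v \<le> 1" if "v \<in> \<sigma>" for v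
      using f member_le_sum[of v \<sigma> f] that assms by (auto simp: closed_simplex_def)
    then show "f \<in> ?B \<inter> {f. sum f \<sigma> = 1}"
      using f by (auto simp: closed_simplex_def)
  next
    fix f assume f: "f \<in> ?B \<inter> {f. sum f \<sigma> = 1}"
    then have "f v \<in> (if v \<in> \<sigma> then {0..1} else {0})" for v
      by (auto simp: PiE_iff)
    then show "f \<in> closed_simplex \<sigma>"
      using f unfolding closed_simplex_def
      by (smt (verit) Int_iff atLeastAtMost_iff mem_Collect_eq singletonD)
  qed
  ultimately show ?thesis
    by (metis compact_Int_closed)
qed

lemma closed_closed_simplex: "closed (closed_simplex \<sigma>)"
proof -
  have 1: "closed_simplex \<sigma> = (\<Inter>v. {f. 0 \<le> f v}) \<inter> (\<Inter>v\<in>- \<sigma>. {f. f v = 0}) \<inter> {f. sum f \<sigma> = 1}"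
    by (auto simp: closed_simplex_def)
  show ?thesis
    unfolding 1 by (intro closed_Int closed_INT closed_Collect_eq closed_Collect_le ballI continuous_intros) simp_all
qed

lemma closed_realization_set:
  assumes "abstract_complex K"
  shows "closed (realization_set K)"
  unfolding realization_set_def
  using abstract_complexD(1)[OF assms] closed_closed_simplex by (intro closed_UN) auto

lemma compact_realization_set:
  assumes "abstract_complex K"
  shows "compact (realization_set K)"
  unfolding realization_set_def
  using assms by (intro compact_UN compact_closed_simplex) (auto dest: abstract_complexD)

text \<open>A finite union of closed sets is closed: if \<open>U\<close> is open in each simplex,
  its complements in the finitely many simplices are closed, and so is their union.\<close>

lemma geometric_realization_eq_realization_set:
  assumes K: "abstract_complex K"
  shows "geometric_realization K = top_of_set (realization_set K)"
  unfolding topology_eq openin_geometric_realization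
proof (intro allI iffI)
  fix U assume "openin (top_of_set (realization_set K)) U"
  then obtain T where T: "open T" "U = realization_set K \<inter> T"
    by (auto simp: openin_open)
  have "U \<inter> closed_simplex \<sigma> = closed_simplex \<sigma> \<inter> T" if "\<sigma> \<in> K" for \<sigma>
    using T(2) that by (auto simp: realization_set_def)
  then show "U \<subseteq> (\<Union>\<sigma>\<in>K. closed_simplex \<sigma>) \<and> (\<forall>\<sigma>\<in>K. openin (top_of_set (closed_simplex \<sigma>)) (U \<inter> closed_simplex \<sigma>))"
    using T by (auto simp: realization_set_def)
next
  fix U assume U: "U \<subseteq> (\<Union>\<sigma>\<in>K. closed_simplex \<sigma>) \<and> (\<forall>\<sigma>\<in>K. openin (top_of_set (closed_simplex \<sigma>)) (U \<inter> closed_simplex \<sigma>))"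
  have "closed (closed_simplex \<sigma> - U)" if "\<sigma> \<in> K" for \<sigma>
  proof -
    have "closedin (top_of_set (closed_simplex \<sigma>)) (closed_simplex \<sigma> - U \<inter> closed_simplex \<sigma>)"
      using U that by (intro closedin_diff) auto
    then have "closedin (top_of_set (closed_simplex \<sigma>)) (closed_simplex \<sigma> - U)"
      by (simp add: Diff_Int)
    then show ?thesis
      using closed_closed_simplex closedin_closed_trans by blast
  qed
  then have "closed (\<Union>\<sigma>\<in>K. closed_simplex \<sigma> - U)"
    using abstract_complexD(1)[OF K] by (intro closed_UN) auto
  moreover have "U = realization_set K \<inter> - (\<Union>\<sigma>\<in>K. closed_simplex \<sigma> - U)"
    using U by (auto simp: realization_set_def)
  ultimately show "openin (top_of_set (realization_set K)) U"
    unfolding openin_open by (metis open_Compl)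
qed

lemma closed_simplex_mono:
  assumes "finite \<tau>" "x \<in> closed_simplex \<tau>" "support x \<subseteq> \<sigma>" "\<sigma> \<subseteq> \<tau>"
  shows "x \<in> closed_simplex \<sigma>"
proof -
  have "sum x \<sigma> = sum x \<tau>"
    using assms by (intro sum.mono_neutral_left) (auto simp: support_def)
  then show ?thesis
    using assms unfolding closed_simplex_def support_def by auto
qed

lemma support_closed_simplex: "x \<in> closed_simplex \<sigma> \<Longrightarrow> support x \<subseteq> \<sigma>"
  by (auto simp: closed_simplex_def support_def)

lemma support_nonempty: "x \<in> closed_simplex \<sigma> \<Longrightarrow> support x \<noteq> {}"
  unfolding closed_simplex_def support_def by force

lemma realization_setD:
  assumes "abstract_complex K" "x \<in> realization_set K"
  shows "support x \<in> K" "x \<in> closed_simplex (support x)" "finite (support x)" "0 \<le> x v"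
proof -
  obtain \<sigma> where \<sigma>: "\<sigma> \<in> K" "x \<in> closed_simplex \<sigma>"
    using assms(2) by (auto simp: realization_set_def)
  show "support x \<in> K"
    by (rule abstract_complexD(4)[OF assms(1) \<sigma>(1) support_closed_simplex[OF \<sigma>(2)] support_nonempty[OF \<sigma>(2)]])
  then show "finite (support x)"
    by (rule abstract_complexD(2)[OF assms(1)])
  show "x \<in> closed_simplex (support x)"
    using closed_simplex_mono[OF abstract_complexD(2)[OF assms(1) \<sigma>(1)] \<sigma>(2)]
      support_closed_simplex[OF \<sigma>(2)] by blast
  show "0 \<le> x v"
    using \<sigma>(2) by (auto simp: closed_simplex_def)
qed

lemma realization_setI: "\<lbrakk>\<sigma> \<in> K; x \<in> closed_simplex \<sigma>\<rbrakk> \<Longrightarrow> x \<in> realization_set K"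
  by (auto simp: realization_set_def)

lemma realization_set_support_iff:
  assumes "abstract_complex K" "x \<in> realization_set K" "L \<subseteq> K" "abstract_complex L"
  shows "x \<in> realization_set L \<longleftrightarrow> support x \<in> L"
  using realization_setD[OF assms(1,2)] realization_setD[OF assms(4), of x] realization_setI by blast

lemma vertex_point_in_realization_set: "{w} \<in> K \<Longrightarrow> vertex_point w \<in> realization_set K"
  by (rule realization_setI) (auto simp: vertex_point_def closed_simplex_def)

section \<open>Pointed homotopy equivalence\<close>

lemma homotopic_with_pointI:
  assumes "continuous_on ({0..1} \<times> S) h" "h \<in> {0..1} \<times> S \<rightarrow> T"
    and "\<And>x. x \<in> S \<Longrightarrow> h (0, x) = f x" "\<And>x. x \<in> S \<Longrightarrow> h (1, x) = g x"
    and "s \<in> S" "\<And>u. u \<in> {0..1::real} \<Longrightarrow> h (u, s) = t"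
  shows "homotopic_with_canon (\<lambda>k. k s = t) S T f g"
proof (subst homotopic_with)
  show "\<exists>h. continuous_map (prod_topology (top_of_set {0..1::real}) (top_of_set S)) (top_of_set T) h \<and>
      (\<forall>x\<in>topspace (top_of_set S). h (0, x) = f x) \<and> (\<forall>x\<in>topspace (top_of_set S). h (1, x) = g x) \<and>
      (\<forall>u\<in>{0..1}. h (u, s) = t)"
    unfolding prod_topology_subtopology_eu
    using assms by (intro exI[of _ h] conjI) (auto simp: continuous_map_in_subtopology)
qed (simp add: assms(5))

lemma homotopic_with_pointE:
  assumes "homotopic_with_canon (\<lambda>k. k s = t) S T f g"
  obtains h where "continuous_on ({0..1::real} \<times> S) h" "h \<in> {0..1} \<times> S \<rightarrow> T"
    "\<And>x. h (0, x) = f x" "\<And>x. h (1, x) = g x" "\<And>u. u \<in> {0..1} \<Longrightarrow> h (u, s) = t"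
proof -
  from assms obtain h where "continuous_map (prod_topology (top_of_set {0..1::real}) (top_of_set S)) (top_of_set T) h"
      "\<And>x. h (0, x) = f x" "\<And>x. h (1, x) = g x" "\<And>u. u \<in> {0..1} \<Longrightarrow> h (u, s) = t"
    unfolding homotopic_with_def by blast
  then show thesis
    unfolding prod_topology_subtopology_eu
    by (intro that[of h]) (auto simp: continuous_map_in_subtopology)
qed

text \<open>The homotopies keep the base point fixed, which lets them be combined with the identity
  on another wedge summand in \<open>pointed_heq_axes\<close>.\<close>

definition pointed_heq :: "'a::topological_space set \<Rightarrow> 'a \<Rightarrow> 'b::topological_space set \<Rightarrow> 'b \<Rightarrow> bool" where
  "pointed_heq S s T t \<longleftrightarrow> s \<in> S \<and> t \<in> T \<and> (\<exists>f g. continuous_on S f \<and> f \<in> S \<rightarrow> T \<and> f s = t \<and>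
     continuous_on T g \<and> g \<in> T \<rightarrow> S \<and> g t = s \<and>
     homotopic_with_canon (\<lambda>k. k s = s) S S (g \<circ> f) id \<and>
     homotopic_with_canon (\<lambda>k. k t = t) T T (f \<circ> g) id)"

lemma pointed_heq_refl: "s \<in> S \<Longrightarrow> pointed_heq S s S s"
  unfolding pointed_heq_def by (intro conjI exI[of _ id]) auto

lemma homotopic_with_point_conjugate:
  assumes "homotopic_with_canon (\<lambda>k. k t = t) T T (g' \<circ> f') id"
    and "continuous_on S f" "f \<in> S \<rightarrow> T" "f s = t" "continuous_on T g" "g \<in> T \<rightarrow> S" "g t = s"
    and "homotopic_with_canon (\<lambda>k. k s = s) S S (g \<circ> f) id"
  shows "homotopic_with_canon (\<lambda>k. k s = s) S S ((g \<circ> g') \<circ> (f' \<circ> f)) id"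
proof -
  have "homotopic_with_canon (\<lambda>k. k s = t) S T ((g' \<circ> f') \<circ> f) (id \<circ> f)"
    using assms by (intro homotopic_with_compose_continuous_right) (auto simp: o_def)
  then have "homotopic_with_canon (\<lambda>k. k s = s) S S (g \<circ> ((g' \<circ> f') \<circ> f)) (g \<circ> (id \<circ> f))"
  proof (rule homotopic_with_compose_continuous_map_left)
    show "continuous_map (top_of_set T) (top_of_set S) g"
      using assms(5,6) by (auto simp: continuous_map_in_subtopology)
    show "(g \<circ> j) s = s" if "j s = t" for j
      using that assms(7) by simp
  qed
  then show ?thesis
    using homotopic_with_trans[OF _ assms(8)] by (simp add: o_assoc)
qed

lemma pointed_heq_trans:
  assumes "pointed_heq S s T t" "pointed_heq T t U u"
  shows "pointed_heq S s U u"
proof -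
  obtain f g where fg: "continuous_on S f" "f \<in> S \<rightarrow> T" "f s = t" "continuous_on T g" "g \<in> T \<rightarrow> S" "g t = s"
     "homotopic_with_canon (\<lambda>k. k s = s) S S (g \<circ> f) id" "homotopic_with_canon (\<lambda>k. k t = t) T T (f \<circ> g) id"
    and s: "s \<in> S"
    using assms(1) unfolding pointed_heq_def by blast
  obtain f' g' where fg': "continuous_on T f'" "f' \<in> T \<rightarrow> U" "f' t = u" "continuous_on U g'" "g' \<in> U \<rightarrow> T" "g' u = t"
     "homotopic_with_canon (\<lambda>k. k t = t) T T (g' \<circ> f') id" "homotopic_with_canon (\<lambda>k. k u = u) U U (f' \<circ> g') id"
    and u: "u \<in> U"
    using assms(2) unfolding pointed_heq_def by blast
  show ?thesis
    unfolding pointed_heq_def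
  proof (intro conjI exI)
    show "homotopic_with_canon (\<lambda>k. k s = s) S S ((g \<circ> g') \<circ> (f' \<circ> f)) id"
      by (rule homotopic_with_point_conjugate[OF fg'(7) fg(1-7)])
    show "homotopic_with_canon (\<lambda>k. k u = u) U U ((f' \<circ> f) \<circ> (g \<circ> g')) id"
      by (rule homotopic_with_point_conjugate[OF fg(8) fg'(4-6) fg'(1-3) fg'(8)])
    show "continuous_on S (f' \<circ> f)" "continuous_on U (g \<circ> g')"
      using fg fg' continuous_on_compose continuous_on_subset by (metis image_subset_iff_funcset)+
  qed (use fg fg' s u in auto)
qed

lemma pointed_heq_imp_homotopy_equivalent_space:
  assumes "pointed_heq S s T t"
  shows "top_of_set S homotopy_equivalent_space top_of_set T"
proof -
  obtain f g where fg: "continuous_on S f" "f \<in> S \<rightarrow> T" "continuous_on T g" "g \<in> T \<rightarrow> S"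
     "homotopic_with_canon (\<lambda>k. k s = s) S S (g \<circ> f) id" "homotopic_with_canon (\<lambda>k. k t = t) T T (f \<circ> g) id"
    using assms unfolding pointed_heq_def by blast
  show ?thesis
    unfolding homotopy_equivalent_space_def
  proof (intro exI conjI)
    show "homotopic_with (\<lambda>x. True) (top_of_set S) (top_of_set S) (g \<circ> f) id"
      by (rule homotopic_with_mono[OF fg(5)]) simp
    show "homotopic_with (\<lambda>x. True) (top_of_set T) (top_of_set T) (f \<circ> g) id"
      by (rule homotopic_with_mono[OF fg(6)]) simp
  qed (use fg in \<open>auto simp: continuous_map_in_subtopology\<close>)
qed

lemma pointed_heq_deformation_retract:
  assumes "T \<subseteq> S" "t \<in> T" "continuous_on ({0..1::real} \<times> S) h" "h \<in> {0..1} \<times> S \<rightarrow> S"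
    and "\<And>x. x \<in> S \<Longrightarrow> h (0, x) = x" "\<And>x. x \<in> S \<Longrightarrow> h (1, x) \<in> T"
    and "\<And>x u. \<lbrakk>x \<in> T; u \<in> {0..1}\<rbrakk> \<Longrightarrow> h (u, x) = x"
  shows "pointed_heq S t T t"
  unfolding pointed_heq_def
proof (intro conjI exI)
  let ?r = "\<lambda>x. h (1, x)"
  show cont: "continuous_on S ?r"
    by (rule continuous_on_compose2[OF assms(3)]) (auto intro!: continuous_intros)
  show "t \<in> S" "t \<in> T" "?r \<in> S \<rightarrow> T" "?r t = t" "id t = t" "id \<in> T \<rightarrow> S" "continuous_on T id"
    using assms by auto
  show "homotopic_with_canon (\<lambda>k. k t = t) S S (id \<circ> ?r) id"
    by (subst homotopic_with_sym, rule homotopic_with_pointI[OF assms(3,4)]) (use assms in auto)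
  show "homotopic_with_canon (\<lambda>k. k t = t) T T (?r \<circ> id) id"
  proof (rule homotopic_with_equal)
    show "continuous_map (top_of_set T) (top_of_set T) (?r \<circ> id)"
      using assms(1,6) continuous_on_subset[OF cont assms(1)] by (auto simp: continuous_map_in_subtopology)
  qed (use assms in auto)
qed

section \<open>Collapses and homotopy extension\<close>

lemma continuous_on_snd_coordinate: "continuous_on A (\<lambda>z. snd z u)"
  by (rule continuous_on_product_then_coordinatewise[OF continuous_on_snd[OF continuous_on_id]])

lemma continuous_on_Min_image:
  fixes F :: "'z::topological_space \<Rightarrow> 'a \<Rightarrow> real"
  assumes "finite \<sigma>" "\<sigma> \<noteq> {}" "\<And>v. v \<in> \<sigma> \<Longrightarrow> continuous_on A (\<lambda>z. F z v)"
  shows "continuous_on A (\<lambda>z. Min (F z ` \<sigma>))"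
  using assms
proof (induction \<sigma> rule: finite_ne_induct)
  case (singleton v)
  then show ?case by simp
next
  case (insert v \<sigma>)
  then show ?case
    by (simp add: continuous_on_min)
qed

text \<open>The minimum of \<open>x\<close> over \<open>\<sigma>\<close> serves as a continuous
  measure of how far \<open>x\<close> is inside the open star of \<open>\<sigma>\<close>.\<close>

lemma Min_image_pos_iff:
  fixes x :: "'a \<Rightarrow> real"
  assumes "finite \<sigma>" "\<sigma> \<noteq> {}" "\<And>v. 0 \<le> x v"
  shows "0 < Min (x ` \<sigma>) \<longleftrightarrow> \<sigma> \<subseteq> support x" and "0 \<le> Min (x ` \<sigma>)"
    and "Min (x ` \<sigma>) = 0 \<longleftrightarrow> \<not> \<sigma> \<subseteq> support x"
proof -
  show 1: "0 < Min (x ` \<sigma>) \<longleftrightarrow> \<sigma> \<subseteq> support x"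
    by (subst Min_gr_iff) (use assms in \<open>auto simp: support_def less_le\<close>)
  show 2: "0 \<le> Min (x ` \<sigma>)"
    using assms by simp
  show "Min (x ` \<sigma>) = 0 \<longleftrightarrow> \<not> \<sigma> \<subseteq> support x"
    using 1 2 by linarith
qed

text \<open>The mass \<open>\<mu> = Min (x ` \<sigma>)\<close> is moved from every vertex of \<open>\<sigma>\<close> to \<open>v\<close>; off the two removed
  simplices \<open>\<mu>\<close> vanishes, so a single formula serves on the whole realization.\<close>

lemma pointed_heq_collapse:
  assumes K: "abstract_complex K" and \<sigma>: "\<sigma> \<in> K" and v: "v \<notin> \<sigma>" and \<tau>: "insert v \<sigma> \<in> K"
    and co: "\<And>\<tau>. \<lbrakk>\<tau> \<in> K; \<sigma> \<subseteq> \<tau>\<rbrakk> \<Longrightarrow> \<tau> = \<sigma> \<or> \<tau> = insert v \<sigma>"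
    and w: "{w} \<in> K - {\<sigma>, insert v \<sigma>}"
  shows "pointed_heq (realization_set K) (vertex_point w) (realization_set (K - {\<sigma>, insert v \<sigma>})) (vertex_point w)"
proof (rule pointed_heq_deformation_retract)
  let ?K0 = "K - {\<sigma>, insert v \<sigma>}"
  define \<mu> where "\<mu> x = Min (x ` \<sigma>)" for x :: "'a \<Rightarrow> real"
  define r where "r = (\<lambda>(t, x) u. x u - t * \<mu> x * (if u \<in> \<sigma> then 1 else 0) + t * \<mu> x * card \<sigma> * (if u = v then 1 else 0))"
  have K0: "abstract_complex ?K0"
    by (rule abstract_complex_collapse[OF K \<sigma> co])
  have fin: "finite \<sigma>" "\<sigma> \<noteq> {}"
    using abstract_complexD(2,3)[OF K \<sigma>] by auto
  show sub: "realization_set ?K0 \<subseteq> realization_set K"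
    by (auto simp: realization_set_def)
  show "vertex_point w \<in> realization_set ?K0"
    by (rule vertex_point_in_realization_set[OF w])
  have nonneg: "0 \<le> x u" if "x \<in> realization_set K" for x u
    using realization_setD(4)[OF K that] .
  have \<mu>: "0 < \<mu> x \<longleftrightarrow> \<sigma> \<subseteq> support x" "0 \<le> \<mu> x" "\<mu> x = 0 \<longleftrightarrow> \<not> \<sigma> \<subseteq> support x" if "x \<in> realization_set K" for x
    using Min_image_pos_iff[OF fin, of x] nonneg[OF that] by (auto simp: \<mu>_def)
  have \<mu>0: "r (t, x) = x" if "\<mu> x = 0" for x and t :: real
    using that by (simp add: r_def)
  have in\<tau>: "x \<in> closed_simplex (insert v \<sigma>)" if "x \<in> realization_set K" "\<mu> x \<noteq> 0" for x
  proof -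
    have "\<sigma> \<subseteq> support x"
      using \<mu>(3)[OF that(1)] that(2) by blast
    then have "support x \<subseteq> insert v \<sigma>"
      using co realization_setD(1)[OF K that(1)] by blast
    then show ?thesis
      using realization_setD(2)[OF K that(1)] fin(1) v
      by (smt (verit, best) closed_simplex_def finite_insert mem_Collect_eq subset_iff sum.mono_neutral_left DiffD2)
  qed
  have r\<tau>: "r (t, x) \<in> closed_simplex (insert v \<sigma>)" if x: "x \<in> realization_set K" "\<mu> x \<noteq> 0" and t: "t \<in> {0..1}" for x and t :: real
  proof -
    have cs: "\<And>u. 0 \<le> x u" "\<And>u. u \<notin> insert v \<sigma> \<Longrightarrow> x u = 0" "sum x (insert v \<sigma>) = 1"
      using in\<tau>[OF x] by (auto simp: closed_simplex_def)
    have "t * \<mu> x \<le> x u" if "u \<in> \<sigma>" for u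
    proof -
      have "\<mu> x \<le> x u"
        using that fin(1) by (simp add: \<mu>_def)
      moreover have "t * \<mu> x \<le> 1 * \<mu> x"
        using t \<mu>(2)[OF x(1)] by (intro mult_right_mono) auto
      ultimately show ?thesis by simp
    qed
    moreover have "0 \<le> t * \<mu> x"
      using t \<mu>(2)[OF x(1)] by simp
    ultimately have "0 \<le> r (t, x) u" for u
      using cs(1)[of u] v by (auto simp: r_def)
    moreover have "r (t, x) u = 0" if "u \<notin> insert v \<sigma>" for u
      using cs(2)[OF that] that by (simp add: r_def)
    moreover have "sum (r (t, x)) (insert v \<sigma>) = 1"
    proof -
      have "sum (r (t, x)) (insert v \<sigma>) = x v + t * \<mu> x * card \<sigma> + (\<Sum>u\<in>\<sigma>. x u - t * \<mu> x)"
      proof -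
        have "(\<Sum>u\<in>\<sigma>. r (t, x) u) = (\<Sum>u\<in>\<sigma>. x u - t * \<mu> x)"
          using v by (intro sum.cong refl) (auto simp: r_def)
        then show ?thesis
          using v fin(1) by (simp add: r_def)
      qed
      also have "\<dots> = sum x (insert v \<sigma>)"
        using v fin(1) by (simp add: sum_subtractf)
      finally show ?thesis
        using cs(3) by simp
    qed
    ultimately show ?thesis
      by (simp add: closed_simplex_def)
  qed
  show "continuous_on ({0..1} \<times> realization_set K) r"
    unfolding r_def \<mu>_def case_prod_unfold
  proof (intro continuous_on_coordinatewise_then_product)
    have "continuous_on ({0..1} \<times> realization_set K) (\<lambda>z. Min (snd z ` \<sigma>))"
      by (intro continuous_on_Min_image fin continuous_on_snd_coordinate)
    then show "continuous_on ({0..1} \<times> realization_set K) (\<lambda>z. snd z u - fst z * Min (snd z ` \<sigma>) * (if u \<in> \<sigma> then 1 else 0)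
        + fst z * Min (snd z ` \<sigma>) * real (card \<sigma>) * (if u = v then 1 else 0))" for u
      by (intro continuous_on_add continuous_on_diff continuous_on_mult continuous_on_const
          continuous_on_fst continuous_on_id continuous_on_snd_coordinate)
  qed
  show "r \<in> {0..1} \<times> realization_set K \<rightarrow> realization_set K"
  proof clarsimp
    fix t :: real and x assume "0 \<le> t" "t \<le> 1" and x: "x \<in> realization_set K"
    then show "r (t, x) \<in> realization_set K"
      using r\<tau>[OF x, of t] \<mu>0[of x t] realization_setI[OF \<tau>] by (cases "\<mu> x = 0") auto
  qed
  show "r (0, x) = x" for x
    by (simp add: r_def)
  show "r (1, x) \<in> realization_set ?K0" if x: "x \<in> realization_set K" for x
  proof (cases "\<mu> x = 0")
    case True
    then have "\<not> \<sigma> \<subseteq> support x"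
      using \<mu>(3)[OF x] by blast
    then have "support x \<in> ?K0"
      using realization_setD(1)[OF K x] by auto
    then show ?thesis
      using \<mu>0[OF True] realization_setD(2)[OF K x] realization_setI by metis
  next
    case False
    have "\<mu> x \<in> x ` \<sigma>"
      unfolding \<mu>_def using fin by (intro Min_in) auto
    \<comment> \<open>At time 1 a vertex \<open>u\<close> with the least coordinate has lost all its
      mass, so the point lies in the face of \<open>insert v \<sigma>\<close> opposite
      \<open>u\<close>, which is neither of the removed simplices.\<close>
    then obtain u where u: "u \<in> \<sigma>" "x u = \<mu> x"
      by auto
    then have "r (1, x) u = 0"
      using v by (auto simp: r_def)
    moreover have r1: "r (1, x) \<in> closed_simplex (insert v \<sigma>)"
      by (rule r\<tau>[OF x False]) simp
    ultimately have supp: "support (r (1, x)) \<subseteq> insert v \<sigma> - {u}"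
      using support_closed_simplex[OF r1] by (simp add: subset_Diff_insert) (simp add: support_def)
    have "r (1, x) \<in> closed_simplex (insert v \<sigma> - {u})"
      by (rule closed_simplex_mono[OF _ r1 supp]) (simp add: fin, rule Diff_subset)
    moreover have "insert v \<sigma> - {u} \<in> ?K0"
    proof -
      have "insert v \<sigma> - {u} \<noteq> {}"
        using u v by auto
      then have "insert v \<sigma> - {u} \<in> K"
        by (rule abstract_complexD(4)[OF K \<tau> Diff_subset])
      moreover have "insert v \<sigma> - {u} \<noteq> \<sigma>" "insert v \<sigma> - {u} \<noteq> insert v \<sigma>"
      proof -
        have "u \<notin> insert v \<sigma> - {u}" by simp
        then show "insert v \<sigma> - {u} \<noteq> \<sigma>" "insert v \<sigma> - {u} \<noteq> insert v \<sigma>"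
          using u(1) by (metis, metis insertI2)
      qed
      ultimately show ?thesis
        by simp
    qed
    ultimately show ?thesis
      by (rule realization_setI[rotated])
  qed
  show "r (t, x) = x" if "x \<in> realization_set ?K0" for x and t :: real
  proof -
    have "x \<in> realization_set K" "support x \<in> ?K0"
      using that sub realization_setD(1)[OF K0] by auto
    then have "\<mu> x = 0"
      using \<mu>(3)[of x] co[of "support x"] by auto
    then show ?thesis
      by (rule \<mu>0)
  qed
qed

lemma pointed_heq_reduces:
  assumes "reduces d K N K'" "N = 0" "abstract_complex K" "{w} \<in> K'"
  shows "pointed_heq (realization_set K) (vertex_point w) (realization_set K') (vertex_point w)"
  using assms
proof (induction rule: reduces.induct)
  case (stop K)
  then show ?case
    by (intro pointed_heq_refl vertex_point_in_realization_set)
next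
  case (collapse \<sigma> K v N K')
  have w: "{w} \<in> K - {\<sigma>, insert v \<sigma>}"
    using reduces_subset[OF collapse.hyps(5)] collapse.prems(3) by blast
  have "pointed_heq (realization_set K) (vertex_point w) (realization_set (K - {\<sigma>, insert v \<sigma>})) (vertex_point w)"
    by (rule pointed_heq_collapse; (fact collapse.prems(2) collapse.hyps(1-3) w | erule (1) collapse.hyps(4)))
  moreover have "abstract_complex (K - {\<sigma>, insert v \<sigma>})"
    by (rule abstract_complex_collapse; (fact collapse.prems(2) collapse.hyps(1) | erule (1) collapse.hyps(4)))
  then have "pointed_heq (realization_set (K - {\<sigma>, insert v \<sigma>})) (vertex_point w) (realization_set K') (vertex_point w)"
    by (rule collapse.IH[OF collapse.prems(1) _ collapse.prems(3)])
  ultimately show ?case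
    by (rule pointed_heq_trans)
next
  case critical
  then show ?case by simp
qed

text \<open>Homotopy extension over one simplex. With \<open>s = card \<sigma> * Min (x ` \<sigma>)\<close> a point of the simplex is
  \<open>s\<close> times the barycentre plus \<open>1 - s\<close> times the boundary point \<open>b x\<close>; at time \<open>t\<close> the collar
  \<open>2 * s \<le> t\<close> carries the given homotopy of the boundary and the rest is stretched over the simplex.\<close>

lemma homotopy_extension_simplex:
  fixes Y Z :: "('a \<Rightarrow> real) set" and c :: "real \<times> ('a \<Rightarrow> real) \<Rightarrow> 'a \<Rightarrow> real"
  assumes "closed Y" and fin: "finite \<sigma>" "\<sigma> \<noteq> {}"
    and bd: "\<And>x. x \<in> closed_simplex \<sigma> \<Longrightarrow> x \<in> Y \<longleftrightarrow> Min (x ` \<sigma>) = 0"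
    and c: "continuous_on ({0..1} \<times> Y) c" "c \<in> {0..1} \<times> Y \<rightarrow> Z" "\<And>y. y \<in> Y \<Longrightarrow> c (0, y) = y"
    and Z: "Y \<union> closed_simplex \<sigma> \<subseteq> Z"
  shows "\<exists>c'. continuous_on ({0..1} \<times> (Y \<union> closed_simplex \<sigma>)) c' \<and> c' \<in> {0..1} \<times> (Y \<union> closed_simplex \<sigma>) \<rightarrow> Z \<and>
    (\<forall>x\<in>Y \<union> closed_simplex \<sigma>. c' (0, x) = x) \<and> (\<forall>t. \<forall>y\<in>Y. c' (t, y) = c (t, y))"
proof -
  define k where "k = real (card \<sigma>)"
  define s where "s x = k * Min (x ` \<sigma>)" for x :: "'a \<Rightarrow> real"
  \<comment> \<open>\<open>a\<close> stretches towards the boundary: the parameter \<open>s\<close>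
    becomes \<open>(2 * s - t) / (2 - t)\<close>, which is 0 on the edge \<open>2 * s = t\<close> of
    the collar and 1 at the barycentre.\<close>
  define a where "a = (\<lambda>(t, x) u. 2 / (2 - t) * x u - t / (2 - t) * (if u \<in> \<sigma> then 1 / k else 0))"
  define b where "b x u = (x u - (if u \<in> \<sigma> then s x / k else 0)) / (1 - s x)" for x u
  \<comment> \<open>On the collar the homotopy \<open>c\<close> runs with the delay
    \<open>2 * s x\<close>. At the edge it is just starting,
    \<open>c (0, b x) = b x = a (t, x)\<close>, so the two formulas agree.\<close>
  define c' where "c' = (\<lambda>(t, x). if x \<in> Y then c (t, x) else if t \<le> 2 * s x then a (t, x) else c (t - 2 * s x, b x))"
  have k: "0 < k"
    using fin by (simp add: k_def card_gt_0_iff)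
  have cs: "0 \<le> x u" "u \<notin> \<sigma> \<Longrightarrow> x u = 0" "sum x \<sigma> = 1" if "x \<in> closed_simplex \<sigma>" for x u
    using that by (auto simp: closed_simplex_def)
  have s_le: "s x / k \<le> x u" if "u \<in> \<sigma>" for x u
    using that fin k by (simp add: s_def)
  have s: "0 \<le> s x" "s x \<le> 1" if "x \<in> closed_simplex \<sigma>" for x
  proof -
    show "0 \<le> s x"
      using Min_image_pos_iff(2)[OF fin, of x] cs(1)[OF that] k by (simp add: s_def)
    have "(\<Sum>u\<in>\<sigma>. s x / k) \<le> sum x \<sigma>"
      by (intro sum_mono s_le)
    then show "s x \<le> 1"
      using cs(3)[OF that] k by (simp add: k_def)
  qed
  have s0: "s x = 0 \<longleftrightarrow> x \<in> Y" if "x \<in> closed_simplex \<sigma>" for x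
    using bd[OF that] k by (simp add: s_def)
  have a_in: "a (t, x) \<in> closed_simplex \<sigma>" if x: "x \<in> closed_simplex \<sigma>" and t: "t \<le> 2 * s x" "0 \<le> t" "t \<le> 1" for t x
  proof -
    have "0 \<le> a (t, x) u" for u
    proof (cases "u \<in> \<sigma>")
      case True
      have "t / k \<le> 2 * x u"
        using s_le[OF True, of x] t(1) k by (simp add: field_simps)
      moreover have "a (t, x) u = (2 * x u - t / k) / (2 - t)"
        using True by (simp add: a_def field_simps diff_divide_distrib)
      ultimately show ?thesis
        using t by simp
    next
      case False
      then show ?thesis
        using cs(2)[OF x] by (simp add: a_def)
    qed
    moreover have "a (t, x) u = 0" if "u \<notin> \<sigma>" for u
      using cs(2)[OF x] that by (simp add: a_def)
    moreover have "sum (a (t, x)) \<sigma> = 2 / (2 - t) * sum x \<sigma> - t / (2 - t)"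
      using k by (simp add: a_def sum_subtractf sum_distrib_left k_def)
    then have "sum (a (t, x)) \<sigma> = 1"
      using cs(3)[OF x] t by (simp add: diff_divide_distrib[symmetric])
    ultimately show ?thesis
      by (simp add: closed_simplex_def)
  qed
  have b_in: "b x \<in> closed_simplex \<sigma>" "b x \<in> Y" if x: "x \<in> closed_simplex \<sigma>" "s x < 1" for x
  proof -
    have nn: "0 \<le> b x u" for u
      using s_le[of u x] cs(1)[OF x(1)] x(2) by (simp add: b_def)
    moreover have "b x u = 0" if "u \<notin> \<sigma>" for u
      using cs(2)[OF x(1)] that by (simp add: b_def)
    moreover have "sum (b x) \<sigma> = (sum x \<sigma> - s x) / (1 - s x)"
      using k by (simp add: b_def sum_divide_distrib[symmetric] sum_subtractf k_def)
    then have "sum (b x) \<sigma> = 1"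
      using cs(3)[OF x(1)] x(2) by simp
    ultimately show bx: "b x \<in> closed_simplex \<sigma>"
      by (simp add: closed_simplex_def)
    have "Min (x ` \<sigma>) \<in> x ` \<sigma>"
      using fin by (intro Min_in) auto
    then obtain u where u: "u \<in> \<sigma>" "x u = s x / k"
      using k by (auto simp: s_def)
    then have "b x u = 0"
      by (simp add: b_def)
    then have "\<not> \<sigma> \<subseteq> support (b x)"
      using u(1) by (auto simp: support_def)
    then show "b x \<in> Y"
      using bd[OF bx] Min_image_pos_iff(3)[OF fin, of "b x"] nn by blast
  qed
  have cont_s: "continuous_on A (\<lambda>z :: real \<times> ('a \<Rightarrow> real). s (snd z))" for A
    unfolding s_def by (intro continuous_on_mult continuous_on_const continuous_on_Min_image fin continuous_on_snd_coordinate)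
  let ?A1 = "{0..1::real} \<times> Y"
  let ?A2 = "{z \<in> {0..1} \<times> closed_simplex \<sigma>. fst z \<le> 2 * s (snd z)}"
  let ?A3 = "{z \<in> {0..1} \<times> closed_simplex \<sigma>. 2 * s (snd z) \<le> fst z}"
  have 1: "continuous_on ?A1 c'"
    by (rule continuous_on_eq[OF c(1)]) (auto simp: c'_def)
  have 2: "continuous_on ?A2 c'"
  proof (rule continuous_on_eq)
    show "continuous_on ?A2 a"
      unfolding a_def case_prod_unfold
      by (intro continuous_on_coordinatewise_then_product continuous_on_diff continuous_on_mult continuous_on_divide
          continuous_on_const continuous_on_fst continuous_on_id continuous_on_snd_coordinate) auto
    show "a z = c' z" if z_in: "z \<in> ?A2" for z
    proof -
      obtain t x where z: "z = (t, x)"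
        by (cases z)
      show ?thesis
      proof (cases "x \<in> Y")
        case True
        then have "t = 0"
          using z_in z s0[of x] by auto
        then show ?thesis
          using z True c(3) by (auto simp: c'_def a_def)
      next
        case False
        then show ?thesis
          using z z_in by (simp add: c'_def)
      qed
    qed
  qed
  have 3: "continuous_on ?A3 c'"
  proof (rule continuous_on_eq)
    \<comment> \<open>The collar ends at \<open>s = 1/2\<close> at the latest, so the division by
      \<open>1 - s\<close> in \<open>b\<close> is safe.\<close>
    have s1: "s (snd z) < 1" if "z \<in> ?A3" for z
      using that by auto
    have "continuous_on ?A3 (\<lambda>z. (fst z - 2 * s (snd z), b (snd z)))"
    proof (intro continuous_on_Pair continuous_on_coordinatewise_then_product)
      show "continuous_on ?A3 (\<lambda>z. fst z - 2 * s (snd z))"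
        by (intro continuous_on_diff continuous_on_mult continuous_on_const continuous_on_fst continuous_on_id cont_s)
      have ite: "continuous_on ?A3 (\<lambda>z. if u \<in> \<sigma> then s (snd z) / k else 0)" for u
        using k by (cases "u \<in> \<sigma>") (auto intro!: continuous_on_divide cont_s)
      show "continuous_on ?A3 (\<lambda>z. b (snd z) u)" for u
        unfolding b_def
        by (intro continuous_on_divide continuous_on_diff continuous_on_const continuous_on_snd_coordinate cont_s ite)
          (rule ballI, drule s1, simp)
    qed
    then show "continuous_on ?A3 (\<lambda>z. c (fst z - 2 * s (snd z), b (snd z)))"
    proof (rule continuous_on_compose2[OF c(1)])
      show "(\<lambda>z. (fst z - 2 * s (snd z), b (snd z))) ` ?A3 \<subseteq> {0..1} \<times> Y"
        using s1 b_in(2) s(1) by fastforce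
    qed
    show "c (fst z - 2 * s (snd z), b (snd z)) = c' z" if z_in: "z \<in> ?A3" for z
    proof -
      obtain t x where z: "z = (t, x)"
        by (cases z)
      have x: "x \<in> closed_simplex \<sigma>" "2 * s x \<le> t" "t \<le> 1"
        using z z_in by auto
      show ?thesis
      proof (cases "x \<in> Y")
        case True
        then have "s x = 0"
          using s0[OF x(1)] by blast
        then have "b x = x"
          by (auto simp: b_def)
        then show ?thesis
          using z True \<open>s x = 0\<close> by (simp add: c'_def)
      next
        case F: False
        show ?thesis
        proof (cases "t \<le> 2 * s x")
          case True
          then have t: "t = 2 * s x"
            using x by simp
          have "a (t, x) = b x"
          proof
            fix u
            have "1 - s x \<noteq> 0" "2 - 2 * s x \<noteq> 0"
              using x(2,3) by auto
            then have e: "2 / (2 - 2 * s x) = 1 / (1 - s x)" "2 * s x / (2 - 2 * s x) = s x / (1 - s x)"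
              by (auto simp: frac_eq_eq algebra_simps)
            show "a (t, x) u = b x u"
              unfolding a_def b_def t prod.case e by (simp add: diff_divide_distrib)
          qed
          moreover have "c (0, b x) = b x"
            using b_in(2)[OF x(1)] x(2,3) by (intro c(3)) auto
          ultimately show ?thesis
            using z F t by (simp add: c'_def)
        next
          case False
          then show ?thesis
            using z F by (simp add: c'_def)
        qed
      qed
    qed
  qed
  have "closed ?A1"
    using assms(1) by (intro closed_Times) auto
  moreover have "closed ?A2" "closed ?A3"
  proof -
    have "closed ({0..1::real} \<times> closed_simplex \<sigma>)"
      by (intro closed_Times closed_closed_simplex) auto
    moreover have "closed {z :: real \<times> ('a \<Rightarrow> real). fst z \<le> 2 * s (snd z)}" "closed {z :: real \<times> ('a \<Rightarrow> real). 2 * s (snd z) \<le> fst z}"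
      by (intro closed_Collect_le continuous_on_mult continuous_on_const continuous_on_fst continuous_on_id cont_s)+
    ultimately show "closed ?A2" "closed ?A3"
      using closed_Int by (simp_all add: Collect_conj_eq)
  qed
  ultimately have "continuous_on (?A1 \<union> (?A2 \<union> ?A3)) c'"
    using 1 2 3 by (intro continuous_on_closed_Un closed_Un)
  moreover have "?A1 \<union> (?A2 \<union> ?A3) = {0..1} \<times> (Y \<union> closed_simplex \<sigma>)"
    by auto
  ultimately have "continuous_on ({0..1} \<times> (Y \<union> closed_simplex \<sigma>)) c'"
    by simp
  moreover have mem: "c' (t, x) \<in> Z" if "t \<in> {0..1}" "x \<in> Y \<union> closed_simplex \<sigma>" for t x
  proof (cases "x \<in> Y")
    case True
    then show ?thesis
      using c(2) that(1) by (auto simp: c'_def)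
  next
    case False
    then have x: "x \<in> closed_simplex \<sigma>"
      using that by auto
    show ?thesis
    proof (cases "t \<le> 2 * s x")
      case True
      then show ?thesis
        using False a_in[OF x True] that(1) Z by (auto simp: c'_def)
    next
      case F: False
      then have "b x \<in> Y"
        using b_in(2)[OF x] that(1) by auto
      moreover have "t - 2 * s x \<in> {0..1}"
        using F s(1)[OF x] that(1) by auto
      ultimately show ?thesis
        using False F c(2) by (auto simp: c'_def)
    qed
  qed
  have "c' \<in> {0..1} \<times> (Y \<union> closed_simplex \<sigma>) \<rightarrow> Z"
    by (rule funcsetI) (metis SigmaE mem)
  moreover have "c' (0, x) = x" if "x \<in> Y \<union> closed_simplex \<sigma>" for x
    using that c(3) s(1)[of x] by (auto simp: c'_def a_def)
  moreover have "c' (t, y) = c (t, y)" if "y \<in> Y" for t y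
    using that by (simp add: c'_def)
  ultimately show ?thesis
    by blast
qed

text \<open>The simplices of \<open>C\<close> are facets, so the homotopy can be extended over them
  one after another. \<open>K\<close> shrinks in the induction while the values may lie anywhere in
  the larger complex, hence the separate target \<open>Z\<close>.\<close>

lemma homotopy_extension_cells:
  fixes Z :: "('a \<Rightarrow> real) set" and c :: "real \<times> ('a \<Rightarrow> real) \<Rightarrow> 'a \<Rightarrow> real"
  assumes "finite C" "C \<subseteq> K" "abstract_complex K"
    and "\<And>\<sigma> \<tau>. \<lbrakk>\<sigma> \<in> C; \<tau> \<in> K; \<sigma> \<subseteq> \<tau>\<rbrakk> \<Longrightarrow> \<tau> = \<sigma>"
    and "realization_set K \<subseteq> Z"
    and c: "continuous_on ({0..1} \<times> realization_set (K - C)) c" "c \<in> {0..1} \<times> realization_set (K - C) \<rightarrow> Z"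
      "\<And>y. y \<in> realization_set (K - C) \<Longrightarrow> c (0, y) = y"
  shows "\<exists>c'. continuous_on ({0..1} \<times> realization_set K) c' \<and> c' \<in> {0..1} \<times> realization_set K \<rightarrow> Z \<and>
    (\<forall>x\<in>realization_set K. c' (0, x) = x) \<and> (\<forall>t. \<forall>y\<in>realization_set (K - C). c' (t, y) = c (t, y))"
  using assms
proof (induction C arbitrary: K rule: finite_induct)
  case empty
  then show ?case
    by (intro exI[of _ c]) simp
next
  case (insert \<sigma> C)
  let ?K = "K - {\<sigma>}"
  have K: "abstract_complex K" and \<sigma>: "\<sigma> \<in> K"
    using insert.prems by auto
  have K': "abstract_complex ?K"
    by (rule abstract_complex_up_removal[OF K]) (use insert.prems(3) in blast)
  have eq: "?K - C = K - insert \<sigma> C"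
    by blast
  have poly: "realization_set K = realization_set ?K \<union> closed_simplex \<sigma>"
    using \<sigma> by (auto simp: realization_set_def)
  have "\<exists>c'. continuous_on ({0..1} \<times> realization_set ?K) c' \<and> c' \<in> {0..1} \<times> realization_set ?K \<rightarrow> Z \<and>
    (\<forall>x\<in>realization_set ?K. c' (0, x) = x) \<and> (\<forall>t. \<forall>y\<in>realization_set (?K - C). c' (t, y) = c (t, y))"
  proof (rule insert.IH)
    show "C \<subseteq> ?K"
      using insert.prems(1) insert.hyps by auto
    show "abstract_complex ?K"
      by (rule K')
    show "\<tau> = \<pi>" if "\<pi> \<in> C" "\<tau> \<in> ?K" "\<pi> \<subseteq> \<tau>" for \<pi> \<tau>
      using insert.prems(3) that by blast
    show "realization_set ?K \<subseteq> Z"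
      using insert.prems(4) poly by blast
  qed (use insert.prems(5-7) in \<open>simp_all only: eq\<close>)
  then obtain c1 where c1: "continuous_on ({0..1} \<times> realization_set ?K) c1" "c1 \<in> {0..1} \<times> realization_set ?K \<rightarrow> Z"
    "\<forall>x\<in>realization_set ?K. c1 (0, x) = x" "\<forall>t. \<forall>y\<in>realization_set (K - insert \<sigma> C). c1 (t, y) = c (t, y)"
    unfolding eq by blast
  have "\<exists>c'. continuous_on ({0..1} \<times> (realization_set ?K \<union> closed_simplex \<sigma>)) c' \<and>
    c' \<in> {0..1} \<times> (realization_set ?K \<union> closed_simplex \<sigma>) \<rightarrow> Z \<and>
    (\<forall>x\<in>realization_set ?K \<union> closed_simplex \<sigma>. c' (0, x) = x) \<and> (\<forall>t. \<forall>y\<in>realization_set ?K. c' (t, y) = c1 (t, y))"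
  proof (rule homotopy_extension_simplex)
    show "closed (realization_set ?K)"
      by (rule closed_realization_set[OF K'])
    show fin: "finite \<sigma>" "\<sigma> \<noteq> {}"
      using abstract_complexD(2,3)[OF K \<sigma>] by auto
    show "x \<in> realization_set ?K \<longleftrightarrow> Min (x ` \<sigma>) = 0" if x: "x \<in> closed_simplex \<sigma>" for x
    proof -
      have "x \<in> realization_set K"
        using x \<sigma> realization_setI by blast
      then have "x \<in> realization_set ?K \<longleftrightarrow> support x \<noteq> \<sigma>"
        using realization_set_support_iff[OF K _ _ K', of x] realization_setD(1)[OF K, of x] by auto
      also have "\<dots> \<longleftrightarrow> \<not> \<sigma> \<subseteq> support x"
        using support_closed_simplex[OF x] by auto
      finally show ?thesis
        using Min_image_pos_iff(3)[OF fin, of x] x by (auto simp: closed_simplex_def)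
    qed
    show "realization_set ?K \<union> closed_simplex \<sigma> \<subseteq> Z"
      using insert.prems(4) poly by simp
  qed (use c1 in auto)
  then obtain c2 where c2: "continuous_on ({0..1} \<times> realization_set K) c2" "c2 \<in> {0..1} \<times> realization_set K \<rightarrow> Z"
    "\<forall>x\<in>realization_set K. c2 (0, x) = x" "\<forall>t. \<forall>y\<in>realization_set ?K. c2 (t, y) = c1 (t, y)"
    unfolding poly[symmetric] by blast
  have "realization_set (K - insert \<sigma> C) \<subseteq> realization_set ?K"
    by (auto simp: realization_set_def)
  then have "\<forall>t. \<forall>y\<in>realization_set (K - insert \<sigma> C). c2 (t, y) = c (t, y)"
    using c2(4) c1(4) by (metis subsetD)
  then show ?case
    using c2(1-3) by blast
qed

section \<open>Spheres and bouquets of spheres\<close>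

definition base_pt :: "nat \<Rightarrow> real" where
  "base_pt = (\<lambda>i. if i = 0 then 1 else 0)"

definition std_sphere :: "nat \<Rightarrow> (nat \<Rightarrow> real) set" where
  "std_sphere d = {x. (\<Sum>i\<le>d. (x i)\<^sup>2) = 1 \<and> (\<forall>i>d. x i = 0)}"

text \<open>The union of the coordinate axes in a power of the sphere. Coordinates from
  \<open>N\<close> on are fixed at the base point, so that bouquets of all sizes are subsets of one
  type.\<close>

definition bouquet :: "nat \<Rightarrow> nat \<Rightarrow> (nat \<Rightarrow> nat \<Rightarrow> real) set" where
  "bouquet d N = {G. (\<forall>i. G i \<in> std_sphere d) \<and> (\<forall>i\<ge>N. G i = base_pt) \<and>
     (\<forall>i j. i \<noteq> j \<longrightarrow> G i = base_pt \<or> G j = base_pt)}"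

definition bouquet_base :: "nat \<Rightarrow> nat \<Rightarrow> real" where
  "bouquet_base = (\<lambda>_. base_pt)"

lemma base_pt_in_std_sphere: "base_pt \<in> std_sphere d"
proof -
  have "(\<Sum>i\<le>d. (base_pt i)\<^sup>2) = (\<Sum>i\<le>d. if i = 0 then 1 else 0)"
    by (intro sum.cong) (auto simp: base_pt_def)
  then show ?thesis
    by (simp add: std_sphere_def base_pt_def)
qed

lemma bouquet_base_in_bouquet: "bouquet_base \<in> bouquet d N"
  by (simp add: bouquet_def bouquet_base_def base_pt_in_std_sphere)

lemma nsphere_eq_std_sphere: "nsphere d = top_of_set (std_sphere d)"
  by (simp add: nsphere std_sphere_def euclidean_product_topology conj_commute)

lemma std_sphere_0_eq_1:
  assumes "x \<in> std_sphere d" "x 0 = 1"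
  shows "x = base_pt"
proof
  fix i
  have "(\<Sum>i\<le>d. (x i)\<^sup>2) = (x 0)\<^sup>2 + (\<Sum>i\<in>{..d} - {0}. (x i)\<^sup>2)"
    by (simp add: sum.remove[of "{..d}" 0])
  then have "(\<Sum>i\<in>{..d} - {0}. (x i)\<^sup>2) = 0"
    using assms by (simp add: std_sphere_def)
  then have "\<forall>i\<in>{..d} - {0}. (x i)\<^sup>2 = 0"
    by (subst (asm) sum_nonneg_eq_0_iff) auto
  then show "x i = base_pt i"
    using assms by (cases "i \<le> d") (auto simp: base_pt_def std_sphere_def)
qed

lemma std_sphere_0_le_1:
  assumes "x \<in> std_sphere d"
  shows "x 0 \<le> 1" "-1 \<le> x 0"
proof -
  have "(x 0)\<^sup>2 \<le> (\<Sum>i\<le>d. (x i)\<^sup>2)"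
    by (rule member_le_sum) auto
  then have "(x 0)\<^sup>2 \<le> 1"
    using assms by (simp add: std_sphere_def)
  then show "x 0 \<le> 1" "-1 \<le> x 0"
    by (auto simp: abs_square_le_1 abs_le_iff)
qed

text \<open>The map from the standard simplex to the sphere which collapses the boundary to the base point:
  with \<open>\<mu> = Min y\<close> it sends \<open>y\<close> to the inverse stereographic projection of \<open>(y j - y 0) / \<mu>\<close>. The
  last summand of the denominator vanishes on the simplex and makes the formula meaningful for
  all nonnegative \<open>y\<close>.\<close>

definition simplex_den :: "nat \<Rightarrow> (nat \<Rightarrow> real) \<Rightarrow> real" where
  "simplex_den d y = (\<Sum>j\<le>d. (y j - y 0)\<^sup>2) + (Min (y ` {..d}))\<^sup>2 + (1 - sum y {..d})\<^sup>2"

definition simplex_sphere :: "nat \<Rightarrow> (nat \<Rightarrow> real) \<Rightarrow> nat \<Rightarrow> real" where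
  "simplex_sphere d y = (\<lambda>j. if j = 0 then 1 - 2 * (Min (y ` {..d}))\<^sup>2 / simplex_den d y
     else if j \<le> d then 2 * Min (y ` {..d}) * (y j - y 0) / simplex_den d y else 0)"

text \<open>If all three squares vanished, \<open>y\<close> would be constantly 0 on
  \<open>{..d}\<close>, and then \<open>1 - sum y {..d}\<close> would be 1.\<close>

lemma simplex_den_pos: "0 < simplex_den d y"
proof -
  have nn: "0 \<le> (\<Sum>j\<le>d. (y j - y 0)\<^sup>2)"
    by (intro sum_nonneg) auto
  then have "0 \<le> simplex_den d y"
    by (simp add: simplex_den_def)
  moreover have "simplex_den d y \<noteq> 0"
  proof
    assume "simplex_den d y = 0"
    then have 00: "(\<Sum>j\<le>d. (y j - y 0)\<^sup>2) + (Min (y ` {..d}))\<^sup>2 + (1 - sum y {..d})\<^sup>2 = 0"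
      unfolding simplex_den_def .
    note nn2 = nn zero_le_power2[of "Min (y ` {..d})"] zero_le_power2[of "1 - sum y {..d}"]
    have 0: "(\<Sum>j\<le>d. (y j - y 0)\<^sup>2) = 0" "(Min (y ` {..d}))\<^sup>2 = 0" "(1 - sum y {..d})\<^sup>2 = 0"
      using add_nonneg_eq_0_iff[OF add_nonneg_nonneg[OF nn2(1,2)] nn2(3)] add_nonneg_eq_0_iff[OF nn2(1,2)] 00
      by blast+
    have eq: "y j = y 0" if "j \<le> d" for j
    proof -
      have "(y j - y 0)\<^sup>2 = 0"
        by (rule bspec[OF sum_nonneg_eq_0_iff[THEN iffD1, OF _ _ 0(1)]]) (use that in simp_all)
      then show ?thesis by simp
    qed
    have "y ` {..d} = (\<lambda>_. y 0) ` {..d}"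
      by (intro image_cong refl eq) simp
    then have "y 0 = 0"
      using 0(2) by (simp add: image_constant_conv)
    moreover have "sum y {..d} = (\<Sum>j\<le>d. y 0)"
      by (intro sum.cong refl eq) simp
    ultimately have "sum y {..d} = 0"
      by simp
    then show False
      using 0(3) by simp
  qed
  ultimately show ?thesis
    by simp
qed

lemma simplex_sphere_Min_0: "Min (y ` {..d}) = 0 \<Longrightarrow> simplex_sphere d y = base_pt"
  by (auto simp: simplex_sphere_def base_pt_def)

lemma simplex_sphere_less_1:
  assumes "Min (y ` {..d}) \<noteq> 0"
  shows "simplex_sphere d y 0 < 1" "simplex_sphere d y \<noteq> base_pt"
proof -
  show "simplex_sphere d y 0 < 1"
    using assms simplex_den_pos[of d y] by (simp add: simplex_sphere_def)
  then show "simplex_sphere d y \<noteq> base_pt"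
    by (auto simp: base_pt_def)
qed

lemma simplex_sphere_in_std_sphere:
  assumes "Min (y ` {..d}) = 0 \<or> sum y {..d} = 1"
  shows "simplex_sphere d y \<in> std_sphere d"
proof (cases "Min (y ` {..d}) = 0")
  case True
  then show ?thesis
    by (simp add: simplex_sphere_Min_0 base_pt_in_std_sphere)
next
  case False
  define \<mu> where "\<mu> = Min (y ` {..d})"
  define D where "D = simplex_den d y"
  define Z where "Z = (\<Sum>j\<in>{..d} - {0}. (y j - y 0)\<^sup>2)"
  have D: "0 < D"
    by (simp add: D_def simplex_den_pos)
  have "(\<Sum>j\<le>d. (y j - y 0)\<^sup>2) = Z"
    by (simp add: sum.remove[of "{..d}" 0] Z_def)
  then have D_eq: "D = Z + \<mu>\<^sup>2"
    using assms False by (simp add: D_def simplex_den_def \<mu>_def)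
  have "(\<Sum>i\<le>d. (simplex_sphere d y i)\<^sup>2) = (1 - 2 * \<mu>\<^sup>2 / D)\<^sup>2 + (\<Sum>j\<in>{..d} - {0}. (simplex_sphere d y j)\<^sup>2)"
    by (simp add: sum.remove[of "{..d}" 0] simplex_sphere_def \<mu>_def D_def)
  also have "(\<Sum>j\<in>{..d} - {0}. (simplex_sphere d y j)\<^sup>2) = (\<Sum>j\<in>{..d} - {0}. (2 * \<mu> / D)\<^sup>2 * (y j - y 0)\<^sup>2)"
    by (intro sum.cong refl) (simp add: simplex_sphere_def \<mu>_def D_def power_mult_distrib power_divide)
  also have "\<dots> = (2 * \<mu> / D)\<^sup>2 * Z"
    by (simp add: Z_def sum_distrib_left)
  also have "(1 - 2 * \<mu>\<^sup>2 / D)\<^sup>2 + (2 * \<mu> / D)\<^sup>2 * Z = 1 - 4 * \<mu>\<^sup>2 / D + 4 * \<mu>\<^sup>2 * (Z + \<mu>\<^sup>2) / D\<^sup>2"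
    by (simp add: power2_diff power_divide power_mult_distrib add_divide_distrib algebra_simps power2_eq_square)
  also have "\<dots> = 1"
    unfolding D_eq[symmetric] using D by (simp add: power2_eq_square)
  finally show ?thesis
    by (auto simp: std_sphere_def simplex_sphere_def)
qed

lemma simplex_sphere_ratio:
  assumes "Min (y ` {..d}) \<noteq> 0" "j \<le> d"
  shows "(y j - y 0) / Min (y ` {..d}) = (if j = 0 then 0 else simplex_sphere d y j / (1 - simplex_sphere d y 0))"
  using assms simplex_den_pos[of d y] by (simp add: simplex_sphere_def power2_eq_square)

text \<open>The least ratio belongs to the least coordinate \<open>\<mu>\<close> and is
  \<open>(\<mu> - y 0) / \<mu>\<close>; subtracting it from the ratio at \<open>j\<close> leaves
  \<open>y j / \<mu> - 1\<close>. So the ratios determine \<open>y\<close> up to the factor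
  \<open>\<mu>\<close>.\<close>

lemma simplex_coordinate_from_ratio:
  fixes y :: "nat \<Rightarrow> real"
  assumes "0 < Min (y ` {..d})"
  shows "y j = Min (y ` {..d}) * (1 + (y j - y 0) / Min (y ` {..d}) - Min ((\<lambda>j. (y j - y 0) / Min (y ` {..d})) ` {..d}))"
proof -
  let ?\<mu> = "Min (y ` {..d})"
  have "mono (\<lambda>t. (t - y 0) / ?\<mu>)"
  proof (rule monoI)
    fix t u :: real assume "t \<le> u"
    then have "t - y 0 \<le> u - y 0"
      by simp
    moreover have "0 \<le> ?\<mu>"
      by (rule less_imp_le[OF assms])
    ultimately show "(t - y 0) / ?\<mu> \<le> (u - y 0) / ?\<mu>"
      by (rule divide_right_mono)
  qed
  then have "(?\<mu> - y 0) / ?\<mu> = Min ((\<lambda>t. (t - y 0) / ?\<mu>) ` y ` {..d})"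
    by (rule mono_Min_commute) auto
  then have M: "Min ((\<lambda>j. (y j - y 0) / ?\<mu>) ` {..d}) = (?\<mu> - y 0) / ?\<mu>"
    by (simp add: image_image)
  have "t = \<mu> * (1 + (t - u) / \<mu> - (\<mu> - u) / \<mu>)" if "0 < \<mu>" for t u \<mu> :: real
    using that by (simp add: field_simps)
  then show ?thesis
    unfolding M using assms by blast
qed

text \<open>Equal images have equal stereographic coordinates by
  \<open>simplex_sphere_ratio\<close>, so \<open>y\<close> and \<open>y'\<close> are multiples of
  the same \<open>r\<close>; the sum 1 fixes the factor.\<close>

lemma simplex_sphere_inj:
  assumes "0 < Min (y ` {..d})" "0 < Min (y' ` {..d})" "sum y {..d} = 1" "sum y' {..d} = 1"
    and eq: "simplex_sphere d y = simplex_sphere d y'" and "j \<le> d"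
  shows "y j = y' j"
proof -
  define \<mu> \<mu>' where "\<mu> = Min (y ` {..d})" and "\<mu>' = Min (y' ` {..d})"
  define q where "q j = (y j - y 0) / \<mu>" for j
  define r where "r j = 1 + q j - Min (q ` {..d})" for j
  have q': "(y' j - y' 0) / \<mu>' = q j" if "j \<le> d" for j
    using simplex_sphere_ratio[of y d j] simplex_sphere_ratio[of y' d j] assms(1,2) that eq
    by (simp add: q_def \<mu>_def \<mu>'_def)
  then have im: "(\<lambda>j. (y' j - y' 0) / \<mu>') ` {..d} = q ` {..d}"
    by (intro image_cong) auto
  have y: "y j = \<mu> * r j" for j
    using simplex_coordinate_from_ratio[OF assms(1), of j] by (simp add: \<mu>_def q_def r_def)
  have y': "y' j = \<mu>' * r j" if "j \<le> d" for j
    using simplex_coordinate_from_ratio[OF assms(2), of j] im q'[OF that] by (simp add: \<mu>'_def r_def)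
  have "\<mu> * sum r {..d} = 1"
    using assms(3) by (simp add: y sum_distrib_left)
  moreover have "\<mu>' * sum r {..d} = 1"
    using assms(4) by (simp add: y' sum_distrib_left)
  ultimately have "\<mu> = \<mu>'"
    by (metis mult_cancel_right mult_zero_right zero_neq_one)
  then show ?thesis
    using y y' assms(6) by simp
qed

lemma simplex_sphere_surj:
  assumes s: "s \<in> std_sphere d" "s \<noteq> base_pt"
  obtains y where "0 < Min (y ` {..d})" "\<And>j. j \<le> d \<Longrightarrow> 0 \<le> y j" "sum y {..d} = 1" "simplex_sphere d y = s"
proof -
  have s0: "s 0 < 1"
    using std_sphere_0_le_1(1)[OF s(1)] std_sphere_0_eq_1[OF s(1)] s(2) by fastforce
  define q where "q j = (if j = 0 then 0 else s j / (1 - s 0))" for j :: nat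
  define m where "m = Min (q ` {..d})"
  \<comment> \<open>The stereographic coordinates \<open>q\<close> of \<open>s\<close> are shifted
    so that the least value is 1 and then scaled to sum 1; the minimum of \<open>y\<close> becomes
    \<open>1 / R\<close>.\<close>
  define r where "r j = 1 + q j - m" for j
  define R where "R = sum r {..d}"
  define y where "y j = r j / R" for j
  have r1: "1 \<le> r j" if "j \<le> d" for j
  proof -
    have "m \<le> q j"
      unfolding m_def using that by (intro Min_le) auto
    then show ?thesis
      by (simp add: r_def)
  qed
  have "(\<Sum>j\<le>d. 1) \<le> R"
    unfolding R_def by (intro sum_mono) (use r1 in auto)
  then have R: "0 < R"
    by (simp add: R_def)
  have "mono (\<lambda>t. (1 + t - m) / R)"
    using R by (intro monoI) (simp add: divide_right_mono)
  then have "(1 + m - m) / R = Min ((\<lambda>t. (1 + t - m) / R) ` q ` {..d})"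
    unfolding m_def by (rule mono_Min_commute) auto
  then have \<mu>: "Min (y ` {..d}) = 1 / R"
    by (simp add: image_image y_def[abs_def] r_def)
  have sum1: "sum y {..d} = 1"
    using R by (simp add: y_def sum_divide_distrib[symmetric] R_def)
  have z: "y j - y 0 = q j / R" for j
    by (simp add: y_def r_def diff_divide_distrib[symmetric] q_def)
  have "(\<Sum>i\<le>d. (s i)\<^sup>2) = (s 0)\<^sup>2 + (\<Sum>i\<in>{..d} - {0}. (s i)\<^sup>2)"
    by (simp add: sum.remove[of "{..d}" 0])
  then have S: "(\<Sum>i\<in>{..d} - {0}. (s i)\<^sup>2) = 1 - (s 0)\<^sup>2"
    using s(1) by (simp add: std_sphere_def)
  have "(\<Sum>j\<le>d. (q j)\<^sup>2) = (\<Sum>j\<in>{..d} - {0}. (s j / (1 - s 0))\<^sup>2)"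
    by (simp add: sum.remove[of "{..d}" 0] q_def)
  also have "\<dots> = (1 - (s 0)\<^sup>2) / (1 - s 0)\<^sup>2"
    by (simp add: power_divide sum_divide_distrib[symmetric] S)
  also have "\<dots> = (1 + s 0) / (1 - s 0)"
  proof -
    have "1 - (s 0)\<^sup>2 = (1 + s 0) * (1 - s 0)"
      by (simp add: power2_eq_square algebra_simps)
    then show ?thesis
      using s0 by (simp add: power2_eq_square)
  qed
  finally have Q: "(\<Sum>j\<le>d. (q j)\<^sup>2) = (1 + s 0) / (1 - s 0)" .
  have "simplex_den d y = (\<Sum>j\<le>d. (q j)\<^sup>2) / R\<^sup>2 + 1 / R\<^sup>2"
    using sum1 by (simp add: simplex_den_def z \<mu> power_divide sum_divide_distrib[symmetric])
  also have "\<dots> = (2 / (1 - s 0)) / R\<^sup>2"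
  proof -
    have "(1 + s 0) / (1 - s 0) + 1 = 2 / (1 - s 0)"
      using s0 by (simp add: field_simps)
    then show ?thesis
      unfolding Q add_divide_distrib[symmetric] by simp
  qed
  finally have D: "simplex_den d y = (2 / (1 - s 0)) / R\<^sup>2" .
  have "simplex_sphere d y j = s j" for j
  proof -
    have 1: "2 * (1 / R) * (q j / R) / simplex_den d y = q j * (1 - s 0)"
      using R s0 by (simp add: D power2_eq_square)
    have 2: "2 * (1 / R)\<^sup>2 / simplex_den d y = 1 - s 0"
      using R s0 by (simp add: D power_divide)
    have 3: "s j = 0" if "d < j"
      using s(1) that by (simp add: std_sphere_def)
    show ?thesis
      unfolding simplex_sphere_def \<mu> z 1 2 using s0 3 by (auto simp: q_def)
  qed
  then have "simplex_sphere d y = s"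
    by blast
  moreover have "0 \<le> y j" if "j \<le> d" for j
    using r1[OF that] R by (simp add: y_def)
  ultimately show thesis
    using that[of y] \<mu> R sum1 by simp
qed

lemma continuous_on_simplex_sphere:
  fixes F :: "'z::topological_space \<Rightarrow> nat \<Rightarrow> real"
  assumes "\<And>j. continuous_on A (\<lambda>z. F z j)"
  shows "continuous_on A (\<lambda>z. simplex_sphere d (F z))"
proof (rule continuous_on_coordinatewise_then_product)
  fix j
  have m: "continuous_on A (\<lambda>z. Min (F z ` {..d}))"
    by (intro continuous_on_Min_image assms) auto
  have "continuous_on A (\<lambda>z. simplex_den d (F z))"
    unfolding simplex_den_def by (intro continuous_intros assms m)
  moreover have "\<forall>z\<in>A. simplex_den d (F z) \<noteq> 0"
    using simplex_den_pos by (metis less_irrefl)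
  ultimately show "continuous_on A (\<lambda>z. simplex_sphere d (F z) j)"
    unfolding simplex_sphere_def
    by (cases "j = 0"; cases "j \<le> d") (auto intro!: continuous_intros assms m)
qed

section \<open>Collapsing a contractible subcomplex\<close>

text \<open>\<open>h\<close> collapses \<open>A\<close> to a point. The homotopy \<open>k\<close>
  ends with \<open>A\<close> at \<open>a\<close>, so its final map factors through \<open>h\<close>,
  and the factor \<open>g\<close> is the homotopy inverse. Maps on \<open>B\<close> are continuous
  because \<open>h\<close> and its product with the interval are quotient maps, being continuous
  surjections of compact onto Hausdorff spaces.\<close>

lemma pointed_heq_quotient:
  fixes X A :: "'a::topological_space set" and h :: "'a \<Rightarrow> 'b::metric_space" and k :: "real \<times> 'a \<Rightarrow> 'a"
  assumes X: "compact X" and h: "continuous_on X h" "h ` X = B"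
    and k: "continuous_on ({0..1} \<times> X) k" "k \<in> {0..1} \<times> X \<rightarrow> X" "\<And>x. x \<in> X \<Longrightarrow> k (0, x) = x"
    and A: "A \<subseteq> X" "a \<in> A" "\<And>t x. \<lbrakk>t \<in> {0..1}; x \<in> A\<rbrakk> \<Longrightarrow> k (t, x) \<in> A"
      "\<And>x. x \<in> A \<Longrightarrow> k (1, x) = a" "\<And>t. t \<in> {0..1} \<Longrightarrow> k (t, a) = a"
    and hA: "\<And>x. x \<in> A \<Longrightarrow> h x = b"
    and inj: "\<And>x y. \<lbrakk>x \<in> X; y \<in> X; h x = h y\<rbrakk> \<Longrightarrow> x = y \<or> x \<in> A \<and> y \<in> A"
  shows "pointed_heq X a B b"
proof -
  \<comment> \<open>Any section of \<open>h\<close> will do: it is ambiguous only on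
    \<open>A\<close>, where \<open>k (1, x)\<close> and \<open>h (k (t, x))\<close> do not depend on
    \<open>x\<close>.\<close>
  define r where "r y = (SOME x. x \<in> X \<and> h x = y)" for y
  have r: "r y \<in> X" "h (r y) = y" if "y \<in> B" for y
    using someI_ex[of "\<lambda>x. x \<in> X \<and> h x = y"] that h(2) unfolding r_def by blast+
  have rh: "r (h x) = x \<or> r (h x) \<in> A \<and> x \<in> A" if "x \<in> X" for x
    using inj[of "r (h x)" x] r[of "h x"] h(2) that by blast
  define g where "g y = k (1, r y)" for y
  define H where "H = (\<lambda>(t, y). h (k (t, r y)))"
  have gh: "g (h x) = k (1, x)" if "x \<in> X" for x
    using rh[OF that] A(4) by (auto simp: g_def)
  have Hh: "H (t, h x) = h (k (t, x))" if "x \<in> X" "t \<in> {0..1}" for t x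
    using rh[OF that(1)] A(3)[OF that(2)] hA by (auto simp: H_def)
  have a: "a \<in> X"
    using A by blast
  have b: "b \<in> B" "h a = b"
    using hA[OF A(2)] h(2) a by auto
  have k1: "continuous_on X (\<lambda>x. k (1, x))"
    by (rule continuous_on_compose2[OF k(1) continuous_on_Pair[OF continuous_on_const continuous_on_id]]) auto
  have "quotient_map (top_of_set X) (top_of_set B) h"
    using X h by (intro continuous_imp_quotient_map)
      (auto simp: continuous_map_in_subtopology compact_space_subtopology Hausdorff_space_subtopology Hausdorff_space_euclidean)
  then have "continuous_map (top_of_set B) (top_of_set X) g"
  proof (rule continuous_compose_quotient_map)
    have "continuous_map (top_of_set X) (top_of_set X) (\<lambda>x. k (1, x))"
      using k1 k(2) by (auto simp: continuous_map_in_subtopology)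
    then show "continuous_map (top_of_set X) (top_of_set X) (g \<circ> h)"
      by (rule continuous_map_eq) (simp add: gh)
  qed
  then have g: "continuous_on B g" "g \<in> B \<rightarrow> X"
    by (auto simp: continuous_map_in_subtopology)
  let ?I = "{0..1::real}"
  have idh: "continuous_on (?I \<times> X) (\<lambda>(t, x). (t, h x))"
    unfolding case_prod_unfold
    by (intro continuous_on_Pair continuous_on_fst continuous_on_id
        continuous_on_compose2[OF h(1) continuous_on_snd[OF continuous_on_id]]) auto
  have "quotient_map (top_of_set (?I \<times> X)) (top_of_set (?I \<times> B)) (\<lambda>(t, x). (t, h x))"
  proof (rule continuous_imp_quotient_map)
    show "continuous_map (top_of_set (?I \<times> X)) (top_of_set (?I \<times> B)) (\<lambda>(t, x). (t, h x))"
      using idh h(2) by (auto simp: continuous_map_in_subtopology)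
    show "compact_space (top_of_set (?I \<times> X))"
      using X by (simp add: compact_space_subtopology compact_Times)
    show "Hausdorff_space (top_of_set (?I \<times> B))"
      by (simp add: Hausdorff_space_subtopology Hausdorff_space_euclidean)
    show "(\<lambda>(t, x). (t, h x)) ` topspace (top_of_set (?I \<times> X)) = topspace (top_of_set (?I \<times> B))"
      using h(2) by force
  qed
  then have "continuous_map (top_of_set (?I \<times> B)) (top_of_set B) H"
  proof (rule continuous_compose_quotient_map)
    have "continuous_on (?I \<times> X) (\<lambda>z. h (k z))"
      by (rule continuous_on_compose2[OF h(1) k(1)]) (use k(2) in auto)
    then have "continuous_map (top_of_set (?I \<times> X)) (top_of_set B) (\<lambda>z. h (k z))"
      using h(2) k(2) by (auto simp: continuous_map_in_subtopology)
    then show "continuous_map (top_of_set (?I \<times> X)) (top_of_set B) (H \<circ> (\<lambda>(t, x). (t, h x)))"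
      by (rule continuous_map_eq) (auto simp: Hh)
  qed
  then have H: "continuous_on (?I \<times> B) H" "H \<in> ?I \<times> B \<rightarrow> B"
    by (auto simp: continuous_map_in_subtopology)
  show ?thesis
    unfolding pointed_heq_def
  proof (intro conjI exI)
    show "a \<in> X" "b \<in> B" "continuous_on X h" "h \<in> X \<rightarrow> B" "h a = b" "continuous_on B g" "g \<in> B \<rightarrow> X"
      using a b h g by auto
    show "g b = a"
      using gh[OF a] b A(4)[OF A(2)] by simp
    show "homotopic_with_canon (\<lambda>k. k a = a) X X (g \<circ> h) id"
      by (subst homotopic_with_sym, rule homotopic_with_pointI[OF k(1,2)]) (use k(3) gh a A(5) in auto)
    show "homotopic_with_canon (\<lambda>k. k b = b) B B (h \<circ> g) id"
    proof (subst homotopic_with_sym, rule homotopic_with_pointI[OF H])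
      show "H (0, y) = id y" "H (1, y) = (h \<circ> g) y" if "y \<in> B" for y
        using r[OF that] k(3) by (auto simp: H_def g_def)
      show "H (t, b) = b" if "t \<in> {0..1}" for t
        using Hh[OF a that] A(5)[OF that] b by simp
    qed (use b in auto)
  qed
qed

lemma realization_set_singleton: "realization_set {{w}} = {vertex_point w}"
proof -
  have "x = vertex_point w" if "x \<in> closed_simplex {w}" for x :: "'a \<Rightarrow> real"
    using that by (intro ext) (simp add: closed_simplex_def vertex_point_def)
  then have "closed_simplex {w} \<subseteq> {vertex_point w}"
    by blast
  moreover have "vertex_point w \<in> closed_simplex {w}"
    by (simp add: closed_simplex_def vertex_point_def)
  ultimately show ?thesis
    by (simp add: realization_set_def subset_singleton_iff) blast
qed

lemma bouquet_cases:
  assumes "G \<in> bouquet d N" "G \<noteq> bouquet_base"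
  obtains i where "i < N" "G i \<noteq> base_pt" "G i \<in> std_sphere d" "G = (\<lambda>j. if j = i then G i else base_pt)"
proof -
  obtain i where i: "G i \<noteq> base_pt"
    using assms(2) by (auto simp: bouquet_base_def)
  have G: "G i \<in> std_sphere d" "N \<le> j \<Longrightarrow> G j = base_pt" "j \<noteq> i \<Longrightarrow> G j = base_pt \<or> G i = base_pt" for j
    using assms(1) unfolding bouquet_def by blast+
  have "i < N"
    using G(2)[of i] i by (meson not_less)
  moreover have "G = (\<lambda>j. if j = i then G i else base_pt)"
    by (rule ext) (use G(3) i in \<open>simp split: if_split\<close>)
  ultimately show thesis
    by (rule that[OF _ i G(1)])
qed

text \<open>The contraction of \<open>K - C\<close>, extended to \<open>K\<close> as a homotopy, is
  what \<open>pointed_heq_quotient\<close> asks for. The collapsing map sends the facet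
  \<open>e i\<close> to the \<open>i\<close>-th sphere by \<open>simplex_sphere\<close>.\<close>

lemma pointed_heq_contractible_union_simplices:
  assumes K: "abstract_complex K" and C: "finite C" "C \<subseteq> K" "card C = N" "\<And>\<sigma>. \<sigma> \<in> C \<Longrightarrow> card \<sigma> = Suc d"
    and dim: "\<And>\<sigma>. \<sigma> \<in> K \<Longrightarrow> card \<sigma> \<le> Suc d"
    and w: "{w} \<in> K - C"
    and contr: "pointed_heq (realization_set (K - C)) (vertex_point w) {vertex_point w} (vertex_point w)"
  shows "pointed_heq (realization_set K) (vertex_point w) (bouquet d N) bouquet_base"
proof -
  have maximal: "\<tau> = \<sigma>" if "\<sigma> \<in> C" "\<tau> \<in> K" "\<sigma> \<subseteq> \<tau>" for \<sigma> \<tau>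
    using card_seteq[OF abstract_complexD(2)[OF K that(2)] that(3)] C(4)[OF that(1)] dim[OF that(2)] by simp
  let ?L = "K - C" and ?X = "realization_set K" and ?w = "vertex_point w"
  let ?A = "realization_set ?L"
  have L: "abstract_complex ?L"
    by (rule abstract_complex_up_removal[OF K]) (use maximal in blast)
  have AX: "?A \<subseteq> ?X"
    by (auto simp: realization_set_def)
  have wA: "?w \<in> ?A"
    by (rule vertex_point_in_realization_set[OF w])
  obtain f g where fg: "f \<in> ?A \<rightarrow> {?w}" "g ?w = ?w" and hom: "homotopic_with_canon (\<lambda>k. k ?w = ?w) ?A ?A (g \<circ> f) id"
    using contr unfolding pointed_heq_def by blast
  from hom have "homotopic_with_canon (\<lambda>k. k ?w = ?w) ?A ?A id (g \<circ> f)"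
    by (simp add: homotopic_with_sym)
  then obtain c where c: "continuous_on ({0..1::real} \<times> ?A) c" "c \<in> {0..1} \<times> ?A \<rightarrow> ?A"
    "\<And>x. c (0, x) = id x" "\<And>x. c (1, x) = (g \<circ> f) x" "\<And>t. t \<in> {0..1} \<Longrightarrow> c (t, ?w) = ?w"
    by (rule homotopic_with_pointE) (rule that)
  have "\<exists>k. continuous_on ({0..1} \<times> ?X) k \<and> k \<in> {0..1} \<times> ?X \<rightarrow> ?X \<and>
    (\<forall>x\<in>?X. k (0, x) = x) \<and> (\<forall>t. \<forall>y\<in>?A. k (t, y) = c (t, y))"
    by (rule homotopy_extension_cells[OF C(1,2) K]) (use maximal c AX in auto)
  then obtain k where k: "continuous_on ({0..1} \<times> ?X) k" "k \<in> {0..1} \<times> ?X \<rightarrow> ?X"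
    "\<And>x. x \<in> ?X \<Longrightarrow> k (0, x) = x" "\<And>t y. y \<in> ?A \<Longrightarrow> k (t, y) = c (t, y)"
    by blast
  obtain e where e: "bij_betw e {..<N} C"
    using ex_bij_betw_nat_finite[OF C(1)] C(3) by (auto simp: atLeast0LessThan)
  have "\<exists>v. bij_betw v {..d} (e i)" if "i < N" for i
  proof -
    have "e i \<in> C"
      using e that by (auto simp: bij_betw_def)
    then have "finite (e i)" "card (e i) = card {..d}"
      using abstract_complexD(2)[OF K] C(2,4) by auto
    then show ?thesis
      using finite_same_card_bij[of "{..d}" "e i"] by simp
  qed
  then obtain v where v: "\<And>i. i < N \<Longrightarrow> bij_betw (v i) {..d} (e i)"
    by metis
  define y where "y i x = (\<lambda>j. x (v i j))" for i and x :: "'a \<Rightarrow> real"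
  \<comment> \<open>Outside the open simplex of \<open>e i\<close> some coordinate on
    \<open>e i\<close> is 0, so one formula gives the base point there.\<close>
  define h where "h x = (\<lambda>i. if i < N then simplex_sphere d (y i x) else base_pt)" for x :: "'a \<Rightarrow> real"
  have eC: "e i \<in> C" if "i < N" for i
    using e that by (auto simp: bij_betw_def)
  have fin_e: "finite (e i)" "e i \<noteq> {}" if "i < N" for i
    using abstract_complexD(2,3)[OF K] eC[OF that] C(2) by auto
  have im: "y i x ` {..d} = x ` e i" if "i < N" for i x
    using v[OF that] unfolding y_def by (metis bij_betw_imp_surj_on image_image)
  have sum_y: "sum (y i x) {..d} = sum x (e i)" if "i < N" for i x
    unfolding y_def by (rule sum.reindex_bij_betw[OF v[OF that]])
  have Min_pos: "Min (y i x ` {..d}) = 0 \<or> support x = e i \<and> 0 < Min (y i x ` {..d}) \<and> sum (y i x) {..d} = 1"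
    if i: "i < N" and x: "x \<in> ?X" for i x
  proof (cases "e i \<subseteq> support x")
    case True
    then have "support x = e i"
      using maximal[OF eC[OF i] realization_setD(1)[OF K x]] by simp
    moreover have "0 < Min (y i x ` {..d})"
      unfolding im[OF i] Min_image_pos_iff(1)[OF fin_e[OF i] realization_setD(4)[OF K x]] by (rule True)
    moreover have "sum x (support x) = 1"
      using realization_setD(2)[OF K x] by (simp add: closed_simplex_def)
    ultimately show ?thesis
      using sum_y[OF i] by simp
  next
    case False
    then have "Min (y i x ` {..d}) = 0"
      unfolding im[OF i] Min_image_pos_iff(3)[OF fin_e[OF i] realization_setD(4)[OF K x]] .
    then show ?thesis ..
  qed
  have hA: "h x = bouquet_base" if x: "x \<in> ?A" for x
  proof -
    have "support x \<in> ?L"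
      by (rule realization_setD(1)[OF L x])
    then have "Min (y i x ` {..d}) = 0" if "i < N" for i
      using Min_pos[OF that subsetD[OF AX x]] eC[OF that] by (metis DiffD2)
    then show ?thesis
      by (auto simp: h_def bouquet_base_def simplex_sphere_Min_0)
  qed
  have h_base: "x \<in> ?A" if x: "x \<in> ?X" and hx: "h x = bouquet_base" for x
  proof (rule ccontr)
    assume "x \<notin> ?A"
    then have "support x \<in> C"
      using realization_set_support_iff[OF K x _ L] realization_setD(1)[OF K x] by auto
    then obtain i where i: "i < N" "support x = e i"
      using e by (auto simp: bij_betw_def)
    have "Min (y i x ` {..d}) \<noteq> 0"
      unfolding im[OF i(1)] Min_image_pos_iff(3)[OF fin_e[OF i(1)] realization_setD(4)[OF K x]] i(2) by simp
    then have "h x i \<noteq> base_pt"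
      using i simplex_sphere_less_1(2) by (simp add: h_def)
    then show False
      using hx by (simp add: bouquet_base_def)
  qed
  have h_in: "h x \<in> bouquet d N" if x: "x \<in> ?X" for x
  proof -
    have "h x i \<in> std_sphere d" for i
      using Min_pos[OF _ x, of i] simplex_sphere_in_std_sphere[of "y i x" d] base_pt_in_std_sphere[of d]
      unfolding h_def by metis
    moreover have "h x i = base_pt \<or> h x j = base_pt" if "i \<noteq> j" for i j
    proof (rule ccontr)
      assume n: "\<not> (h x i = base_pt \<or> h x j = base_pt)"
      then have ij: "i < N" "j < N"
        by (auto simp: h_def split: if_splits)
      have "support x = e i" "support x = e j"
        using Min_pos[OF ij(1) x] Min_pos[OF ij(2) x] n ij simplex_sphere_Min_0 unfolding h_def by metis+
      then show False
        using e ij that by (auto simp: bij_betw_def inj_on_def)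
    qed
    moreover have "h x i = base_pt" if "N \<le> i" for i
      using that by (simp add: h_def)
    ultimately show ?thesis
      by (simp add: bouquet_def)
  qed
  have h_surj: "G \<in> h ` ?X" if G: "G \<in> bouquet d N" for G
  proof (cases "G = bouquet_base")
    case True
    then show ?thesis
      using hA[OF wA] wA AX by force
  next
    case False
    then obtain i where i: "i < N" "G i \<noteq> base_pt" "G i \<in> std_sphere d"
      and Gi: "G = (\<lambda>j. if j = i then G i else base_pt)"
      using bouquet_cases[OF G] by blast
    obtain z where z: "0 < Min (z ` {..d})" "\<And>j. j \<le> d \<Longrightarrow> 0 \<le> z j" "sum z {..d} = 1" "simplex_sphere d z = G i"
      using simplex_sphere_surj[OF i(3,2)] by blast
    define x where "x u = (if u \<in> e i then z (the_inv_into {..d} (v i) u) else 0)" for u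
    have vi: "v i j \<in> e i" "the_inv_into {..d} (v i) (v i j) = j" if "j \<le> d" for j
      using v[OF i(1)] that by (auto simp: bij_betw_def the_inv_into_f_f)
    have y_eq: "y i x j = z j" if "j \<le> d" for j
      using vi[OF that] by (simp add: y_def x_def)
    have im_eq: "y i x ` {..d} = z ` {..d}"
      by (intro image_cong refl y_eq) simp
    have "sum x (e i) = 1"
      unfolding sum_y[OF i(1), symmetric] z(3)[symmetric] by (intro sum.cong refl y_eq) simp
    moreover have "the_inv_into {..d} (v i) u \<in> {..d}" if "u \<in> e i" for u
      using v[OF i(1)] that by (metis bij_betw_def the_inv_into_into order_refl)
    then have "0 \<le> x u" for u
      using z(2) by (simp add: x_def)
    ultimately have "x \<in> closed_simplex (e i)"
      by (simp add: closed_simplex_def x_def)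
    then have x: "x \<in> ?X"
      using eC[OF i(1)] C(2) realization_setI by blast
    \<comment> \<open>\<open>y i x\<close> is known to agree with \<open>z\<close> only on
      \<open>{..d}\<close>; \<open>simplex_den\<close> and \<open>simplex_sphere\<close> look at no
      other entries.\<close>
    have "simplex_den d (y i x) = simplex_den d z"
      unfolding simplex_den_def im_eq
      by (intro arg_cong2[where f = "(+)"] arg_cong[where f = "\<lambda>t. (1 - t)\<^sup>2"] sum.cong refl) (simp_all add: y_eq)
    then have "simplex_sphere d (y i x) = simplex_sphere d z"
      unfolding simplex_sphere_def im_eq by (auto simp: y_eq)
    then have hi: "h x i = G i"
      using i(1) z(4) by (simp add: h_def)
    have "h x j = G j" for j
    proof (cases "j = i")
      case False
      then have "h x j = base_pt"
        using h_in[OF x] hi i(2) unfolding bouquet_def by (metis (mono_tags, lifting) mem_Collect_eq)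
      moreover have "G j = base_pt"
        using Gi False by metis
      ultimately show ?thesis by simp
    qed (use hi in simp)
    then show ?thesis
      using x by (intro image_eqI[of _ _ x]) auto
  qed
  have h_inj: "x = x' \<or> x \<in> ?A \<and> x' \<in> ?A" if x: "x \<in> ?X" "x' \<in> ?X" and eq: "h x = h x'" for x x'
  proof (cases "h x = bouquet_base")
    case True
    then show ?thesis
      using h_base x eq by auto
  next
    case False
    then obtain i where i: "i < N" "h x i \<noteq> base_pt"
      using bouquet_cases[OF h_in[OF x(1)]] by blast
    have ne: "Min (y i x ` {..d}) \<noteq> 0" "Min (y i x' ` {..d}) \<noteq> 0"
      using i fun_cong[OF eq, of i] simplex_sphere_Min_0[of "y i x" d] simplex_sphere_Min_0[of "y i x'" d]
      unfolding h_def by metis+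
    have x1: "support x = e i" "0 < Min (y i x ` {..d})" "sum (y i x) {..d} = 1"
      using Min_pos[OF i(1) x(1)] ne(1) by blast+
    have x2: "support x' = e i" "0 < Min (y i x' ` {..d})" "sum (y i x') {..d} = 1"
      using Min_pos[OF i(1) x(2)] ne(2) by blast+
    have "simplex_sphere d (y i x) = simplex_sphere d (y i x')"
      using fun_cong[OF eq, of i] i(1) by (simp add: h_def)
    then have yy: "y i x j = y i x' j" if "j \<le> d" for j
      using simplex_sphere_inj[OF x1(2) x2(2) x1(3) x2(3)] that by blast
    have "x u = x' u" for u
    proof (cases "u \<in> e i")
      case True
      then obtain j where "j \<le> d" "u = v i j"
        using v[OF i(1)] by (auto simp: bij_betw_def)
      then show ?thesis
        using yy[of j] by (simp add: y_def)
    next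
      case False
      then have "u \<notin> support x" "u \<notin> support x'"
        using x1(1) x2(1) by auto
      then show ?thesis
        by (simp add: support_def)
    qed
    then show ?thesis by blast
  qed
  show ?thesis
  proof (rule pointed_heq_quotient[where A = ?A and h = h and k = k])
    show "compact ?X"
      by (rule compact_realization_set[OF K])
    show "continuous_on ?X h"
    proof (rule continuous_on_coordinatewise_then_product)
      fix i
      show "continuous_on ?X (\<lambda>x. h x i)"
      proof (cases "i < N")
        case True
        have "continuous_on ?X (\<lambda>x. y i x j)" for j
          unfolding y_def by (rule continuous_on_product_then_coordinatewise[OF continuous_on_id])
        then show ?thesis
          using True by (simp add: h_def continuous_on_simplex_sphere)
      next
        case False
        then show ?thesis
          by (simp add: h_def)
      qed
    qed
    show "h ` ?X = bouquet d N"
      using h_in h_surj by blast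
    show "k (t, x) \<in> ?A" if "t \<in> {0..1}" "x \<in> ?A" for t x
      using k(4)[OF that(2)] c(2) that by auto
    show "k (1, x) = ?w" if "x \<in> ?A" for x
      using k(4)[OF that] c(4)[of x] funcset_mem[OF fg(1) that] fg(2) by simp
    show "k (t, ?w) = ?w" if "t \<in> {0..1}" for t
      using k(4)[OF wA] c(5)[OF that] by simp
  qed (use k(1-3) AX wA hA h_inj in \<open>blast+\<close>)
qed

lemma reduces_abstract_complex:
  assumes "reduces d K N K'" "abstract_complex K"
  shows "abstract_complex K'"
  using assms
proof (induction rule: reduces.induct)
  case (stop K)
  then show ?case .
next
  case (collapse \<sigma> K v N K')
  have "abstract_complex (K - {\<sigma>, insert v \<sigma>})"
    by (rule abstract_complex_collapse; (fact collapse.prems collapse.hyps(1) | erule (1) collapse.hyps(4)))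
  then show ?case
    by (rule collapse.IH)
next
  case (critical \<sigma> K N K')
  have "abstract_complex (K - {\<sigma>})"
    by (rule abstract_complex_up_removal[OF critical.prems]) (use critical.hyps(3) in blast)
  then show ?case
    by (rule critical.IH)
qed

lemma pointed_heq_bouquet:
  assumes K: "abstract_complex K" and red: "reduces d K N {{w}}"
  shows "pointed_heq (realization_set K) (vertex_point w) (bouquet d N) bouquet_base"
proof -
  obtain K' C where K': "reduces d K 0 K'" "C \<subseteq> K'" "card C = N" "finite C" "\<forall>\<sigma>\<in>C. card \<sigma> = Suc d"
    "\<forall>\<sigma>\<in>K'. card \<sigma> \<le> Suc d" "reduces d (K' - C) 0 {{w}}"
    using reduces_reorder[OF red refl abstract_complexD(2)[OF K]] by blast
  have scK': "abstract_complex K'"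
    by (rule reduces_abstract_complex[OF K'(1) K])
  have "\<tau> = \<sigma>" if "\<sigma> \<in> C" "\<tau> \<in> K'" "\<sigma> \<subseteq> \<tau>" for \<sigma> \<tau>
    using card_seteq[OF abstract_complexD(2)[OF scK' that(2)] that(3)] K'(5,6) that by auto
  then have L: "abstract_complex (K' - C)"
    by (intro abstract_complex_up_removal[OF scK']) blast
  have w: "{w} \<in> K' - C"
    using reduces_subset[OF K'(7)] by auto
  have "pointed_heq (realization_set K) (vertex_point w) (realization_set K') (vertex_point w)"
    by (rule pointed_heq_reduces[OF K'(1) refl K]) (use w in blast)
  moreover have "pointed_heq (realization_set (K' - C)) (vertex_point w) {vertex_point w} (vertex_point w)"
    using pointed_heq_reduces[OF K'(7) refl L, of w] by (simp add: realization_set_singleton)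
  then have "pointed_heq (realization_set K') (vertex_point w) (bouquet d N) bouquet_base"
    by (intro pointed_heq_contractible_union_simplices[OF scK' K'(4,2,3)] w) (use K'(5,6) in auto)
  ultimately show ?thesis
    by (rule pointed_heq_trans)
qed

section \<open>Wedge sums inside products\<close>

lemma continuous_map_from_final_topology:
  assumes "continuous_map X Z (g \<circ> f)" "f ` topspace X \<subseteq> S" "g \<in> S \<rightarrow> topspace Z"
  shows "continuous_map (final_topology S X f) Z g"
  unfolding continuous_map_def topspace_final_topology[OF assms(2)] openin_final_topology
proof (intro conjI allI impI)
  show "g \<in> S \<rightarrow> topspace Z"
    by (rule assms(3))
  fix U assume "openin Z U"
  then have "openin X {x \<in> topspace X. (g \<circ> f) x \<in> U}"
    using assms(1) by (simp add: continuous_map_def)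
  moreover have "{x \<in> topspace X. f x \<in> {y \<in> S. g y \<in> U}} = {x \<in> topspace X. (g \<circ> f) x \<in> U}"
    using assms(2) by auto
  ultimately show "openin X {x \<in> topspace X. f x \<in> {y \<in> S. g y \<in> U}}"
    by simp
qed auto

lemma continuous_map_into_final_topology:
  assumes "f ` topspace X \<subseteq> S"
  shows "continuous_map X (final_topology S X f) f"
  using assms unfolding continuous_map_def topspace_final_topology[OF assms] openin_final_topology by auto

lemma continuous_map_from_sum_topology:
  assumes "\<And>i. i \<in> I \<Longrightarrow> continuous_map (X i) Z (\<lambda>x. h (i, x))"
  shows "continuous_map (sum_topology X I) Z h"
  unfolding continuous_map_def
proof (intro conjI allI impI)
  show "h \<in> topspace (sum_topology X I) \<rightarrow> topspace Z"
  proof (rule funcsetI)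
    fix z assume "z \<in> topspace (sum_topology X I)"
    then obtain i x where z: "z = (i, x)" "i \<in> I" "x \<in> topspace (X i)"
      by auto
    then show "h z \<in> topspace Z"
      using assms[OF z(2)] unfolding continuous_map_def Pi_iff by blast
  qed
  fix U assume "openin Z U"
  then have "openin (X i) {x \<in> topspace (X i). h (i, x) \<in> U}" if "i \<in> I" for i
    using assms[OF that] by (auto simp: continuous_map_def)
  moreover have "{x. (i, x) \<in> {z \<in> topspace (sum_topology X I). h z \<in> U}} = {x \<in> topspace (X i). h (i, x) \<in> U}" if "i \<in> I" for i
    using that by auto
  ultimately show "openin (sum_topology X I) {z \<in> topspace (sum_topology X I). h z \<in> U}"
    unfolding openin_sum_topology by auto
qed

lemma compact_space_sum_topology:
  assumes "finite I" "\<And>i. i \<in> I \<Longrightarrow> compact_space (X i)"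
  shows "compact_space (sum_topology X I)"
proof -
  have "compactin (sum_topology X I) (Pair i ` topspace (X i))" if "i \<in> I" for i
    using assms(2)[OF that] continuous_map_component_injection[OF that, of X]
    by (intro image_compactin) (auto simp: compact_space_def)
  then have "compactin (sum_topology X I) (\<Union>i\<in>I. Pair i ` topspace (X i))"
    using assms(1) by (intro compactin_Union) auto
  moreover have "(\<Union>i\<in>I. Pair i ` topspace (X i)) = topspace (sum_topology X I)"
    by auto
  ultimately show ?thesis
    by (simp add: compact_space_def)
qed

text \<open>The finitely many points outside the image are there for \<open>None\<close>, which is
  not hit when the wedge has no summands.\<close>

lemma compact_space_final_topology:
  assumes "compact_space X" "f ` topspace X \<subseteq> S" "finite (S - f ` topspace X)"
  shows "compact_space (final_topology S X f)"
proof -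
  let ?F = "final_topology S X f"
  have "compactin ?F (f ` topspace X)"
    using assms(1) continuous_map_into_final_topology[OF assms(2)] by (intro image_compactin) (auto simp: compact_space_def)
  moreover have "compactin ?F (S - f ` topspace X)"
    using assms(3) by (intro finite_imp_compactin) (auto simp: topspace_final_topology[OF assms(2)])
  ultimately have "compactin ?F (f ` topspace X \<union> (S - f ` topspace X))"
    by (rule compactin_Un)
  moreover have "f ` topspace X \<union> (S - f ` topspace X) = S"
    using assms(2) by blast
  ultimately show ?thesis
    by (simp add: compact_space_def topspace_final_topology[OF assms(2)])
qed

lemma continuous_map_from_disjoint_union:
  assumes "continuous_map X Z (h \<circ> Inl)" "continuous_map Y Z (h \<circ> Inr)"
  shows "continuous_map (disjoint_union X Y) Z h"
  unfolding continuous_map_def topspace_disjoint_union openin_disjoint_union_iff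
proof (intro conjI allI impI)
  show "h \<in> topspace X <+> topspace Y \<rightarrow> topspace Z"
    using assms by (auto simp: continuous_map_def)
  fix U assume U: "openin Z U"
  have "Inl -` {x \<in> topspace X <+> topspace Y. h x \<in> U} = {x \<in> topspace X. (h \<circ> Inl) x \<in> U}"
    "Inr -` {x \<in> topspace X <+> topspace Y. h x \<in> U} = {x \<in> topspace Y. (h \<circ> Inr) x \<in> U}"
    by auto
  then show "openin X (Inl -` {x \<in> topspace X <+> topspace Y. h x \<in> U})"
    "openin Y (Inr -` {x \<in> topspace X <+> topspace Y. h x \<in> U})"
    using assms U by (simp_all add: continuous_map_def)
qed

lemma compact_space_disjoint_union:
  assumes "compact_space X" "compact_space Y"
  shows "compact_space (disjoint_union X Y)"
proof -
  have "continuous_map X (disjoint_union X Y) Inl" "continuous_map Y (disjoint_union X Y) Inr"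
    unfolding continuous_map_def topspace_disjoint_union openin_disjoint_union_iff
    by (auto simp: vimage_def openin_subset Collect_conj_eq)
  then have "compactin (disjoint_union X Y) (Inl ` topspace X)" "compactin (disjoint_union X Y) (Inr ` topspace Y)"
    using assms by (auto intro!: image_compactin simp: compact_space_def)
  then have "compactin (disjoint_union X Y) (Inl ` topspace X \<union> Inr ` topspace Y)"
    by (rule compactin_Un)
  then show ?thesis
    by (simp add: compact_space_def topspace_disjoint_union Plus_def)
qed

lemma Hausdorff_space_fun: "Hausdorff_space (euclidean :: ('a \<Rightarrow> 'b::metric_space) topology)"
  by (metis Hausdorff_space_euclidean Hausdorff_space_product_topology euclidean_product_topology)

lemma compact_std_sphere: "compact (std_sphere d)"
proof -
  let ?B = "PiE UNIV (\<lambda>_. {-1..1::real}) :: (nat \<Rightarrow> real) set"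
  have "compactin (product_topology (\<lambda>_. euclidean) UNIV) ?B"
    by (simp add: compactin_PiE)
  then have "compact ?B"
    by (simp add: euclidean_product_topology)
  moreover have "closed (std_sphere d)"
  proof -
    have eq: "std_sphere d = {x. (\<Sum>i\<le>d. (x i)\<^sup>2) = 1} \<inter> (\<Inter>i\<in>{d<..}. {x. x i = 0})"
      by (auto simp: std_sphere_def)
    show ?thesis
      unfolding eq by (intro closed_Int closed_INT closed_Collect_eq ballI continuous_intros) simp_all
  qed
  moreover have "std_sphere d \<subseteq> ?B"
  proof
    fix x assume x: "x \<in> std_sphere d"
    have "x i \<in> {-1..1}" for i
    proof (cases "i \<le> d")
      case True
      then have "(x i)\<^sup>2 \<le> (\<Sum>i\<le>d. (x i)\<^sup>2)"
        by (intro member_le_sum) auto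
      then have "\<bar>x i\<bar> \<le> 1"
        using x by (simp add: std_sphere_def abs_square_le_1)
      then show ?thesis by auto
    next
      case False
      then show ?thesis
        using x by (simp add: std_sphere_def)
    qed
    then show "x \<in> ?B"
      by (simp add: PiE_iff)
  qed
  ultimately show ?thesis
    by (metis compact_Int_closed inf.absorb_iff2)
qed

definition bouquet_map :: "(nat \<times> (nat \<Rightarrow> real)) option \<Rightarrow> nat \<Rightarrow> nat \<Rightarrow> real" where
  "bouquet_map z = (case z of None \<Rightarrow> bouquet_base | Some (i, x) \<Rightarrow> (\<lambda>j. if j = i then x else base_pt))"

text \<open>The map is a continuous bijection from a compact space onto a Hausdorff space; its
  inverse reads off the single coordinate different from \<open>base_pt\<close>.\<close>

lemma homeomorphic_map_sphere_bouquet: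
  "compact_space (sphere_bouquet d k)" (is ?compact)
  "homeomorphic_map (sphere_bouquet d k) (top_of_set (bouquet d k)) bouquet_map" (is ?homeo)
proof -
  let ?c = "wedge_collapse (\<lambda>_ :: nat. base_pt)"
  let ?S = "sum_topology (\<lambda>_. nsphere d) {..<k}"
  let ?T = "insert None (?c ` topspace ?S)"
  have sb: "sphere_bouquet d k = final_topology ?T ?S ?c"
    by (simp add: sphere_bouquet_def wedge_family_def base_pt_def)
  have top: "topspace (sphere_bouquet d k) = ?T"
    unfolding sb by (rule topspace_final_topology) blast
  have topS: "topspace ?S = {..<k} \<times> std_sphere d"
    by (auto simp: nsphere_eq_std_sphere)
  have c_eq: "bouquet_map (?c (i, x)) = (\<lambda>j. if j = i then x else base_pt)" for i x
    by (auto simp: bouquet_map_def wedge_collapse_def bouquet_base_def)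
  have in_b: "(\<lambda>j. if j = i then x else base_pt) \<in> bouquet d k" if "i < k" "x \<in> std_sphere d" for i x
    using that base_pt_in_std_sphere[of d] by (auto simp: bouquet_def)
  have None: "bouquet_map None = bouquet_base"
    by (simp add: bouquet_map_def)
  have "compact_space (nsphere d)"
    by (simp add: nsphere_eq_std_sphere compact_space_subtopology compact_std_sphere)
  then have "compact_space ?S"
    by (intro compact_space_sum_topology) auto
  moreover have "finite (?T - ?c ` topspace ?S)"
    by (rule finite_subset[of _ "{None}"]) blast+
  ultimately show ?compact
    unfolding sb by (intro compact_space_final_topology) blast+
  have im: "bouquet_map ` ?T = bouquet d k"
  proof (rule subset_antisym)
    show "bouquet_map ` ?T \<subseteq> bouquet d k"
      unfolding topS using in_b bouquet_base_in_bouquet[of d k] None c_eq by auto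
    show "bouquet d k \<subseteq> bouquet_map ` ?T"
    proof
      fix G assume G: "G \<in> bouquet d k"
      show "G \<in> bouquet_map ` ?T"
      proof (cases "G = bouquet_base")
        case True
        then show ?thesis
          by (simp add: None)
      next
        case False
        then obtain i where i: "i < k" "G i \<in> std_sphere d" and Gi: "G = (\<lambda>j. if j = i then G i else base_pt)"
          using bouquet_cases[OF G] by blast
        then have "G = bouquet_map (?c (i, G i))"
          using c_eq by simp
        moreover have "?c (i, G i) \<in> ?T"
          unfolding topS using i by blast
        ultimately show ?thesis
          by (rule image_eqI)
      qed
    qed
  qed
  have inj: "inj_on bouquet_map ?T"
  proof -
    have Some_ne: "x \<noteq> base_pt" if "Some (i, x) \<in> ?T" for i x
      using that by (auto simp: wedge_collapse_def split: if_splits)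
    define g where "g G = (if \<exists>i. G i \<noteq> base_pt then Some (THE i. G i \<noteq> base_pt, G (THE i. G i \<noteq> base_pt)) else None)"
      for G :: "nat \<Rightarrow> nat \<Rightarrow> real"
    have gb: "g (bouquet_map z) = z"
      if "z \<in> ?T" for z
    proof (cases z)
      case None
      then show ?thesis
        by (simp add: g_def bouquet_map_def bouquet_base_def)
    next
      case (Some a)
      obtain i x where a: "a = (i, x)"
        by (cases a)
      have "x \<noteq> base_pt"
        using Some_ne that Some a by blast
      moreover have b: "bouquet_map z = (\<lambda>j. if j = i then x else base_pt)"
        by (simp add: Some a bouquet_map_def)
      ultimately have n: "bouquet_map z j \<noteq> base_pt \<longleftrightarrow> j = i" for j
        by simp
      show ?thesis
        unfolding g_def n by (simp add: b) (simp add: Some a)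
    qed
    show ?thesis
      by (rule inj_on_inverseI[where g = g]) (rule gb)
  qed
  have "continuous_map ?S (top_of_set (bouquet d k)) (bouquet_map \<circ> ?c)"
  proof (rule continuous_map_from_sum_topology)
    fix i assume i: "i \<in> {..<k}"
    have "continuous_on (std_sphere d) (\<lambda>x j. if j = i then x else base_pt)"
    proof (rule continuous_on_coordinatewise_then_product)
      show "continuous_on (std_sphere d) (\<lambda>x. if j = i then x else base_pt)" for j
        by (cases "j = i") simp_all
    qed
    then show "continuous_map (nsphere d) (top_of_set (bouquet d k)) (\<lambda>x. (bouquet_map \<circ> ?c) (i, x))"
      using in_b i by (auto simp: nsphere_eq_std_sphere continuous_map_in_subtopology c_eq)
  qed
  then have "continuous_map (sphere_bouquet d k) (top_of_set (bouquet d k)) bouquet_map"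
    unfolding sb using im by (intro continuous_map_from_final_topology) auto
  then show ?homeo
    using \<open>?compact\<close> im inj
    by (intro continuous_imp_homeomorphic_map) (auto simp: top Hausdorff_space_subtopology)
qed

text \<open>The wedge of \<open>(S, s)\<close> and \<open>(T, t)\<close> inside the product.\<close>

definition axes :: "'a set \<Rightarrow> 'a \<Rightarrow> 'b set \<Rightarrow> 'b \<Rightarrow> ('a \<times> 'b) set" where
  "axes S s T t = {(x, y). x \<in> S \<and> y \<in> T \<and> (x = s \<or> y = t)}"

lemma homeomorphic_space_wedge_axes:
  fixes S :: "'b::topological_space set" and T :: "'c::topological_space set"
  assumes X: "compact_space X" and \<theta>: "homeomorphic_map X (top_of_set S) \<theta>" and p: "p \<in> topspace X" "\<theta> p = s"
    and T: "compact T" "t \<in> T"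
    and H: "Hausdorff_space (euclidean :: 'b topology)" "Hausdorff_space (euclidean :: 'c topology)"
  shows "wedge X p (top_of_set T) t homeomorphic_space top_of_set (axes S s T t)"
proof -
  let ?i = "wedge_identify p t"
  let ?DU = "disjoint_union X (top_of_set T)"
  define f where "f z = (case z of Inl x \<Rightarrow> (\<theta> x, t) | Inr y \<Rightarrow> (s, y))" for z
  have cont: "continuous_map X (top_of_set S) \<theta>" and im: "\<theta> ` topspace X = S" and inj: "inj_on \<theta> (topspace X)"
    using \<theta> by (auto simp: homeomorphic_map_def quotient_imp_continuous_map homeomorphic_imp_surjective_map[OF \<theta>, simplified])
  have \<theta>S: "\<theta> x \<in> S" if "x \<in> topspace X" for x
    using im that by blast
  have sS: "s \<in> S"
    using p \<theta>S by blast
  have topW: "topspace (wedge X p (top_of_set T) t) = ?i ` topspace ?DU"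
    unfolding wedge_def by (rule topspace_final_topology) simp
  have fi: "f (?i z) = f z" for z
    using p(2) by (auto simp: f_def wedge_identify_def)
  have "compact_space (wedge X p (top_of_set T) t)"
    unfolding wedge_def using X T(1)
    by (intro compact_space_final_topology compact_space_disjoint_union) (auto simp: compact_space_subtopology)
  moreover have H: "Hausdorff_space (top_of_set (axes S s T t))"
  proof (rule Hausdorff_space_subtopology)
    have "Hausdorff_space (prod_topology (euclidean :: 'b topology) (euclidean :: 'c topology))"
      unfolding Hausdorff_space_prod_topology using H by blast
    then show "Hausdorff_space (euclidean :: ('b \<times> 'c) topology)"
      by simp
  qed
  moreover have im_f: "f ` topspace (wedge X p (top_of_set T) t) = axes S s T t"
  proof -
    have "f ` topspace (wedge X p (top_of_set T) t) = f ` topspace ?DU"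
      unfolding topW image_image fi ..
    also have "\<dots> = (\<lambda>x. (\<theta> x, t)) ` topspace X \<union> (\<lambda>y. (s, y)) ` T"
      by (auto simp: topspace_disjoint_union f_def Plus_def image_Un image_image)
    also have "(\<lambda>x. (\<theta> x, t)) ` topspace X = (\<lambda>x. (x, t)) ` S"
      unfolding im[symmetric] by (simp add: image_image)
    also have "(\<lambda>x. (x, t)) ` S \<union> (\<lambda>y. (s, y)) ` T = axes S s T t"
      using T(2) sS by (auto simp: axes_def)
    finally show ?thesis .
  qed
  moreover have "continuous_map (wedge X p (top_of_set T) t) (top_of_set (axes S s T t)) f"
  proof -
    have "continuous_map X (top_of_set (axes S s T t)) ((f \<circ> ?i) \<circ> Inl)"
    proof -
      have "continuous_map X (prod_topology euclidean euclidean) (\<lambda>x. (\<theta> x, t))"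
        using cont by (intro continuous_map_pairedI) (auto simp: continuous_map_in_subtopology)
      moreover have "(f \<circ> ?i) \<circ> Inl = (\<lambda>x. (\<theta> x, t))"
        unfolding comp_def fi by (simp add: f_def)
      ultimately show ?thesis
        using \<theta>S T(2) by (auto simp: continuous_map_in_subtopology axes_def)
    qed
    moreover have "continuous_map (top_of_set T) (top_of_set (axes S s T t)) ((f \<circ> ?i) \<circ> Inr)"
    proof -
      have "continuous_on T (\<lambda>y. (s, y))"
        by (intro continuous_intros)
      moreover have "(f \<circ> ?i) \<circ> Inr = (\<lambda>y. (s, y))"
        unfolding comp_def fi by (simp add: f_def)
      ultimately show ?thesis
        using sS by (auto simp: continuous_map_in_subtopology axes_def)
    qed
    ultimately have "continuous_map ?DU (top_of_set (axes S s T t)) (f \<circ> ?i)"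
      by (rule continuous_map_from_disjoint_union)
    then show ?thesis
      unfolding wedge_def using im_f unfolding topW
      by (intro continuous_map_from_final_topology) auto
  qed
  moreover have "inj_on f (topspace (wedge X p (top_of_set T) t))"
  proof (rule inj_onI)
    fix z z' assume z: "z \<in> topspace (wedge X p (top_of_set T) t)" "z' \<in> topspace (wedge X p (top_of_set T) t)"
      and eq: "f z = f z'"
    \<comment> \<open>\<open>wedge_identify\<close> replaces \<open>Inr t\<close> by
      \<open>Inl p\<close>, so a remaining \<open>Inr y\<close> has \<open>y \<noteq> t\<close>, and
      \<open>f\<close> cannot confuse it with a point of the first summand.\<close>
    have c: "(\<exists>x\<in>topspace X. z = Inl x) \<or> (\<exists>y. z = Inr y \<and> y \<noteq> t)" 
      if "z \<in> topspace (wedge X p (top_of_set T) t)" for z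
      using that p(1) unfolding topW by (auto simp: topspace_disjoint_union wedge_identify_def split: if_splits)
    have ip: "x = x'" if "\<theta> x = \<theta> x'" "x \<in> topspace X" "x' \<in> topspace X" for x x'
      using inj that by (auto simp: inj_on_def)
    show "z = z'"
      using c[OF z(1)] c[OF z(2)] eq ip by (auto simp: f_def)
  qed
  ultimately have "homeomorphic_map (wedge X p (top_of_set T) t) (top_of_set (axes S s T t)) f"
    by (intro continuous_imp_homeomorphic_map) auto
  then show ?thesis
    by (rule homeomorphic_map_imp_homeomorphic_space)
qed

text \<open>Maps and homotopies act on the second factor alone; they stay in the axes because they
  keep the base point.\<close>

lemma pointed_heq_axes:
  assumes "s \<in> S" "pointed_heq T t T' t'"
  shows "pointed_heq (axes S s T t) (s, t) (axes S s T' t') (s, t')"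
proof -
  obtain f g where fg: "continuous_on T f" "f \<in> T \<rightarrow> T'" "f t = t'" "continuous_on T' g" "g \<in> T' \<rightarrow> T" "g t' = t"
     "homotopic_with_canon (\<lambda>k. k t = t) T T (g \<circ> f) id" "homotopic_with_canon (\<lambda>k. k t' = t') T' T' (f \<circ> g) id"
    and t: "t \<in> T" "t' \<in> T'"
    using assms(2) unfolding pointed_heq_def by blast
  have cont: "continuous_on (axes S s T t) (\<lambda>(x, y). (x, f y))" if "continuous_on T f"
    for T :: "'x::topological_space set" and f :: "'x \<Rightarrow> 'y::topological_space" and t
    unfolding case_prod_unfold
    by (intro continuous_on_Pair continuous_on_fst continuous_on_id
        continuous_on_compose2[OF that continuous_on_snd[OF continuous_on_id]]) (auto simp: axes_def)
  have hom: "homotopic_with_canon (\<lambda>k. k (s, t) = (s, t)) (axes S s T t) (axes S s T t)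
      ((\<lambda>(x, y). (x, g y)) \<circ> (\<lambda>(x, y). (x, f y))) id"
    if h: "homotopic_with_canon (\<lambda>k. k t = t) T T (g \<circ> f) id" and t: "t \<in> T"
    for T :: "'x::topological_space set" and f :: "'x \<Rightarrow> 'y::topological_space" and g t
  proof -
    obtain h where h: "continuous_on ({0..1::real} \<times> T) h" "h \<in> {0..1} \<times> T \<rightarrow> T"
      "\<And>x. h (0, x) = (g \<circ> f) x" "\<And>x. h (1, x) = id x" "\<And>u. u \<in> {0..1} \<Longrightarrow> h (u, t) = t"
      using h by (rule homotopic_with_pointE) (rule that)
    show ?thesis
    proof (rule homotopic_with_pointI)
      show "continuous_on ({0..1} \<times> axes S s T t) (\<lambda>(u, (x, y)). (x, h (u, y)))"
        unfolding case_prod_unfold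
        by (intro continuous_on_Pair continuous_on_fst continuous_on_snd continuous_on_id
            continuous_on_compose2[OF h(1)]) (auto simp: axes_def)
      show "(\<lambda>(u, (x, y)). (x, h (u, y))) \<in> {0..1} \<times> axes S s T t \<rightarrow> axes S s T t"
        using h(2,5) by (auto simp: axes_def)
    qed (use h assms(1) t in \<open>auto simp: axes_def\<close>)
  qed
  show ?thesis
    unfolding pointed_heq_def
  proof (intro conjI exI)
    show "homotopic_with_canon (\<lambda>k. k (s, t) = (s, t)) (axes S s T t) (axes S s T t)
      ((\<lambda>(x, y). (x, g y)) \<circ> (\<lambda>(x, y). (x, f y))) id"
      by (rule hom[OF fg(7) t(1)])
    show "homotopic_with_canon (\<lambda>k. k (s, t') = (s, t')) (axes S s T' t') (axes S s T' t')
      ((\<lambda>(x, y). (x, f y)) \<circ> (\<lambda>(x, y). (x, g y))) id"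
      by (rule hom[OF fg(8) t(2)])
    show "continuous_on (axes S s T t) (\<lambda>(x, y). (x, f y))" "continuous_on (axes S s T' t') (\<lambda>(x, y). (x, g y))"
      by (rule cont, rule fg)+
  qed (use fg assms(1) t in \<open>auto simp: axes_def\<close>)
qed

lemma homeomorphic_space_axes_bouquet:
  "top_of_set (axes (bouquet d a) bouquet_base (bouquet d b) bouquet_base) homeomorphic_space top_of_set (bouquet d (a + b))"
  (is "top_of_set ?A homeomorphic_space top_of_set ?B")
proof -
  define f where "f = (\<lambda>(G, H) i. if i < a then G i else H (i - a) :: nat \<Rightarrow> real)"
  define g where "g G = (\<lambda>i. if i < a then G i else base_pt, \<lambda>i. G (i + a))" for G :: "nat \<Rightarrow> nat \<Rightarrow> real"
  have bD: "G i \<in> std_sphere d" "N \<le> i \<Longrightarrow> G i = base_pt" "i \<noteq> j \<Longrightarrow> G i = base_pt \<or> G j = base_pt"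
    if "G \<in> bouquet d N" for G N i j
    using that unfolding bouquet_def by blast+
  have bI: "G \<in> bouquet d N" if "\<And>i. G i \<in> std_sphere d" "\<And>i. N \<le> i \<Longrightarrow> G i = base_pt"
    "\<And>i j. i \<noteq> j \<Longrightarrow> G i = base_pt \<or> G j = base_pt" for G N
    using that unfolding bouquet_def by blast
  have base: "bouquet_base i = base_pt" for i
    by (simp add: bouquet_base_def)
  have coord: "continuous_on A (\<lambda>z. F z i j)" if "continuous_on A F" for A :: "'z::topological_space set"
    and F :: "'z \<Rightarrow> nat \<Rightarrow> nat \<Rightarrow> real" and i j
    by (rule continuous_on_product_then_coordinatewise[OF continuous_on_product_then_coordinatewise[OF that]])
  have fst: "continuous_on A fst" and snd: "continuous_on A snd" for A :: "((nat \<Rightarrow> nat \<Rightarrow> real) \<times> (nat \<Rightarrow> nat \<Rightarrow> real)) set"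
    by (rule continuous_on_fst[OF continuous_on_id] continuous_on_snd[OF continuous_on_id])+
  have "homeomorphic_maps (top_of_set ?A) (top_of_set ?B) f g"
    unfolding homeomorphic_maps_def
  proof (intro conjI)
    show "continuous_map (top_of_set ?A) (top_of_set ?B) f"
      unfolding continuous_map_in_subtopology
    proof (intro conjI)
      have "continuous_on ?A f"
        unfolding f_def case_prod_unfold
      proof (intro continuous_on_coordinatewise_then_product)
        show "continuous_on ?A (\<lambda>z. (if i < a then fst z i else snd z (i - a)) j)" for i j
          by (cases "i < a") (simp_all add: coord[OF fst] coord[OF snd])
      qed
      then show "continuous_map (top_of_set ?A) euclidean f"
        by simp
      have "f (G, H) \<in> ?B" if "G \<in> bouquet d a" "H \<in> bouquet d b" "G = bouquet_base \<or> H = bouquet_base" for G H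
      proof (rule bI)
        show "f (G, H) i \<in> std_sphere d" for i
          using bD(1)[OF that(1)] bD(1)[OF that(2)] by (simp add: f_def)
        show "f (G, H) i = base_pt" if "a + b \<le> i" for i
          using that bD(2)[OF \<open>H \<in> bouquet d b\<close>, of "i - a"] by (simp add: f_def)
        show "f (G, H) i = base_pt \<or> f (G, H) j = base_pt" if "i \<noteq> j" for i j
        proof -
          \<comment> \<open>For indices from \<open>a\<close> on the truncated subtraction is
            injective.\<close>
          have "i - a \<noteq> j - a \<or> i < a \<or> j < a"
            using that by linarith
          then show ?thesis
            using bD(3)[OF \<open>G \<in> bouquet d a\<close>, of i j] bD(3)[OF \<open>H \<in> bouquet d b\<close>, of "i - a" "j - a"] that
              \<open>G = bouquet_base \<or> H = bouquet_base\<close> base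
            by (auto simp: f_def)
        qed
      qed
      then show "f \<in> topspace (top_of_set ?A) \<rightarrow> ?B"
        by (auto simp: axes_def)
    qed
    show "continuous_map (top_of_set ?B) (top_of_set ?A) g"
      unfolding continuous_map_in_subtopology
    proof (intro conjI)
      have "continuous_on ?B g"
        unfolding g_def
      proof (intro continuous_on_Pair continuous_on_coordinatewise_then_product)
        show "continuous_on ?B (\<lambda>G. (if i < a then G i else base_pt) j)" for i j
          by (cases "i < a") (simp_all add: coord[OF continuous_on_id])
        show "continuous_on ?B (\<lambda>G. G (i + a) j)" for i j
          by (rule coord[OF continuous_on_id])
      qed
      then show "continuous_map (top_of_set ?B) euclidean g"
        by simp
      have "g G \<in> ?A" if G: "G \<in> ?B" for G
      proof -
        have "(\<lambda>i. if i < a then G i else base_pt) \<in> bouquet d a"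
          by (rule bI) (use bD[OF G] base_pt_in_std_sphere[of d] in auto)
        moreover have "(\<lambda>i. G (i + a)) \<in> bouquet d b"
          by (rule bI) (use bD[OF G] in auto)
        moreover have "(\<lambda>i. if i < a then G i else base_pt) = bouquet_base \<or> (\<lambda>i. G (i + a)) = bouquet_base"
        proof (rule ccontr)
          assume n: "\<not> ?thesis"
          then obtain i where i: "i < a" "G i \<noteq> base_pt"
            by (auto simp: fun_eq_iff[of _ bouquet_base] base split: if_splits)
          from n obtain j where "G (j + a) \<noteq> base_pt"
            by (auto simp: fun_eq_iff[of _ bouquet_base] base)
          then show False
            using bD(3)[OF G, of i "j + a"] i by auto
        qed
        ultimately show ?thesis
          by (auto simp: axes_def g_def)
      qed
      then show "g \<in> topspace (top_of_set ?B) \<rightarrow> ?A"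
        by auto
    qed
    show "\<forall>x\<in>topspace (top_of_set ?A). g (f x) = x"
    proof clarsimp
      fix G H assume "(G, H) \<in> ?A"
      then have "G i = base_pt" if "a \<le> i" for i
        using bD(2)[of G a i] that by (auto simp: axes_def)
      then show "g (f (G, H)) = (G, H)"
        by (auto simp: f_def g_def)
    qed
    show "\<forall>y\<in>topspace (top_of_set ?B). f (g y) = y"
      by (auto simp: f_def g_def)
  qed
  then show ?thesis
    by (rule homeomorphic_maps_imp_homeomorphic_space)
qed

section \<open>Moving the base point\<close>

text \<open>\<open>sphere_fold\<close> doubles the angular distance to the antipode of the base point, crushing the
  hemisphere \<open>0 \<le> x 0\<close> to the base point. The straight line from \<open>x\<close> to \<open>sphere_fold x\<close> avoids
  the origin, because the inner product of the two points is \<open>\<bar>x 0\<bar>\<close>; \<open>sphere_push\<close> normalizes it.\<close>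

definition sphere_fold :: "(nat \<Rightarrow> real) \<Rightarrow> nat \<Rightarrow> real" where
  "sphere_fold x = (\<lambda>j. if j = 0 then 1 - 2 * (min (x 0) 0)\<^sup>2 else - 2 * min (x 0) 0 * x j)"

definition sphere_push :: "real \<Rightarrow> (nat \<Rightarrow> real) \<Rightarrow> nat \<Rightarrow> real" where
  "sphere_push t x = (\<lambda>j. ((1 - t) * x j + t * sphere_fold x j) /
     sqrt ((1 - t)\<^sup>2 + t\<^sup>2 + 2 * t * (1 - t) * \<bar>x 0\<bar>))"

lemma sum_upto_remove_0: "(\<Sum>i\<le>d. f i) = f 0 + (\<Sum>i\<in>{..d} - {0}. f i)" for f :: "nat \<Rightarrow> real"
  by (simp add: sum.remove[of "{..d}" 0])

lemma sphere_fold_facts: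
  assumes "x \<in> std_sphere d"
  shows "(\<Sum>i\<le>d. (sphere_fold x i)\<^sup>2) = 1" "(\<Sum>i\<le>d. x i * sphere_fold x i) = \<bar>x 0\<bar>"
    "0 \<le> x 0 \<Longrightarrow> sphere_fold x = base_pt"
proof -
  let ?n = "min (x 0) 0"
  have S: "(\<Sum>i\<in>{..d} - {0}. (x i)\<^sup>2) = 1 - (x 0)\<^sup>2"
    using assms sum_upto_remove_0[of "\<lambda>i. (x i)\<^sup>2" d] by (simp add: std_sphere_def)
  have "(\<Sum>i\<in>{..d} - {0}. (sphere_fold x i)\<^sup>2) = (\<Sum>i\<in>{..d} - {0}. 4 * ?n\<^sup>2 * (x i)\<^sup>2)"
    by (intro sum.cong refl) (simp add: sphere_fold_def power_mult_distrib)
  also have "\<dots> = 4 * ?n\<^sup>2 * (1 - (x 0)\<^sup>2)"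
    by (simp add: sum_distrib_left[symmetric] S)
  finally show "(\<Sum>i\<le>d. (sphere_fold x i)\<^sup>2) = 1"
    unfolding sum_upto_remove_0 by (cases "x 0 \<le> 0") (simp_all add: sphere_fold_def power2_eq_square algebra_simps)
  have "(\<Sum>i\<in>{..d} - {0}. x i * sphere_fold x i) = (\<Sum>i\<in>{..d} - {0}. - 2 * ?n * (x i)\<^sup>2)"
    by (intro sum.cong refl) (simp add: sphere_fold_def power2_eq_square)
  also have "\<dots> = - 2 * ?n * (1 - (x 0)\<^sup>2)"
    by (simp only: sum_distrib_left[symmetric] S)
  finally show "(\<Sum>i\<le>d. x i * sphere_fold x i) = \<bar>x 0\<bar>"
    unfolding sum_upto_remove_0 by (cases "x 0 \<le> 0") (simp_all add: sphere_fold_def power2_eq_square algebra_simps)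
  show "sphere_fold x = base_pt" if "0 \<le> x 0"
    using that by (auto simp: sphere_fold_def base_pt_def)
qed

lemma sphere_push_norm_pos:
  fixes t a :: real
  assumes "0 \<le> t" "t \<le> 1"
  shows "0 < (1 - t)\<^sup>2 + t\<^sup>2 + 2 * t * (1 - t) * \<bar>a\<bar>"
proof -
  have "0 < (1 - t)\<^sup>2 + t\<^sup>2"
    by (cases "t = 0") (auto intro: add_nonneg_pos)
  moreover have "0 \<le> 2 * t * (1 - t) * \<bar>a\<bar>"
    using assms by simp
  ultimately show ?thesis
    by linarith
qed

lemma sphere_push_in_std_sphere:
  assumes "x \<in> std_sphere d" "t \<in> {0..1}"
  shows "sphere_push t x \<in> std_sphere d"
proof -
  let ?N = "(1 - t)\<^sup>2 + t\<^sup>2 + 2 * t * (1 - t) * \<bar>x 0\<bar>"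
  have N: "0 < ?N"
    using assms(2) by (intro sphere_push_norm_pos) auto
  have x: "(\<Sum>i\<le>d. (x i)\<^sup>2) = 1" "\<And>i. d < i \<Longrightarrow> x i = 0"
    using assms(1) by (auto simp: std_sphere_def)
  have "(\<Sum>j\<le>d. ((1 - t) * x j + t * sphere_fold x j)\<^sup>2) =
      (1 - t)\<^sup>2 * (\<Sum>j\<le>d. (x j)\<^sup>2) + t\<^sup>2 * (\<Sum>j\<le>d. (sphere_fold x j)\<^sup>2) + 2 * t * (1 - t) * (\<Sum>j\<le>d. x j * sphere_fold x j)"
    by (simp add: sum_distrib_left sum.distrib[symmetric] power2_eq_square algebra_simps)
  also have "\<dots> = ?N"
    using x sphere_fold_facts[OF assms(1)] by simp
  finally have "(\<Sum>j\<le>d. (sphere_push t x j)\<^sup>2) = ?N / ?N"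
    using N by (simp add: sphere_push_def power_divide sum_divide_distrib[symmetric])
  then show ?thesis
    using N x(2) by (auto simp: std_sphere_def sphere_push_def sphere_fold_def)
qed

lemma sphere_push_0: "sphere_push 0 x = x"
  by (simp add: sphere_push_def)

lemma sphere_push_1: "sphere_push 1 x = sphere_fold x"
  by (simp add: sphere_push_def)

lemma sphere_push_base: "t \<in> {0..1} \<Longrightarrow> sphere_push t base_pt = base_pt"
proof -
  have "(1 - t)\<^sup>2 + t\<^sup>2 + 2 * t * (1 - t) = 1"
    by (simp add: power2_eq_square algebra_simps)
  then show ?thesis
    by (auto simp: sphere_push_def sphere_fold_def base_pt_def)
qed

text \<open>Pasting along the two axes \<open>y = p\<close> and \<open>x = s\<close>; on their
  intersection \<open>F (t, s) = p\<close>.\<close>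

lemma continuous_on_axes_second:
  fixes S :: "'a::topological_space set" and T :: "'b::topological_space set"
  assumes "closed {s}" "closed {p}" and F: "continuous_on ({0..1} \<times> S) F" "\<And>t. t \<in> {0..1} \<Longrightarrow> F (t, s) = p"
  shows "continuous_on ({0..1::real} \<times> axes S s T p) (\<lambda>(t, (x, y)). if y = p then F (t, x) else y)"
proof -
  let ?W = "{0..1::real} \<times> axes S s T p"
  let ?A = "{z \<in> ?W. snd (snd z) = p}" and ?B = "{z \<in> ?W. fst (snd z) = s}"
  have cont: "continuous_on ?W (\<lambda>z. snd (snd z))" "continuous_on ?W (\<lambda>z. fst (snd z))"
    by (intro continuous_intros)+
  have W: "?A \<union> ?B = ?W"
    by (auto simp: axes_def)
  have "closedin (top_of_set ?W) ?A"
    using continuous_closedin_preimage[OF cont(1) assms(2)] by (simp add: vimage_def Int_def)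
  moreover have "closedin (top_of_set ?W) ?B"
    using continuous_closedin_preimage[OF cont(2) assms(1)] by (simp add: vimage_def Int_def)
  moreover have "continuous_on ?A (\<lambda>z. F (fst z, fst (snd z)))"
    by (rule continuous_on_compose2[OF F(1)]) (auto intro!: continuous_intros simp: axes_def)
  moreover have "continuous_on ?B (\<lambda>z. snd (snd z))"
    by (intro continuous_intros)
  ultimately have "continuous_on (?A \<union> ?B) (\<lambda>z. if snd (snd z) = p then F (fst z, fst (snd z)) else snd (snd z))"
    by (intro continuous_on_cases_local) (use F(2) in \<open>auto simp: W\<close>)
  then show ?thesis
    unfolding W by (simp add: case_prod_unfold)
qed

text \<open>A pointed space with a whisker map: \<open>\<Phi>\<close> is a pointed homotopy from the identity to a map which
  is constant where \<open>U \<noteq> 1\<close>, so that this part of the space can be used to run along a path.\<close>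

locale whiskered =
  fixes S :: "'a::topological_space set" and s :: 'a and \<Phi> :: "real \<times> 'a \<Rightarrow> 'a" and U :: "'a \<Rightarrow> real"
  assumes s: "s \<in> S" "closed {s}"
    and \<Phi>: "continuous_on ({0..1} \<times> S) \<Phi>" "\<Phi> \<in> {0..1} \<times> S \<rightarrow> S" "\<And>x. x \<in> S \<Longrightarrow> \<Phi> (0, x) = x"
      "\<And>t. t \<in> {0..1} \<Longrightarrow> \<Phi> (t, s) = s"
    and U: "continuous_on S U" "U \<in> S \<rightarrow> {0..1}" "U s = 0" "\<And>x. \<lbrakk>x \<in> S; U x \<noteq> 1\<rbrakk> \<Longrightarrow> \<Phi> (1, x) = s"
begin

text \<open>A point of the first summand is pushed by \<open>\<Phi>\<close> and sent along the path
  to \<open>\<gamma> (U x)\<close>; the second summand stays. The result lies on the axes at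
  \<open>\<gamma> 1\<close>, for either \<open>U x = 1\<close> or
  \<open>\<Phi> (1, x) = s\<close>.\<close>

definition slide :: "(real \<Rightarrow> 'b) \<Rightarrow> 'a \<times> 'b \<Rightarrow> 'a \<times> 'b" where
  "slide \<gamma> = (\<lambda>(x, y). (\<Phi> (1, x), if y = \<gamma> 0 then \<gamma> (U x) else y))"

lemma \<Phi>1: "x \<in> S \<Longrightarrow> \<Phi> (1, x) \<in> S"
  using \<Phi>(2) by auto

lemma U01: "x \<in> S \<Longrightarrow> 0 \<le> U x" "x \<in> S \<Longrightarrow> U x \<le> 1"
  using U(2) by auto

lemma slide_in_axes:
  assumes "\<gamma> \<in> {0..1} \<rightarrow> T"
  shows "slide \<gamma> \<in> axes S s T (\<gamma> 0) \<rightarrow> axes S s T (\<gamma> 1)"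
proof clarify
  fix x y assume "(x, y) \<in> axes S s T (\<gamma> 0)"
  then have xy: "x \<in> S" "y \<in> T" "x = s \<or> y = \<gamma> 0"
    by (auto simp: axes_def)
  moreover have "\<gamma> (U x) \<in> T"
    using assms U(2) xy(1) by auto
  ultimately show "slide \<gamma> (x, y) \<in> axes S s T (\<gamma> 1)"
    using \<Phi>1 \<Phi>(4)[of 1] U(4)[of x] by (cases "U x = 1") (auto simp: axes_def slide_def)
qed

lemma continuous_on_slide:
  fixes T :: "'b::topological_space set" and \<gamma> :: "real \<Rightarrow> 'b"
  assumes "continuous_on {0..1} \<gamma>" "closed {\<gamma> 0}"
  shows "continuous_on (axes S s T (\<gamma> 0)) (slide \<gamma>)"
proof -
  let ?W = "axes S s T (\<gamma> 0)"
  have "continuous_on ({0..1} \<times> S) (\<lambda>z. \<gamma> (U (snd z)))"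
    by (intro continuous_on_compose2[OF assms(1)] continuous_on_compose2[OF U(1)] continuous_intros)
      (use U(2) in auto)
  from continuous_on_axes_second[OF s(2) assms(2) this, of T]
  have "continuous_on ({0..1} \<times> ?W) (\<lambda>(t :: real, (x, y)). if y = \<gamma> 0 then \<gamma> (U x) else y)"
    using U(3) \<open>closed {\<gamma> 0}\<close> by (simp add: case_prod_unfold cong: if_cong)
  then have "continuous_on ?W (\<lambda>z. (\<lambda>(t :: real, (x, y)). if y = \<gamma> 0 then \<gamma> (U x) else y) (0, z))"
    by (rule continuous_on_compose2) (auto intro!: continuous_intros)
  moreover have "continuous_on ?W (\<lambda>z. \<Phi> (1, fst z))"
    by (rule continuous_on_compose2[OF \<Phi>(1)]) (auto intro!: continuous_intros simp: axes_def)
  ultimately show ?thesis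
    unfolding slide_def case_prod_unfold by (intro continuous_on_Pair) (simp_all cong: if_cong)
qed

text \<open>Going forth and back leaves the second coordinate of a point of the first summand at
  \<open>\<gamma> (U x - U (\<Phi> (1, x)))\<close>: if \<open>\<Phi> (1, x) \<noteq> s\<close>,
  then \<open>U x = 1\<close> and the return starts at \<open>\<gamma> 1\<close>; otherwise the
  second slide leaves it at \<open>\<gamma> (U x)\<close>. \<open>C\<close> shrinks the parameter to
  0, and \<open>B\<close> then undoes the two pushes.\<close>

lemma slide_slide_homotopic_id:
  fixes T :: "'b::topological_space set" and \<gamma> :: "real \<Rightarrow> 'b"
  assumes \<gamma>: "continuous_on {0..1} \<gamma>" "\<gamma> \<in> {0..1} \<rightarrow> T" and cl: "closed {\<gamma> 0}"
  shows "homotopic_with_canon (\<lambda>_. True) (axes S s T (\<gamma> 0)) (axes S s T (\<gamma> 0)) (slide (\<lambda>t. \<gamma> (1 - t)) \<circ> slide \<gamma>) id"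
proof -
  let ?p = "\<gamma> 0"
  let ?W = "axes S s T ?p" and ?I = "{0..1::real}"
  let ?\<phi> = "\<lambda>x. \<Phi> (1, x)"
  have diff: "U x - U (?\<phi> x) \<in> {0..1}" if "x \<in> S" for x
    using U01[OF that] U01[OF \<Phi>1[OF that]] U(3) U(4)[OF that] by (cases "U x = 1") auto
  have p_in: "\<gamma> 0 \<in> T"
    using \<gamma>(2) by auto
  define C where "C = (\<lambda>(t, (x, y)). (?\<phi> (?\<phi> x), if y = ?p then \<gamma> (t * (U x - U (?\<phi> x))) else y))"
  define B :: "real \<times> 'a \<times> 'b \<Rightarrow> 'a \<times> 'b" where "B = (\<lambda>(t, (x, y)). (\<Phi> (t, \<Phi> (t, x)), y))"
  have c\<phi>: "continuous_on S ?\<phi>"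
    by (rule continuous_on_compose2[OF \<Phi>(1)]) (auto intro!: continuous_intros)
  have cont_F: "continuous_on (?I \<times> S) (\<lambda>z. \<gamma> (fst z * (U (snd z) - U (?\<phi> (snd z)))))"
  proof (rule continuous_on_compose2[OF \<gamma>(1)])
    show "continuous_on (?I \<times> S) (\<lambda>z. fst z * (U (snd z) - U (?\<phi> (snd z))))"
      by (intro continuous_on_mult continuous_on_diff continuous_on_fst continuous_on_id
          continuous_on_compose2[OF U(1)] continuous_on_compose2[OF c\<phi>] continuous_on_snd)
        (use \<Phi>1 in auto)
    show "(\<lambda>z. fst z * (U (snd z) - U (?\<phi> (snd z)))) ` (?I \<times> S) \<subseteq> {0..1}"
      using diff by (auto intro!: mult_nonneg_nonneg mult_le_one)
  qed
  have "continuous_on (?I \<times> ?W) C"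
  proof -
    have "continuous_on (?I \<times> ?W) (\<lambda>(t, (x, y)). if y = ?p then \<gamma> (t * (U x - U (?\<phi> x))) else y)"
      using continuous_on_axes_second[OF s(2) cl cont_F, of T] \<Phi>(4)[of 1]
      by (simp add: case_prod_unfold cong: if_cong)
    moreover have "continuous_on (?I \<times> ?W) (\<lambda>z. ?\<phi> (?\<phi> (fst (snd z))))"
      by (intro continuous_on_compose2[OF c\<phi>] continuous_on_fst continuous_on_snd continuous_on_id)
        (use \<Phi>1 in \<open>auto simp: axes_def\<close>)
    ultimately show ?thesis
      unfolding C_def case_prod_unfold by (intro continuous_on_Pair)
  qed
  moreover have "C \<in> ?I \<times> ?W \<rightarrow> ?W"
  proof clarify
    fix t :: real and x y assume t: "t \<in> {0..1}" and "(x, y) \<in> ?W"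
    then have xy: "x \<in> S" "y \<in> T" "x = s \<or> y = ?p"
      by (auto simp: axes_def)
    have "t * (U x - U (?\<phi> x)) \<in> {0..1}"
      using diff[OF xy(1)] t by (auto intro!: mult_nonneg_nonneg mult_le_one)
    then have "\<gamma> (t * (U x - U (?\<phi> x))) \<in> T"
      using \<gamma>(2) by auto
    \<comment> \<open>In the second case the parameter is 0, so the second coordinate is
      \<open>\<gamma> 0\<close>.\<close>
    moreover have "?\<phi> (?\<phi> x) = s \<or> U x = 1 \<and> U (?\<phi> x) = 1"
      using U(4)[OF xy(1)] U(4)[OF \<Phi>1[OF xy(1)]] \<Phi>(4)[of 1] by auto
    ultimately show "C (t, (x, y)) \<in> ?W"
      using xy \<Phi>1 \<Phi>(4)[of 1] by (auto simp: C_def axes_def)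
  qed
  ultimately have "homotopic_with_canon (\<lambda>_. True) ?W ?W (\<lambda>z. C (0, z)) (\<lambda>z. C (1, z))"
    unfolding homotopic_with_def
    by (intro exI[of _ C]) (auto simp: continuous_map_in_subtopology)
  moreover have "homotopic_with_canon (\<lambda>_. True) ?W ?W (\<lambda>z. B (0, z)) (\<lambda>z. B (1, z))"
  proof -
    have "continuous_on (?I \<times> ?W) B"
      unfolding B_def case_prod_unfold
      by (intro continuous_on_Pair continuous_on_compose2[OF \<Phi>(1)] continuous_on_fst continuous_on_snd continuous_on_id)
        (use \<Phi>(2) in \<open>auto simp: axes_def\<close>)
    moreover have "B \<in> ?I \<times> ?W \<rightarrow> ?W"
      using \<Phi>(2,4) by (auto simp: B_def axes_def)
    ultimately show ?thesis
      unfolding homotopic_with_def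
      by (intro exI[of _ B]) (auto simp: continuous_map_in_subtopology)
  qed
  moreover have "C (0, z) = B (1, z)" for z
    by (auto simp: C_def B_def split: prod.split)
  moreover have "B (0, z) = id z" if "z \<in> ?W" for z
    using that \<Phi>(2,3) by (auto simp: B_def axes_def)
  moreover have "(slide (\<lambda>t. \<gamma> (1 - t)) \<circ> slide \<gamma>) z = C (1, z)" if zW: "z \<in> ?W" for z
  proof -
    obtain x y where z: "z = (x, y)" and xy: "x \<in> S" "y \<in> T" "x = s \<or> y = ?p"
      using zW by (auto simp: axes_def)
    show ?thesis
    proof (cases "y = ?p")
      case False
      then have "x = s"
        using xy by blast
      then show ?thesis
        using False \<Phi>(4)[of 1] U(3) by (auto simp: z slide_def C_def)
    next
      case True
      show ?thesis
      proof (cases "?\<phi> x = s")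
        case s: True
        then show ?thesis
          using True \<Phi>(4)[of 1] U(3) by (auto simp: z slide_def C_def)
      next
        case False
        then have "U x = 1"
          using U(4)[OF xy(1)] by blast
        then show ?thesis
          using True by (simp add: z slide_def C_def)
      qed
    qed
  qed
  ultimately show ?thesis
    by (smt (verit) homotopic_with_eq homotopic_with_symD homotopic_with_trans topspace_euclidean_subtopology)
qed

lemma axes_change_base:
  fixes T :: "'b::topological_space set" and \<gamma> :: "real \<Rightarrow> 'b"
  assumes \<gamma>: "continuous_on {0..1} \<gamma>" "\<gamma> \<in> {0..1} \<rightarrow> T" and cl: "closed {\<gamma> 0}" "closed {\<gamma> 1}"
  shows "top_of_set (axes S s T (\<gamma> 0)) homotopy_equivalent_space top_of_set (axes S s T (\<gamma> 1))"
proof -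
  define \<delta> where "\<delta> t = \<gamma> (1 - t)" for t
  have \<delta>: "continuous_on {0..1} \<delta>" "\<delta> \<in> {0..1} \<rightarrow> T" "\<delta> 0 = \<gamma> 1" "\<delta> 1 = \<gamma> 0"
    unfolding \<delta>_def using \<gamma>(2)
    by (auto intro!: continuous_on_compose2[OF \<gamma>(1)] continuous_intros)
  have \<gamma>\<delta>: "(\<lambda>t. \<delta> (1 - t)) = \<gamma>" "(\<lambda>t. \<gamma> (1 - t)) = \<delta>"
    by (auto simp: \<delta>_def)
  show ?thesis
    unfolding homotopy_equivalent_space_def
  proof (intro exI conjI)
    show "homotopic_with (\<lambda>x. True) (top_of_set (axes S s T (\<gamma> 0))) (top_of_set (axes S s T (\<gamma> 0))) (slide \<delta> \<circ> slide \<gamma>) id"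
      using slide_slide_homotopic_id[OF \<gamma> cl(1)] unfolding \<gamma>\<delta> .
    show "homotopic_with (\<lambda>x. True) (top_of_set (axes S s T (\<gamma> 1))) (top_of_set (axes S s T (\<gamma> 1))) (slide \<gamma> \<circ> slide \<delta>) id"
      using slide_slide_homotopic_id[OF \<delta>(1,2)] cl(2) unfolding \<gamma>\<delta> \<delta>(3) by blast
    show "continuous_map (top_of_set (axes S s T (\<gamma> 0))) (top_of_set (axes S s T (\<gamma> 1))) (slide \<gamma>)"
      using continuous_on_slide[OF \<gamma>(1) cl(1), of T] slide_in_axes[OF \<gamma>(2)] by (auto simp: continuous_map_in_subtopology)
    show "continuous_map (top_of_set (axes S s T (\<gamma> 1))) (top_of_set (axes S s T (\<gamma> 0))) (slide \<delta>)"
      using continuous_on_slide[OF \<delta>(1), of T] cl(2) slide_in_axes[OF \<delta>(2)] \<delta>(3,4) by (auto simp: continuous_map_in_subtopology)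
  qed
qed

end

text \<open>At most one coordinate is off the base point, so the sum is a single term. It is 1
  exactly where that coordinate has \<open>G i 0 \<le> 0\<close>; the hemisphere
  \<open>0 < G i 0\<close>, which \<open>sphere_fold\<close> crushes, serves as the whisker.\<close>

lemma whiskered_bouquet:
  "whiskered (bouquet d N) bouquet_base (\<lambda>(t, G) i. sphere_push t (G i)) (\<lambda>G. \<Sum>i<N. min 1 (1 - G i 0))"
proof
  let ?u = "\<lambda>x :: nat \<Rightarrow> real. min 1 (1 - x 0)"
  have bD: "G i \<in> std_sphere d" "N \<le> i \<Longrightarrow> G i = base_pt" "i \<noteq> j \<Longrightarrow> G i = base_pt \<or> G j = base_pt"
    if "G \<in> bouquet d N" for G i j
    using that unfolding bouquet_def by blast+
  have u0: "?u base_pt = 0"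
    by (simp add: base_pt_def)
  have sum_u: "(\<Sum>i<N. ?u (G i)) = ?u (G k)" if "G = (\<lambda>j. if j = k then G k else base_pt)" "k < N" for G k
  proof -
    have "(\<Sum>i<N. ?u (G i)) = (\<Sum>i<N. if i = k then ?u (G k) else 0)"
      by (intro sum.cong refl) (subst that(1), simp add: u0)
    then show ?thesis
      using that(2) by simp
  qed
  show "bouquet_base \<in> bouquet d N"
    by (rule bouquet_base_in_bouquet)
  show "closed {bouquet_base}"
    by simp
  have c2: "continuous_on A (\<lambda>G. G i j)" for A :: "(nat \<Rightarrow> nat \<Rightarrow> real) set" and i j
    by (rule continuous_on_product_then_coordinatewise[OF continuous_on_product_then_coordinatewise[OF continuous_on_id]])
  have c3: "continuous_on A (\<lambda>z. snd z i j)" for A :: "(real \<times> (nat \<Rightarrow> nat \<Rightarrow> real)) set" and i j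
    by (rule continuous_on_product_then_coordinatewise[OF continuous_on_product_then_coordinatewise[OF
          continuous_on_snd[OF continuous_on_id]]])
  show "continuous_on ({0..1} \<times> bouquet d N) (\<lambda>(t, G) i. sphere_push t (G i))"
    unfolding case_prod_unfold
  proof (intro continuous_on_coordinatewise_then_product)
    fix i j
    have fold: "continuous_on ({0..1::real} \<times> bouquet d N) (\<lambda>z. sphere_fold (snd z i) j)"
      unfolding sphere_fold_def
      by (cases "j = 0") (auto intro!: continuous_on_diff continuous_on_mult continuous_on_const continuous_on_power
          continuous_on_min continuous_on_minus c3)
    show "continuous_on ({0..1} \<times> bouquet d N) (\<lambda>z. sphere_push (fst z) (snd z i) j)"
      unfolding sphere_push_def
    proof (intro continuous_on_divide)
      show "\<forall>z\<in>{0..1} \<times> bouquet d N. sqrt ((1 - fst z)\<^sup>2 + (fst z)\<^sup>2 + 2 * fst z * (1 - fst z) * \<bar>snd z i 0\<bar>) \<noteq> 0"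
        using sphere_push_norm_pos by (auto simp: less_le)
    qed (intro continuous_on_add continuous_on_diff continuous_on_mult continuous_on_const continuous_on_power
          continuous_on_fst continuous_on_id continuous_on_real_sqrt continuous_on_rabs c3 fold)+
  qed
  show "(\<lambda>(t, G) i. sphere_push t (G i)) \<in> {0..1} \<times> bouquet d N \<rightarrow> bouquet d N"
  proof clarify
    fix t :: real and G :: "nat \<Rightarrow> nat \<Rightarrow> real" assume t: "t \<in> {0..1}" and G: "G \<in> bouquet d N"
    show "(\<lambda>i. sphere_push t (G i)) \<in> bouquet d N"
      unfolding bouquet_def mem_Collect_eq
      using bD[OF G] sphere_push_in_std_sphere[OF _ t] sphere_push_base[OF t] by metis
  qed
  show "(case (0, G) of (t, G) \<Rightarrow> \<lambda>i. sphere_push t (G i)) = G" for G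
    by (simp add: sphere_push_0)
  show "(case (t, bouquet_base) of (t, G) \<Rightarrow> \<lambda>i. sphere_push t (G i)) = bouquet_base" if "t \<in> {0..1}" for t
    using sphere_push_base[OF that] by (simp add: bouquet_base_def)
  show "continuous_on (bouquet d N) (\<lambda>G. \<Sum>i<N. ?u (G i))"
    by (intro continuous_on_sum continuous_on_min continuous_on_diff continuous_on_const c2)
  show "(\<Sum>i<N. ?u (bouquet_base i)) = 0"
    by (simp add: bouquet_base_def u0)
  show "(\<lambda>G. \<Sum>i<N. ?u (G i)) \<in> bouquet d N \<rightarrow> {0..1}"
  proof
    fix G assume G: "G \<in> bouquet d N"
    show "(\<Sum>i<N. ?u (G i)) \<in> {0..1}"
    proof (cases "G = bouquet_base")
      case True
      then show ?thesis
        by (simp add: bouquet_base_def u0)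
    next
      case False
      then obtain k where "k < N" "G = (\<lambda>j. if j = k then G k else base_pt)" "G k \<in> std_sphere d"
        using bouquet_cases[OF G] by blast
      then show ?thesis
        using sum_u[of G k] std_sphere_0_le_1[of "G k" d] by simp
    qed
  qed
  show "(case (1, G) of (t, G) \<Rightarrow> \<lambda>i. sphere_push t (G i)) = bouquet_base"
    if G: "G \<in> bouquet d N" and ne: "(\<Sum>i<N. ?u (G i)) \<noteq> 1" for G
  proof -
    have fold: "sphere_fold base_pt = base_pt"
      using sphere_fold_facts(3)[OF base_pt_in_std_sphere] by (simp add: base_pt_def)
    have "sphere_fold (G i) = base_pt" for i
    proof (cases "G = bouquet_base")
      case True
      then show ?thesis
        by (simp add: bouquet_base_def fold)
    next
      case False
      then obtain k where k: "k < N" "G = (\<lambda>j. if j = k then G k else base_pt)" "G k \<in> std_sphere d"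
        using bouquet_cases[OF G] by blast
      then have "0 \<le> G k 0"
        using ne sum_u[OF k(2,1)] by (auto simp: min_def split: if_splits)
      then have "sphere_fold (G k) = base_pt"
        by (rule sphere_fold_facts(3)[OF k(3)])
      then show ?thesis
        by (subst k(2)) (simp add: fold)
    qed
    then show ?thesis
      by (simp add: sphere_push_1 bouquet_base_def)
  qed
qed

lemma path_component_std_sphere:
  assumes "1 \<le> d" "x \<in> std_sphere d"
  shows "path_component (std_sphere d) x base_pt"
proof -
  define \<alpha> where "\<alpha> = arccos (x 0)"
  have cos: "cos \<alpha> = x 0" and "0 \<le> \<alpha>" "\<alpha> \<le> pi"
    using std_sphere_0_le_1[OF assms(2)] by (simp_all add: \<alpha>_def arccos_bounded)
  have S: "(\<Sum>i\<in>{..d} - {0}. (x i)\<^sup>2) = (sin \<alpha>)\<^sup>2"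
    using assms(2) sum_upto_remove_0[of "\<lambda>i. (x i)\<^sup>2" d] by (simp add: std_sphere_def sin_squared_eq cos)
  \<comment> \<open>The entries from 1 on form a unit vector, the direction of a great circle from
    \<open>base_pt\<close> through \<open>x\<close>. At the base point and its antipode the
    direction is free; coordinate 1 exists because \<open>1 \<le> d\<close>.\<close>
  define u where "u j = (if sin \<alpha> = 0 then if j = 1 then 1 else 0 else x j / sin \<alpha>)" for j :: nat
  have u: "(\<Sum>i\<in>{..d} - {0}. (u i)\<^sup>2) = 1"
  proof (cases "sin \<alpha> = 0")
    case True
    then have "(\<Sum>i\<in>{..d} - {0}. (u i)\<^sup>2) = (\<Sum>i\<in>{..d} - {0}. if i = 1 then 1 else 0)"
      by (intro sum.cong refl) (simp add: u_def)
    then show ?thesis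
      using assms(1) by simp
  next
    case False
    then show ?thesis
      using S by (simp add: u_def power_divide sum_divide_distrib[symmetric])
  qed
  have xu: "sin \<alpha> * u j = x j" if "j \<noteq> 0" for j
  proof (cases "sin \<alpha> = 0")
    case True
    then have "x j = 0" if "j \<le> d"
      using S \<open>j \<noteq> 0\<close> that sum_nonneg_eq_0_iff[of "{..d} - {0}" "\<lambda>i. (x i)\<^sup>2"] by simp
    moreover have "x j = 0" if "d < j"
      using assms(2) that by (simp add: std_sphere_def)
    ultimately show ?thesis
      using True by (metis mult_zero_left not_le)
  qed (simp add: u_def)
  have u_out: "u j = 0" if "d < j" for j
    using assms that by (auto simp: u_def std_sphere_def)
  define \<gamma> where "\<gamma> t = (\<lambda>j. if j = 0 then cos ((1 - t) * \<alpha>) else sin ((1 - t) * \<alpha>) * u j)" for t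
  have "continuous_on {0..1} \<gamma>"
  proof (rule continuous_on_coordinatewise_then_product)
    show "continuous_on {0..1} (\<lambda>t. \<gamma> t j)" for j
      unfolding \<gamma>_def by (cases "j = 0") (auto intro!: continuous_intros)
  qed
  moreover have "\<gamma> t \<in> std_sphere d" for t
  proof -
    have "(\<Sum>i\<in>{..d} - {0}. (\<gamma> t i)\<^sup>2) = (\<Sum>i\<in>{..d} - {0}. (sin ((1 - t) * \<alpha>))\<^sup>2 * (u i)\<^sup>2)"
      by (intro sum.cong refl) (simp add: \<gamma>_def power_mult_distrib)
    also have "\<dots> = (sin ((1 - t) * \<alpha>))\<^sup>2"
      by (simp add: sum_distrib_left[symmetric] u)
    finally have "(\<Sum>i\<le>d. (\<gamma> t i)\<^sup>2) = 1"
      unfolding sum_upto_remove_0 by (simp add: \<gamma>_def)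
    then show ?thesis
      using u_out by (simp add: std_sphere_def \<gamma>_def)
  qed
  moreover have "\<gamma> 0 = x"
    using cos xu by (auto simp: \<gamma>_def)
  moreover have "\<gamma> 1 = base_pt"
    by (auto simp: \<gamma>_def base_pt_def)
  ultimately show ?thesis
    unfolding path_component_def path_def path_image_def pathstart_def pathfinish_def by blast
qed

lemma path_component_continuous_image:
  assumes "continuous_on S f" "path_component S x y"
  shows "path_component (f ` S) (f x) (f y)"
proof -
  obtain g where "path g" "path_image g \<subseteq> S" "pathstart g = x" "pathfinish g = y"
    using assms(2) unfolding path_component_def by blast
  then show ?thesis
    unfolding path_component_def
    using path_continuous_image[of g f] continuous_on_subset[OF assms(1)]
    by (intro exI[of _ "f \<circ> g"]) (auto simp: path_image_compose pathstart_compose pathfinish_compose)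
qed

lemma path_component_bouquet:
  assumes "1 \<le> d" "G \<in> bouquet d N"
  shows "path_component (bouquet d N) G bouquet_base"
proof (cases "G = bouquet_base")
  case True
  then show ?thesis
    using assms(2) by (simp add: path_component_refl)
next
  case False
  then obtain k where k: "k < N" "G k \<in> std_sphere d" "G = (\<lambda>j. if j = k then G k else base_pt)"
    using bouquet_cases[OF assms(2)] by blast
  let ?i = "\<lambda>x j. if j = k then x else base_pt"
  have "continuous_on (std_sphere d) ?i"
  proof (rule continuous_on_coordinatewise_then_product)
    show "continuous_on (std_sphere d) (\<lambda>x. if j = k then x else base_pt)" for j
      by (cases "j = k") simp_all
  qed
  then have "path_component (?i ` std_sphere d) (?i (G k)) (?i base_pt)"
    by (rule path_component_continuous_image[OF _ path_component_std_sphere[OF assms(1) k(2)]])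
  moreover have "?i ` std_sphere d \<subseteq> bouquet d N"
    using k(1) base_pt_in_std_sphere[of d] by (auto simp: bouquet_def)
  ultimately have "path_component (bouquet d N) (?i (G k)) (?i base_pt)"
    by (rule path_component_of_subset[rotated])
  moreover have "?i (G k) = G"
    using k(3) by simp
  moreover have "?i base_pt = bouquet_base"
    by (auto simp: bouquet_base_def)
  ultimately show ?thesis
    by simp
qed

text \<open>The homotopy from \<open>g \<circ> f\<close> to the identity joins
  \<open>g (f p)\<close> to \<open>p\<close>, and \<open>g\<close> carries a path from
  \<open>f p\<close> to \<open>b\<close> to one ending at \<open>t\<close>.\<close>

lemma pointed_heq_path_component:
  assumes "pointed_heq T t B b" "\<And>y. y \<in> B \<Longrightarrow> path_component B y b" "p \<in> T"
  shows "path_component T p t"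
proof -
  obtain f g where fg: "f \<in> T \<rightarrow> B" "continuous_on B g" "g \<in> B \<rightarrow> T" "g b = t"
     and hom: "homotopic_with_canon (\<lambda>k. k t = t) T T (g \<circ> f) id"
    using assms(1) unfolding pointed_heq_def by blast
  obtain h where h: "continuous_on ({0..1::real} \<times> T) h" "h \<in> {0..1} \<times> T \<rightarrow> T"
      "\<And>x. h (0, x) = (g \<circ> f) x" "\<And>x. h (1, x) = id x"
    using hom by (rule homotopic_with_pointE) (rule that)
  have "continuous_on {0..1} (\<lambda>u. h (u, p))"
    by (rule continuous_on_compose2[OF h(1)]) (use assms(3) in \<open>auto intro!: continuous_intros\<close>)
  then have "path_component T (g (f p)) p"
    unfolding path_component_def path_def path_image_def pathstart_def pathfinish_def
    using h(2-4) assms(3) by (intro exI[of _ "\<lambda>u. h (u, p)"]) auto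
  moreover have "path_component (g ` B) (g (f p)) (g b)"
    using fg(1) assms(2,3) by (intro path_component_continuous_image[OF fg(2)]) auto
  then have "path_component T (g (f p)) t"
    using fg(3,4) path_component_of_subset[of "g ` B" T] by auto
  ultimately show ?thesis
    using path_component_sym path_component_trans by metis
qed

section \<open>The Vietoris-Rips complexes and the theorem\<close>

lemma closed_singleton_fun: "closed {x :: 'a \<Rightarrow> real}"
proof -
  have "{x} = (\<Inter>v. {f. f v = x v})"
    by auto
  moreover have "closed (\<Inter>v. {f :: 'a \<Rightarrow> real. f v = x v})"
    by (intro closed_INT closed_Collect_eq ballI continuous_intros) simp_all
  ultimately show ?thesis
    by simp
qed

lemma finite_subsets_upto: "finite (subsets_upto m n)"
  by (rule finite_subset[of _ "Pow {1..m}"]) (auto simp: subsets_upto_def)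

lemma VR_subsets_eq_realization_set:
  "VR_subsets m n 2 = top_of_set (realization_set (flag_complex (subsets_upto m n)))"
  unfolding VR_subsets_def vietoris_rips_symdiff_dist[OF finite_subsets_upto]
  by (intro geometric_realization_eq_realization_set abstract_complex_flag_complex finite_subsets_upto)

lemma pointed_heq_VR_subsets:
  "pointed_heq (realization_set (flag_complex (subsets_upto m n))) (vertex_point {})
     (bouquet 3 (\<Sum>k=1..n. t_coeff m k)) bouquet_base"
  by (intro pointed_heq_bouquet abstract_complex_flag_complex finite_subsets_upto reduces_flag_complex_to_point)

theorem theorem16:
  fixes m n :: nat
  assumes "n > 2" and "m \<ge> n"
  shows "(\<forall>p \<in> topspace (VR_subsets m (n - 1) 2).
            VR_subsets m n 2 homotopy_equivalent_space
              wedge (sphere_bouquet 3 (t_coeff m n)) None (VR_subsets m (n - 1) 2) p)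
       \<and> VR_subsets m n 2 homotopy_equivalent_space
              sphere_bouquet 3 (\<Sum>k = 3..n. t_coeff m k)"
proof -
  \<comment> \<open>The sums start at 1 because the reductions go down to the vertex
    \<open>{}\<close>; \<open>t_coeff m 1\<close> and \<open>t_coeff m 2\<close> are 0.\<close>
  define s where "s j = (\<Sum>k=1..j. t_coeff m k)" for j
  let ?T = "\<lambda>j. realization_set (flag_complex (subsets_upto m j))"
  have VR_bouquet: "VR_subsets m n 2 homotopy_equivalent_space top_of_set (bouquet 3 (s n))"
    unfolding VR_subsets_eq_realization_set s_def
    by (rule pointed_heq_imp_homotopy_equivalent_space[OF pointed_heq_VR_subsets])
  have "s n = (\<Sum>k = 3..n. t_coeff m k)"
    unfolding s_def by (intro sum.mono_neutral_right) (auto intro!: t_coeff_less_3)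
  then have "VR_subsets m n 2 homotopy_equivalent_space sphere_bouquet 3 (\<Sum>k = 3..n. t_coeff m k)"
    using VR_bouquet homeomorphic_map_imp_homeomorphic_space[OF homeomorphic_map_sphere_bouquet(2)]
    by (metis homeomorphic_imp_homotopy_equivalent_space homeomorphic_space_sym homotopy_eqv_trans)
  moreover have "VR_subsets m n 2 homotopy_equivalent_space
      wedge (sphere_bouquet 3 (t_coeff m n)) None (VR_subsets m (n - 1) 2) p"
    if "p \<in> topspace (VR_subsets m (n - 1) 2)" for p
  proof -
    let ?S = "bouquet 3 (t_coeff m n)" and ?w = "vertex_point {} :: nat set \<Rightarrow> real"
    have p: "p \<in> ?T (n - 1)"
      using that unfolding VR_subsets_eq_realization_set by simp
    have eq: "pointed_heq (?T (n - 1)) ?w (bouquet 3 (s (n - 1))) bouquet_base"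
      unfolding s_def by (rule pointed_heq_VR_subsets)
    have "wedge (sphere_bouquet 3 (t_coeff m n)) None (top_of_set (?T (n - 1))) p homeomorphic_space
        top_of_set (axes ?S bouquet_base (?T (n - 1)) p)"
    proof (rule homeomorphic_space_wedge_axes[OF homeomorphic_map_sphere_bouquet])
      show "None \<in> topspace (sphere_bouquet 3 (t_coeff m n))"
        unfolding sphere_bouquet_def wedge_family_def by (subst topspace_final_topology) auto
      show "bouquet_map None = bouquet_base"
        by (simp add: bouquet_map_def)
      show "compact (?T (n - 1))"
        by (intro compact_realization_set abstract_complex_flag_complex finite_subsets_upto)
    qed (use p Hausdorff_space_fun in auto)
    then have 1: "wedge (sphere_bouquet 3 (t_coeff m n)) None (top_of_set (?T (n - 1))) p homotopy_equivalent_space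
        top_of_set (axes ?S bouquet_base (?T (n - 1)) p)"
      by (rule homeomorphic_imp_homotopy_equivalent_space)
    have "path_component (?T (n - 1)) p ?w"
      by (rule pointed_heq_path_component[OF eq path_component_bouquet p]) simp_all
    then obtain \<gamma> where \<gamma>: "continuous_on {0..1::real} \<gamma>" "\<gamma> \<in> {0..1} \<rightarrow> ?T (n - 1)" "\<gamma> 0 = p" "\<gamma> 1 = ?w"
      unfolding path_component_def path_def path_image_def pathstart_def pathfinish_def by blast
    \<comment> \<open>\<open>p\<close> is arbitrary, while the bouquet equivalence of the smaller
      complex is pointed only at \<open>{}\<close>; the bouquet of \<open>t_coeff m n\<close>
      spheres supplies the whiskers for the move.\<close>
    have 2: "top_of_set (axes ?S bouquet_base (?T (n - 1)) p) homotopy_equivalent_space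
        top_of_set (axes ?S bouquet_base (?T (n - 1)) ?w)"
      using whiskered.axes_change_base[OF whiskered_bouquet \<gamma>(1,2), of 3 "t_coeff m n"]
      unfolding \<gamma>(3,4) by (simp add: closed_singleton_fun)
    have 3: "top_of_set (axes ?S bouquet_base (?T (n - 1)) ?w) homotopy_equivalent_space
        top_of_set (axes ?S bouquet_base (bouquet 3 (s (n - 1))) bouquet_base)"
      by (rule pointed_heq_imp_homotopy_equivalent_space[OF pointed_heq_axes[OF bouquet_base_in_bouquet eq]])
    have "t_coeff m n + s (n - 1) = s n"
      using assms(1) by (cases n) (simp_all add: s_def)
    then have 4: "top_of_set (axes ?S bouquet_base (bouquet 3 (s (n - 1))) bouquet_base) homotopy_equivalent_space
        top_of_set (bouquet 3 (s n))"
      using homeomorphic_space_axes_bouquet[of 3 "t_coeff m n" "s (n - 1)"]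
      by (simp add: homeomorphic_imp_homotopy_equivalent_space)
    have "wedge (sphere_bouquet 3 (t_coeff m n)) None (top_of_set (?T (n - 1))) p homotopy_equivalent_space
        top_of_set (bouquet 3 (s n))"
      by (rule homotopy_eqv_trans[OF 1 homotopy_eqv_trans[OF 2 homotopy_eqv_trans[OF 3 4]]])
    then show ?thesis
      unfolding VR_subsets_eq_realization_set[of m "n - 1"]
      using VR_bouquet homotopy_eqv_trans homotopy_equivalent_space_sym by blast
  qed
  ultimately show ?thesis
    by blast
qed

end
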